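(* Let $(V,h)$ be a 3-dimensional oriented Euclidean vector space, endowed with an $h$-symmetric endomorphism $S$ and a bilinear map $K:V\times V\to V$ such that $h(K(X,Y),Z)$ is totally symmetric in $X,Y,Z\in V$ and $\operatorname{trace}K_X=0$ for all $X\in V$. Let $$G=\{g\in SO(V,h) : K(gX,gY)=g(K(X,Y)),\ S(gX)=g(SX)\ \text{ for all } X,Y\in V\}$$ and assume that $G$ is non-trivial. Then $G$ is isomorphic to one of $SO(3)$, "$Z_2\times SO(2)$" (the group generated by all rotations about one axis together with a rotation by $\pi$ about an orthogonal axis), $SO(2)$, $A_4$, $S_3$, $Z_2\times Z_2$, $Z_3$ or $Z_2$. Moreover, there is an orthonormal basis $\{e_1,e_2,e_3\}$ of $V$ with respect to which (all matrices being taken in this basis) one of the following holds: (i) $K=0$, $S=aI$; in this case $G=SO(3)$. (ii) $K=0$, $S=\begin{pmatrix} a&0&0\\0&b&0\\0&0&b\end{pmatrix}$ with $a\neq b$; in this case $G$ is the group "$Z_2\times SO(2)$" consisting of the rotations in the $e_2e_3$-plane together with $P_2$ (i.e. generated by them). (iii) $K_{e_1}=\begin{pmatrix}2\lambda&0&0\\0&-\lambda&0\\0&0&-\lambda\end{pmatrix}$, $K_{e_2}=\begin{pmatrix}0&-\lambda&0\\-\lambda&0&0\\0&0&0\end{pmatrix}$, $K_{e_3}=\begin{pmatrix}0&0&-\lambda\\0&0&0\\-\lambda&0&0\end{pmatrix}$, $S=\begin{pmatrix}a&0&0\\0&b&0\\0&0&b\end{pmatrix}$, $\lambda>0$; in this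 case $G=SO(2)$, consisting of all rotations in the $e_2e_3$-plane. (iv) $K_{e_1}=\begin{pmatrix}0&0&0\\0&0&\lambda\\0&\lambda&0\end{pmatrix}$, $K_{e_2}=\begin{pmatrix}0&0&\lambda\\0&0&0\\\lambda&0&0\end{pmatrix}$, $K_{e_3}=\begin{pmatrix}0&\lambda&0\\\lambda&0&0\\0&0&0\end{pmatrix}$, $S=aI$, $\lambda>0$; in this case $G=\langle P_1,P_2,Q\rangle\cong A_4$. (v) $K_{e_1}=\begin{pmatrix}\lambda&0&0\\0&-\lambda&0\\0&0&0\end{pmatrix}$, $K_{e_2}=\begin{pmatrix}0&-\lambda&0\\-\lambda&0&0\\0&0&0\end{pmatrix}$, $K_{e_3}=0$, $S=\begin{pmatrix}a&0&0\\0&a&0\\0&0&b\end{pmatrix}$, $\lambda>0$; in this case $G=\langle P_1,R_3\rangle\cong S_3$. (vi) $K_{e_1}=\begin{pmatrix}0&0&0\\0&0&\lambda\\0&\lambda&0\end{pmatrix}$, $K_{e_2}=\begin{pmatrix}0&0&\lambda\\0&0&0\\\lambda&0&0\end{pmatrix}$, $K_{e_3}=\begin{pmatrix}0&\lambda&0\\\lambda&0&0\\0&0&0\end{pmatrix}$, $S=\begin{pmatrix}a&0&0\\0&b&0\\0&0&c\end{pmatrix}$, where either $\lambda>0$ and $a,b,c$ are not all equal, or $\lambda=0$ and $a,b,c$ are distinct; in this case $G=\langle P_1,P_2\rangle\cong Z_2\times Z_2$. (vii) $K_{e_1}=\begin{pmatrix}2\lambda&0&0\\0&-\lambda&0\\0&0&-\lambda\end{pmatrix}$,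 $K_{e_2}=\begin{pmatrix}0&-\lambda&0\\-\lambda&\mu&0\\0&0&-\mu\end{pmatrix}$, $K_{e_3}=\begin{pmatrix}0&0&-\lambda\\0&0&-\mu\\-\lambda&-\mu&0\end{pmatrix}$, $S=\begin{pmatrix}a&0&0\\0&b&0\\0&0&b\end{pmatrix}$, where either $\lambda>0$, $\mu>0$ and $\mu\neq\sqrt2\lambda$, or $\mu=\sqrt2\lambda>0$ and $a\neq b$; in this case $G=\langle R_1\rangle\cong Z_3$. (viii) $K_{e_1}=\begin{pmatrix}2\lambda&0&0\\0&-\lambda&\mu\\0&\mu&-\lambda\end{pmatrix}$, $K_{e_2}=\begin{pmatrix}0&-\lambda&\mu\\-\lambda&0&0\\\mu&0&0\end{pmatrix}$, $K_{e_3}=\begin{pmatrix}0&\mu&-\lambda\\\mu&0&0\\-\lambda&0&0\end{pmatrix}$, $S=\begin{pmatrix}a&0&0\\0&b&d\\0&d&c\end{pmatrix}$, where either $\lambda>0$, $\mu>0$ and $\lambda\neq\mu$, or $\lambda=\mu>0$ and $(b-c)^2+(b+c-2a-2d)^2\neq0$, or $\lambda=0$, $\mu>0$ and $d\neq0$, or $\mu=0$, $\lambda>0$ and $(b-c)^2+d^2\neq0$; in this case $G=\langle P_1\rangle\cong Z_2$.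
   Context: $K_X$ denotes the endomorphism $Y\mapsto K(X,Y)$. All parameters $a,b,c,d,\lambda,\mu$ are real. For an orthonormal basis $\{e_1,e_2,e_3\}$ with coordinates $x,y,z$: $P_i$ is the rotation by the angle $\pi$ about $e_i$, $R_i$ is the rotation by the angle $2\pi/3$ about $e_i$, and $Q$ is the rotation by the angle $2\pi/3$ about the line $x=y=z$. *)

theory Defs
  imports
    "HOL-Analysis.Analysis"
    "HOL-Algebra.Sym_Groups"
    "HOL-Algebra.Elementary_Groups"
begin

text \<open>
  The Euclidean space \<open>(V, h)\<close> is a type of class \<open>euclidean_space\<close>, with \<open>h\<close> its inner product
  and \<open>DIM('a) = 3\<close>. The library has the trace and the determinant only for matrices, so they are
  defined here for endomorphisms, in terms of the distinguished orthonormal basis \<open>Basis\<close>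
  (the determinant by the Leibniz formula).
\<close>

definition endo_trace :: "('a::euclidean_space \<Rightarrow> 'a) \<Rightarrow> real" where
  "endo_trace f = (\<Sum>b\<in>Basis. f b \<bullet> b)"

definition endo_det :: "('a::euclidean_space \<Rightarrow> 'a) \<Rightarrow> real" where
  "endo_det f = (\<Sum>p | p permutes Basis. of_int (sign p) * (\<Prod>b\<in>Basis. f (p b) \<bullet> b))"

definition totally_symmetric :: "('a::real_inner \<Rightarrow> 'a \<Rightarrow> 'a) \<Rightarrow> bool" where
  "totally_symmetric K \<longleftrightarrow>
     (\<forall>X Y Z. K X Y \<bullet> Z = K Y X \<bullet> Z \<and> K X Y \<bullet> Z = K X Z \<bullet> Y)"

definition special_orthogonal_group :: "('a::euclidean_space \<Rightarrow> 'a) monoid" where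
  "special_orthogonal_group =
     \<lparr>carrier = {g. orthogonal_transformation g \<and> endo_det g = 1}, monoid.mult = (\<circ>), one = id\<rparr>"

definition stabilizer_group ::
  "('a::euclidean_space \<Rightarrow> 'a) \<Rightarrow> ('a \<Rightarrow> 'a \<Rightarrow> 'a) \<Rightarrow> ('a \<Rightarrow> 'a) monoid" where
  "stabilizer_group S K =
     special_orthogonal_group
       \<lparr>carrier := {g \<in> carrier special_orthogonal_group.
          (\<forall>X Y. K (g X) (g Y) = g (K X Y)) \<and> (\<forall>X. S (g X) = g (S X))}\<rparr>"

text \<open>
  An orientation of a 3-dimensional Euclidean space is given by its volume form, i.e. one of the
  two alternating trilinear forms with values \<open>\<plusminus>1\<close> on orthonormal bases.
\<close>

definition volume_form :: "('a::euclidean_space \<Rightarrow> 'a \<Rightarrow> 'a \<Rightarrow> real) \<Rightarrow> bool" where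
  "volume_form \<omega> \<longleftrightarrow>
     (\<forall>v w. linear (\<lambda>u. \<omega> u v w)) \<and> (\<forall>u w. linear (\<lambda>v. \<omega> u v w)) \<and>
     (\<forall>u v. linear (\<lambda>w. \<omega> u v w)) \<and>
     (\<forall>u v. \<omega> u u v = 0 \<and> \<omega> u v u = 0 \<and> \<omega> u v v = 0) \<and>
     (\<forall>u v w. norm u = 1 \<and> norm v = 1 \<and> norm w = 1 \<and> u \<bullet> v = 0 \<and> u \<bullet> w = 0 \<and> v \<bullet> w = 0
        \<longrightarrow> \<bar>\<omega> u v w\<bar> = 1)"

text \<open>The vector representing the linear form \<open>\<omega> u v\<close>.\<close>

definition cross_product ::
  "('a::euclidean_space \<Rightarrow> 'a \<Rightarrow> 'a \<Rightarrow> real) \<Rightarrow> 'a \<Rightarrow> 'a \<Rightarrow> 'a" where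
  "cross_product \<omega> u v = (\<Sum>b\<in>Basis. \<omega> u v b *\<^sub>R b)"

text \<open>
  The rotation by the angle \<open>\<theta>\<close> about the axis directed by the unit vector \<open>u\<close>, in the sense given
  by the orientation (Rodrigues' formula).
\<close>

definition rotation ::
  "('a::euclidean_space \<Rightarrow> 'a \<Rightarrow> 'a \<Rightarrow> real) \<Rightarrow> 'a \<Rightarrow> real \<Rightarrow> 'a \<Rightarrow> 'a" where
  "rotation \<omega> u \<theta> v =
     cos \<theta> *\<^sub>R v + sin \<theta> *\<^sub>R cross_product \<omega> u v + ((1 - cos \<theta>) * (u \<bullet> v)) *\<^sub>R u"

definition orthonormal_basis :: "(3 \<Rightarrow> 'a::euclidean_space) \<Rightarrow> bool" where
  "orthonormal_basis e \<longleftrightarrow>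
     (\<forall>i j. e i \<bullet> e j = (if i = j then 1 else 0)) \<and> span (range e) = UNIV"

text \<open>For an orthonormal basis \<open>e\<close>: the \<open>j\<close>-th column holds the coordinates of \<open>f (e j)\<close>.\<close>

definition matrix_wrt ::
  "(3 \<Rightarrow> 'a::euclidean_space) \<Rightarrow> ('a \<Rightarrow> 'a) \<Rightarrow> real^3^3" where
  "matrix_wrt e f = (\<chi> i j. e i \<bullet> f (e j))"

definition rot_P ::
  "('a::euclidean_space \<Rightarrow> 'a \<Rightarrow> 'a \<Rightarrow> real) \<Rightarrow> (3 \<Rightarrow> 'a) \<Rightarrow> 3 \<Rightarrow> 'a \<Rightarrow> 'a" where
  "rot_P \<omega> e i = rotation \<omega> (e i) pi"

definition rot_R ::
  "('a::euclidean_space \<Rightarrow> 'a \<Rightarrow> 'a \<Rightarrow> real) \<Rightarrow> (3 \<Rightarrow> 'a) \<Rightarrow> 3 \<Rightarrow> 'a \<Rightarrow> 'a" where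
  "rot_R \<omega> e i = rotation \<omega> (e i) (2 * pi / 3)"

text \<open>
  The line \<open>x = y = z\<close> is directed by \<open>e 1 + e 2 + e 3\<close>. The opposite direction would give the
  inverse rotation, and hence the same generated groups.
\<close>

definition rot_Q ::
  "('a::euclidean_space \<Rightarrow> 'a \<Rightarrow> 'a \<Rightarrow> real) \<Rightarrow> (3 \<Rightarrow> 'a) \<Rightarrow> 'a \<Rightarrow> 'a" where
  "rot_Q \<omega> e = rotation \<omega> ((1 / sqrt 3) *\<^sub>R (e 1 + e 2 + e 3)) (2 * pi / 3)"

text \<open>
  \<open>subgroup_generated\<close> intersects the generating set with the carrier, which has no effect on
  the sets of rotations used here.
\<close>

abbreviation generated_by :: "('a::euclidean_space \<Rightarrow> 'a) set \<Rightarrow> ('a \<Rightarrow> 'a) monoid" where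
  "generated_by A \<equiv> subgroup_generated special_orthogonal_group A"

abbreviation model_SO3 :: "(real^3 \<Rightarrow> real^3) monoid" where
  "model_SO3 \<equiv> special_orthogonal_group"

abbreviation model_SO2 :: "(real^2 \<Rightarrow> real^2) monoid" where
  "model_SO2 \<equiv> special_orthogonal_group"

text \<open>
  ``\<open>Z\<^sub>2 \<times> SO(2)\<close>'' is not a direct product: it is generated by all rotations about the first
  coordinate axis of \<open>\<real>\<^sup>3\<close> and the rotation by \<open>\<pi>\<close> about the second.
\<close>

definition model_Z2_SO2 :: "(real^3 \<Rightarrow> real^3) monoid" where
  "model_Z2_SO2 =
     (let \<omega> = (\<lambda>u v w. det (vector [u, v, w] :: real^3^3))
      in generated_by (range (rotation \<omega> (axis 1 1)) \<union> {rotation \<omega> (axis 2 1) pi}))"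

abbreviation model_A4 :: "(nat \<Rightarrow> nat) monoid" where
  "model_A4 \<equiv> alt_group 4"

abbreviation model_S3 :: "(nat \<Rightarrow> nat) monoid" where
  "model_S3 \<equiv> sym_group 3"

abbreviation model_Z2_Z2 :: "(int \<times> int) monoid" where
  "model_Z2_Z2 \<equiv> integer_mod_group 2 \<times>\<times> integer_mod_group 2"

abbreviation model_Z3 :: "int monoid" where
  "model_Z3 \<equiv> integer_mod_group 3"

abbreviation model_Z2 :: "int monoid" where
  "model_Z2 \<equiv> integer_mod_group 2"

text \<open>
  The normal forms of \<open>(S, K)\<close> in an orthonormal basis \<open>e\<close>, named after the corresponding group.
  The inner vectors are the rows of the matrices.
\<close>

definition type_SO3 ::
  "('a::euclidean_space \<Rightarrow> 'a) \<Rightarrow> ('a \<Rightarrow> 'a \<Rightarrow> 'a) \<Rightarrow> (3 \<Rightarrow> 'a) \<Rightarrow> bool" where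
  "type_SO3 S K e \<longleftrightarrow> (\<exists>a :: real.
     K = (\<lambda>X Y. 0) \<and>
     S = (\<lambda>X. a *\<^sub>R X))"

definition type_Z2_SO2 ::
  "('a::euclidean_space \<Rightarrow> 'a) \<Rightarrow> ('a \<Rightarrow> 'a \<Rightarrow> 'a) \<Rightarrow> (3 \<Rightarrow> 'a) \<Rightarrow> bool" where
  "type_Z2_SO2 S K e \<longleftrightarrow> (\<exists>a b :: real.
     K = (\<lambda>X Y. 0) \<and>
     matrix_wrt e S = vector [vector [a, 0, 0], vector [0, b, 0], vector [0, 0, b]] \<and>
     a \<noteq> b)"

definition type_SO2 ::
  "('a::euclidean_space \<Rightarrow> 'a) \<Rightarrow> ('a \<Rightarrow> 'a \<Rightarrow> 'a) \<Rightarrow> (3 \<Rightarrow> 'a) \<Rightarrow> bool" where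
  "type_SO2 S K e \<longleftrightarrow> (\<exists>lam a b :: real.
     matrix_wrt e (K (e 1)) = vector [vector [2*lam, 0, 0], vector [0, -lam, 0], vector [0, 0, -lam]] \<and>
     matrix_wrt e (K (e 2)) = vector [vector [0, -lam, 0], vector [-lam, 0, 0], vector [0, 0, 0]] \<and>
     matrix_wrt e (K (e 3)) = vector [vector [0, 0, -lam], vector [0, 0, 0], vector [-lam, 0, 0]] \<and>
     matrix_wrt e S = vector [vector [a, 0, 0], vector [0, b, 0], vector [0, 0, b]] \<and>
     lam > 0)"

definition type_A4 ::
  "('a::euclidean_space \<Rightarrow> 'a) \<Rightarrow> ('a \<Rightarrow> 'a \<Rightarrow> 'a) \<Rightarrow> (3 \<Rightarrow> 'a) \<Rightarrow> bool" where
  "type_A4 S K e \<longleftrightarrow> (\<exists>lam a :: real.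
     matrix_wrt e (K (e 1)) = vector [vector [0, 0, 0], vector [0, 0, lam], vector [0, lam, 0]] \<and>
     matrix_wrt e (K (e 2)) = vector [vector [0, 0, lam], vector [0, 0, 0], vector [lam, 0, 0]] \<and>
     matrix_wrt e (K (e 3)) = vector [vector [0, lam, 0], vector [lam, 0, 0], vector [0, 0, 0]] \<and>
     S = (\<lambda>X. a *\<^sub>R X) \<and>
     lam > 0)"

definition type_S3 ::
  "('a::euclidean_space \<Rightarrow> 'a) \<Rightarrow> ('a \<Rightarrow> 'a \<Rightarrow> 'a) \<Rightarrow> (3 \<Rightarrow> 'a) \<Rightarrow> bool" where
  "type_S3 S K e \<longleftrightarrow> (\<exists>lam a b :: real.
     matrix_wrt e (K (e 1)) = vector [vector [lam, 0, 0], vector [0, -lam, 0], vector [0, 0, 0]] \<and>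
     matrix_wrt e (K (e 2)) = vector [vector [0, -lam, 0], vector [-lam, 0, 0], vector [0, 0, 0]] \<and>
     K (e 3) = (\<lambda>Y. 0) \<and>
     matrix_wrt e S = vector [vector [a, 0, 0], vector [0, a, 0], vector [0, 0, b]] \<and>
     lam > 0)"

definition type_Z2_Z2 ::
  "('a::euclidean_space \<Rightarrow> 'a) \<Rightarrow> ('a \<Rightarrow> 'a \<Rightarrow> 'a) \<Rightarrow> (3 \<Rightarrow> 'a) \<Rightarrow> bool" where
  "type_Z2_Z2 S K e \<longleftrightarrow> (\<exists>lam a b c :: real.
     matrix_wrt e (K (e 1)) = vector [vector [0, 0, 0], vector [0, 0, lam], vector [0, lam, 0]] \<and>
     matrix_wrt e (K (e 2)) = vector [vector [0, 0, lam], vector [0, 0, 0], vector [lam, 0, 0]] \<and>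
     matrix_wrt e (K (e 3)) = vector [vector [0, lam, 0], vector [lam, 0, 0], vector [0, 0, 0]] \<and>
     matrix_wrt e S = vector [vector [a, 0, 0], vector [0, b, 0], vector [0, 0, c]] \<and>
     (lam > 0 \<and> \<not> (a = b \<and> b = c) \<or>
      lam = 0 \<and> a \<noteq> b \<and> b \<noteq> c \<and> a \<noteq> c))"

definition type_Z3 ::
  "('a::euclidean_space \<Rightarrow> 'a) \<Rightarrow> ('a \<Rightarrow> 'a \<Rightarrow> 'a) \<Rightarrow> (3 \<Rightarrow> 'a) \<Rightarrow> bool" where
  "type_Z3 S K e \<longleftrightarrow> (\<exists>lam mu a b :: real.
     matrix_wrt e (K (e 1)) = vector [vector [2*lam, 0, 0], vector [0, -lam, 0], vector [0, 0, -lam]] \<and>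
     matrix_wrt e (K (e 2)) = vector [vector [0, -lam, 0], vector [-lam, mu, 0], vector [0, 0, -mu]] \<and>
     matrix_wrt e (K (e 3)) = vector [vector [0, 0, -lam], vector [0, 0, -mu], vector [-lam, -mu, 0]] \<and>
     matrix_wrt e S = vector [vector [a, 0, 0], vector [0, b, 0], vector [0, 0, b]] \<and>
     (lam > 0 \<and> mu > 0 \<and> mu \<noteq> sqrt 2 * lam \<or>
      mu = sqrt 2 * lam \<and> mu > 0 \<and> a \<noteq> b))"

definition type_Z2 ::
  "('a::euclidean_space \<Rightarrow> 'a) \<Rightarrow> ('a \<Rightarrow> 'a \<Rightarrow> 'a) \<Rightarrow> (3 \<Rightarrow> 'a) \<Rightarrow> bool" where
  "type_Z2 S K e \<longleftrightarrow> (\<exists>lam mu a b c d :: real.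
     matrix_wrt e (K (e 1)) = vector [vector [2*lam, 0, 0], vector [0, -lam, mu], vector [0, mu, -lam]] \<and>
     matrix_wrt e (K (e 2)) = vector [vector [0, -lam, mu], vector [-lam, 0, 0], vector [mu, 0, 0]] \<and>
     matrix_wrt e (K (e 3)) = vector [vector [0, mu, -lam], vector [mu, 0, 0], vector [-lam, 0, 0]] \<and>
     matrix_wrt e S = vector [vector [a, 0, 0], vector [0, b, d], vector [0, d, c]] \<and>
     (lam > 0 \<and> mu > 0 \<and> lam \<noteq> mu \<or>
      lam = mu \<and> mu > 0 \<and> (b - c)^2 + (b + c - 2*a - 2*d)^2 \<noteq> 0 \<or>
      lam = 0 \<and> mu > 0 \<and> d \<noteq> 0 \<or>
      mu = 0 \<and> lam > 0 \<and> (b - c)^2 + d^2 \<noteq> 0))"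

end

(*
  Up to a factor, K is the polarization of a harmonic cubic form C(X) = h(K(X,X),X), so G is the
  group of rotations that preserve C and S.

  Existence of a normal form: a nontrivial g in G is a rotation about an axis e 1. If its angle is
  not pi, then invariance leaves in C only the terms of weight 0 and 3 under rotations about e 1;
  if the angle is pi, it leaves those of weight 0 and 2. Turning e 2, e 3 about the axis, and
  replacing e 1 by its negative, removes one parameter and makes the other two nonnegative. The
  degenerate parameter values are turned into one of the other normal forms by an explicit change
  of basis.

  Determination of G: the vector e 1 satisfies K(e 1, e 1) = 2 lam e 1, so its image under an
  element of G is a unit solution v of K(v, v) = 2 lam v. These few solutions, together with
  S, pin down G. For the groups A4 and S3 the form C is a sum of cubes over the vertices of
  a regular tetrahedron resp. triangle, so that all permutations of the vertices preserve it.
*)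

theory Submission
  imports Defs
begin

section \<open>Coordinates in an orthonormal basis\<close>

text \<open>All computations are polynomial identities in coordinates: rotations about
  \<open>e 1\<close> are given by pairs \<open>c\<close>, \<open>s\<close> with
  \<open>c^2 + s^2 = 1\<close>, and angles are used only to take complex square and cube roots. The
  side conditions of \<open>type_Z3\<close> and \<open>type_Z2\<close> come from the equation K(v,
  v) = 2 lam v. For lam > 0 it has unit solutions besides \<open>e 1\<close> only for mu = sqrt 2 *
  lam, where they are the other vertices of a regular tetrahedron, and, in the second family, for
  lam = mu, where they are the other vertices of an equilateral triangle. At these values K alone
  has a larger group, and S has to break the symmetry. A theorem about a basis \<open>e\<close> must
  hold for both orientations of \<open>e\<close>. The sign \<sigma> records the orientation; it
  reverses the sense of \<open>rot_R\<close> and \<open>rot_Q\<close> but does not change the groups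
  that they generate. Generation is never shown by listing a group: for an arbitrary g, a word h in
  the generators is found such that h after g fixes \<open>e 1\<close> and
  \<open>e 2\<close>.\<close>

definition comb :: "(3 \<Rightarrow> 'a::real_vector) \<Rightarrow> real \<Rightarrow> real \<Rightarrow> real \<Rightarrow> 'a" where
  "comb e x y z = x *\<^sub>R e 1 + y *\<^sub>R e 2 + z *\<^sub>R e 3"

lemma comb_add [simp]: "comb e x y z + comb e x' y' z' = comb e (x + x') (y + y') (z + z')"
  by (simp add: comb_def algebra_simps)

lemma comb_diff [simp]: "comb e x y z - comb e x' y' z' = comb e (x - x') (y - y') (z - z')"
  by (simp add: comb_def algebra_simps)

lemma comb_scaleR [simp]: "r *\<^sub>R comb e x y z = comb e (r * x) (r * y) (r * z)"
  by (simp add: comb_def algebra_simps)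

lemma comb_uminus [simp]: "- comb e x y z = comb e (- x) (- y) (- z)"
  by (simp add: comb_def algebra_simps)

lemma comb_0 [simp]: "comb e 0 0 0 = 0"
  by (simp add: comb_def)

lemma comb_unit: "e 1 = comb e 1 0 0" "e 2 = comb e 0 1 0" "e 3 = comb e 0 0 1"
  by (simp_all add: comb_def)

lemma comb_linear:
  assumes "linear f"
  shows "f (comb e x y z) = x *\<^sub>R f (e 1) + y *\<^sub>R f (e 2) + z *\<^sub>R f (e 3)"
  by (simp add: comb_def linear_add[OF assms] linear_cmul[OF assms])

lemma comb_bilinear:
  assumes "bilinear K"
  shows "K (comb e x y z) (comb e x' y' z') =
    (x * x') *\<^sub>R K (e 1) (e 1) + (x * y') *\<^sub>R K (e 1) (e 2) + (x * z') *\<^sub>R K (e 1) (e 3) +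
    ((y * x') *\<^sub>R K (e 2) (e 1) + (y * y') *\<^sub>R K (e 2) (e 2) + (y * z') *\<^sub>R K (e 2) (e 3)) +
    ((z * x') *\<^sub>R K (e 3) (e 1) + (z * y') *\<^sub>R K (e 3) (e 2) + (z * z') *\<^sub>R K (e 3) (e 3))"
  by (simp add: comb_def bilinear_ladd[OF assms] bilinear_radd[OF assms]
      bilinear_lmul[OF assms] bilinear_rmul[OF assms] algebra_simps)

lemma orthonormal_basisI:
  fixes e :: "3 \<Rightarrow> 'a::euclidean_space"
  assumes "DIM('a) = 3" and e: "\<And>i j. e i \<bullet> e j = (if i = j then 1 else 0)"
  shows "orthonormal_basis e"
proof -
  have inj: "inj e"
    by (rule injI) (metis e zero_neq_one)
  have "pairwise orthogonal (range e)"
    by (auto simp: pairwise_def orthogonal_def e)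
  moreover have "0 \<notin> range e"
    by (metis (no_types, lifting) e imageE inner_zero_left zero_neq_one)
  ultimately have "independent (range e)"
    by (simp add: pairwise_orthogonal_independent)
  moreover have "card (range e) = DIM('a)"
    using card_image[OF inj] assms(1) by simp
  ultimately have "span (range e) = UNIV"
    using card_ge_dim_independent[of "range e" UNIV] by auto
  with e show ?thesis
    by (simp add: orthonormal_basis_def)
qed

definition triple :: "'a \<Rightarrow> 'a \<Rightarrow> 'a \<Rightarrow> 3 \<Rightarrow> 'a" where
  "triple a b c i = (if i = 1 then a else if i = 2 then b else c)"

lemma triple_simps [simp]: "triple a b c 1 = a" "triple a b c 2 = b" "triple a b c 3 = c"
  by (simp_all add: triple_def)

locale onb =
  fixes e :: "3 \<Rightarrow> 'a::euclidean_space"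
  assumes onb: "orthonormal_basis e"
begin

lemma inner_e: "e i \<bullet> e j = (if i = j then 1 else 0)"
  using onb by (simp add: orthonormal_basis_def)

lemma inner_e_simps [simp]:
  "e 1 \<bullet> e 1 = 1" "e 1 \<bullet> e 2 = 0" "e 1 \<bullet> e 3 = 0"
  "e 2 \<bullet> e 1 = 0" "e 2 \<bullet> e 2 = 1" "e 2 \<bullet> e 3 = 0"
  "e 3 \<bullet> e 1 = 0" "e 3 \<bullet> e 2 = 0" "e 3 \<bullet> e 3 = 1"
  by (simp_all add: inner_e)

lemma inner_comb [simp]:
  "comb e x y z \<bullet> comb e x' y' z' = x * x' + y * y' + z * z'"
  "e 1 \<bullet> comb e x y z = x" "e 2 \<bullet> comb e x y z = y" "e 3 \<bullet> comb e x y z = z"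
  "comb e x y z \<bullet> e 1 = x" "comb e x y z \<bullet> e 2 = y" "comb e x y z \<bullet> e 3 = z"
  by (simp_all add: comb_def inner_simps)

lemma comb_eq_iff [simp]:
  "comb e x y z = comb e x' y' z' \<longleftrightarrow> x = x' \<and> y = y' \<and> z = z'"
  by (metis inner_comb(2-4))

lemma comb_eq_e [simp]:
  "comb e x y z = e 1 \<longleftrightarrow> x = 1 \<and> y = 0 \<and> z = 0"
  "comb e x y z = e 2 \<longleftrightarrow> x = 0 \<and> y = 1 \<and> z = 0"
  "comb e x y z = e 3 \<longleftrightarrow> x = 0 \<and> y = 0 \<and> z = 1"
  "e 1 = comb e x y z \<longleftrightarrow> x = 1 \<and> y = 0 \<and> z = 0"
  "e 2 = comb e x y z \<longleftrightarrow> x = 0 \<and> y = 1 \<and> z = 0"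
  "e 3 = comb e x y z \<longleftrightarrow> x = 0 \<and> y = 0 \<and> z = 1"
  "comb e x y z = 0 \<longleftrightarrow> x = 0 \<and> y = 0 \<and> z = 0"
  by (metis comb_eq_iff comb_unit(1), metis comb_eq_iff comb_unit(2), metis comb_eq_iff comb_unit(3),
      metis comb_eq_iff comb_unit(1), metis comb_eq_iff comb_unit(2), metis comb_eq_iff comb_unit(3),
      metis comb_0 comb_eq_iff)

text \<open>The difference of both sides is orthogonal to each \<open>e i\<close>, hence to their
  span, which is the whole space, hence to itself.\<close>

lemma comb_expand: "X = comb e (e 1 \<bullet> X) (e 2 \<bullet> X) (e 3 \<bullet> X)"
proof -
  let ?Y = "X - comb e (e 1 \<bullet> X) (e 2 \<bullet> X) (e 3 \<bullet> X)"
  have "?Y \<bullet> e i = 0" for i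
    using exhaust_3[of i] by (auto simp: inner_simps inner_commute)
  then have "orthogonal ?Y y" if "y \<in> range e" for y
    using that by (auto simp: orthogonal_def)
  moreover have "?Y \<in> span (range e)"
    using onb by (simp add: orthonormal_basis_def)
  ultimately have "orthogonal ?Y ?Y"
    using orthogonal_to_span by blast
  then show ?thesis
    by (simp add: orthogonal_def)
qed

lemma comb_exhaust:
  obtains x y z where "X = comb e x y z"
  using comb_expand by blast

lemma DIM_eq: "DIM('a) = 3"
proof -
  have "inj e"
    by (rule injI) (metis inner_e zero_neq_one)
  have "pairwise orthogonal (range e)"
    by (auto simp: pairwise_def orthogonal_def inner_e)
  moreover have "0 \<notin> range e"
    by (metis (no_types, lifting) inner_e imageE inner_zero_left zero_neq_one)
  ultimately have "independent (range e)"
    by (simp add: pairwise_orthogonal_independent)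
  then have "dim (range e) = 3"
    using card_image[OF \<open>inj e\<close>] by (simp add: dim_eq_card_independent)
  then show ?thesis
    using onb by (metis dim_UNIV dim_span orthonormal_basis_def)
qed

lemma linear_eqI:
  assumes "linear f" "linear g" "f (e 1) = g (e 1)" "f (e 2) = g (e 2)" "f (e 3) = g (e 3)"
  shows "f = g"
proof
  fix X
  obtain x y z where "X = comb e x y z"
    by (rule comb_exhaust)
  then show "f X = g X"
    using assms by (simp add: comb_linear)
qed

lemma onb_triple:
  assumes "a1 * a1 + a2 * a2 + a3 * a3 = 1" "b1 * b1 + b2 * b2 + b3 * b3 = 1" "c1 * c1 + c2 * c2 + c3 * c3 = 1"
    "a1 * b1 + a2 * b2 + a3 * b3 = 0" "a1 * c1 + a2 * c2 + a3 * c3 = 0" "b1 * c1 + b2 * c2 + b3 * c3 = 0"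
  shows "onb (triple (comb e a1 a2 a3) (comb e b1 b2 b3) (comb e c1 c2 c3))"
proof
  show "orthonormal_basis (triple (comb e a1 a2 a3) (comb e b1 b2 b3) (comb e c1 c2 c3))"
  proof (rule orthonormal_basisI[OF DIM_eq])
    fix i j
    show "triple (comb e a1 a2 a3) (comb e b1 b2 b3) (comb e c1 c2 c3) i \<bullet>
      triple (comb e a1 a2 a3) (comb e b1 b2 b3) (comb e c1 c2 c3) j = (if i = j then 1 else 0)"
      using exhaust_3[of i] exhaust_3[of j] assms
      by (elim disjE) (simp_all add: mult.commute)
  qed
qed

text \<open>\<open>vector\<close> lists rows whereas the images of the basis vectors are the
  columns, so the indices appear transposed on the right.\<close>

lemma matrix_wrt_eq_iff:
  "matrix_wrt e f = vector [vector [a11, a12, a13], vector [a21, a22, a23], vector [a31, a32, a33]] \<longleftrightarrow>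
    f (e 1) = comb e a11 a21 a31 \<and> f (e 2) = comb e a12 a22 a32 \<and> f (e 3) = comb e a13 a23 a33"
proof -
  obtain a1 a2 a3 where a: "f (e 1) = comb e a1 a2 a3" by (rule comb_exhaust)
  obtain b1 b2 b3 where b: "f (e 2) = comb e b1 b2 b3" by (rule comb_exhaust)
  obtain c1 c2 c3 where c: "f (e 3) = comb e c1 c2 c3" by (rule comb_exhaust)
  show ?thesis
    by (auto simp: matrix_wrt_def vec_eq_iff forall_3 a b c)
qed

lemma matrix_wrt_comp:
  assumes "linear f"
  shows "matrix_wrt e (f \<circ> g) = matrix_wrt e f ** matrix_wrt e g"
proof -
  have "e i \<bullet> f (g (e j)) = (e i \<bullet> f (e 1)) * (e 1 \<bullet> g (e j)) + (e i \<bullet> f (e 2)) * (e 2 \<bullet> g (e j)) +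
     (e i \<bullet> f (e 3)) * (e 3 \<bullet> g (e j))" for i j
    by (subst comb_expand[of "g (e j)"]) (simp add: comb_linear[OF assms] inner_simps algebra_simps)
  then show ?thesis
    by (simp add: matrix_wrt_def matrix_matrix_mult_def vec_eq_iff sum_3)
qed

end

text \<open>The bijection with \<open>Basis\<close> is kept because \<open>endo_det\<close> is
  defined through \<open>Basis\<close>.\<close>

lemma ex_onb:
  assumes "DIM('a::euclidean_space) = 3"
  obtains b :: "3 \<Rightarrow> 'a::euclidean_space" where "onb b" "bij_betw b UNIV Basis"
proof -
  have "card (UNIV :: 3 set) = card (Basis :: 'a set)"
    using assms by simp
  then obtain b :: "3 \<Rightarrow> 'a" where b: "bij_betw b UNIV Basis"
    by (metis finite finite_Basis bij_betw_iff_card)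
  have "orthonormal_basis b"
  proof (rule orthonormal_basisI[OF assms])
    fix i j show "b i \<bullet> b j = (if i = j then 1 else 0)"
      using b by (metis (no_types, lifting) bij_betw_def inj_eq inner_Basis rangeI)
  qed
  then show ?thesis
    using that b onb_def by blast
qed

text \<open>Once \<open>Basis\<close> is written as a set of three elements, splitting off one
  element at a time resolves the sum over permutations into the six terms of
  \<open>det_3\<close>.\<close>

lemma endo_det_Basis:
  fixes b :: "3 \<Rightarrow> 'a::euclidean_space"
  assumes b: "bij_betw b UNIV Basis"
  shows "endo_det f = det (matrix_wrt b f)"
proof -
  have inj: "b i = b j \<longleftrightarrow> i = j" for i j
    using b by (auto simp: bij_betw_def inj_on_def)
  have B: "Basis = {b 1, b 2, b 3}"
    using bij_betw_imp_surj_on[OF b] by (simp only: UNIV_3 image_insert image_empty)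
  have f123: "finite {b 2, b 3}" "b 1 \<notin> {b 2, b 3}" and f23: "finite {b 3}" "b 2 \<notin> {b 3}"
    by (auto simp: inj)
  show ?thesis
    unfolding endo_det_def B det_3
    unfolding sum_over_permutations_insert[OF f123]
    unfolding sum_over_permutations_insert[OF f23]
    unfolding permutes_sing
    by (simp add: sign_swap_id permutation_swap_id sign_compose sign_id swap_id_eq inj matrix_wrt_def
        inner_commute[of "b _" "f _"])
qed

text \<open>The transition matrix \<open>P\<close> between \<open>e\<close> and an enumeration of
  \<open>Basis\<close> is orthogonal, so the two matrices of \<open>f\<close> are conjugate and the
  factors \<open>det P\<close> cancel.\<close>

lemma (in onb) endo_det_eq:
  fixes f :: "'a \<Rightarrow> 'a"
  assumes "linear f"
  shows "endo_det f = det (matrix_wrt e f)"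
proof -
  obtain b :: "3 \<Rightarrow> 'a" where "onb b" and b: "bij_betw b UNIV Basis"
    using ex_onb[OF DIM_eq] .
  interpret b: onb b by fact
  define P where "P = (\<chi> i j. b i \<bullet> e j)"
  have expand: "X \<bullet> Y = (X \<bullet> b 1) * (b 1 \<bullet> Y) + (X \<bullet> b 2) * (b 2 \<bullet> Y) + (X \<bullet> b 3) * (b 3 \<bullet> Y)" for X Y
    by (subst b.comb_expand[of Y]) (simp add: comb_def inner_simps algebra_simps)
  have "transpose P ** P = mat 1"
  proof -
    have "(b 1 \<bullet> e i) * (b 1 \<bullet> e j) + (b 2 \<bullet> e i) * (b 2 \<bullet> e j) + (b 3 \<bullet> e i) * (b 3 \<bullet> e j) =
      (if i = j then 1 else 0)" for i j
      using expand[of "e i" "e j"] inner_e[of i j] by (simp only: inner_commute[of "e i" "b _"])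
    then show ?thesis
      by (simp add: P_def transpose_def matrix_matrix_mult_def vec_eq_iff sum_3 mat_def)
  qed
  then have "det (transpose P) * det P = 1"
    by (metis det_I det_mul)
  moreover have "matrix_wrt e f = transpose P ** matrix_wrt b f ** P"
  proof -
    have "e i \<bullet> f (e j) = (e i \<bullet> f (b 1)) * (b 1 \<bullet> e j) + (e i \<bullet> f (b 2)) * (b 2 \<bullet> e j) + (e i \<bullet> f (b 3)) * (b 3 \<bullet> e j)" for i j
      by (subst b.comb_expand[of "e j"]) (simp add: comb_linear[OF assms] inner_simps algebra_simps)
    moreover have "e i \<bullet> f (b k) = (b 1 \<bullet> e i) * (b 1 \<bullet> f (b k)) + (b 2 \<bullet> e i) * (b 2 \<bullet> f (b k)) + (b 3 \<bullet> e i) * (b 3 \<bullet> f (b k))" for i k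
      using expand[of "e i" "f (b k)"] by (simp only: inner_commute[of "e i" "b _"])
    ultimately show ?thesis
      by (simp add: P_def transpose_def matrix_matrix_mult_def vec_eq_iff sum_3 matrix_wrt_def)
  qed
  ultimately show ?thesis
    unfolding endo_det_Basis[OF b] by (simp add: det_mul)
qed

section \<open>The special orthogonal group in coordinates\<close>

abbreviation SO :: "('a::euclidean_space \<Rightarrow> 'a) set" where
  "SO \<equiv> carrier special_orthogonal_group"

lemma SO_iff: "g \<in> SO \<longleftrightarrow> orthogonal_transformation g \<and> endo_det g = 1"
  by (simp add: special_orthogonal_group_def)

lemma SO_linear: "g \<in> SO \<Longrightarrow> linear g"
  by (simp add: SO_iff orthogonal_transformation_def)

lemma SO_inner: "g \<in> SO \<Longrightarrow> g x \<bullet> g y = x \<bullet> y"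
  by (simp add: SO_iff orthogonal_transformation_def)

lemma special_orthogonal_group_simps [simp]:
  "monoid.mult special_orthogonal_group = (\<circ>)" "one special_orthogonal_group = id"
  by (simp_all add: special_orthogonal_group_def)

context onb begin

lemma endo_det_comp: "linear f \<Longrightarrow> linear g \<Longrightarrow> endo_det (f \<circ> g) = endo_det f * endo_det g" for f g :: "'a \<Rightarrow> 'a"
  by (simp add: endo_det_eq matrix_wrt_comp det_mul linear_compose)

lemma endo_det_id: "endo_det (id :: 'a \<Rightarrow> 'a) = 1"
proof -
  have "linear (id :: 'a \<Rightarrow> 'a)"
    by (rule linearI) simp_all
  then show ?thesis
    by (simp add: endo_det_eq det_3 matrix_wrt_def)
qed

lemma SO_comp: "f \<in> SO \<Longrightarrow> g \<in> SO \<Longrightarrow> f \<circ> g \<in> SO" for f g :: "'a \<Rightarrow> 'a"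
  by (simp add: SO_iff endo_det_comp orthogonal_transformation_linear orthogonal_transformation_compose)

lemma SO_id: "(id :: 'a \<Rightarrow> 'a) \<in> SO"
  using endo_det_id by (simp add: SO_iff id_def)

lemma SO_inv: "inv' g \<in> SO" "inv' g \<circ> g = id" "g \<circ> inv' g = id" if "g \<in> SO" for g :: "'a \<Rightarrow> 'a"
proof -
  have o: "orthogonal_transformation g" and d: "endo_det g = 1"
    using that by (simp_all add: SO_iff)
  have o': "orthogonal_transformation (inv' g)"
    using o orthogonal_transformation_inv by blast
  show 1: "inv' g \<circ> g = id" and "g \<circ> inv' g = id"
    using orthogonal_transformation_bij[OF o] by (auto simp: fun_eq_iff bij_def surj_f_inv_f)
  have "endo_det (inv' g) * endo_det g = 1"
    using endo_det_comp[of "inv' g" g] 1 o o' orthogonal_transformation_linear endo_det_id by metis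
  then show "inv' g \<in> SO"
    using o' d by (simp add: SO_iff)
qed

lemma group_SO: "group (special_orthogonal_group :: ('a \<Rightarrow> 'a) monoid)"
proof (rule groupI)
  fix g :: "'a \<Rightarrow> 'a"
  assume "g \<in> SO"
  then show "\<exists>h\<in>SO. h \<otimes>\<^bsub>special_orthogonal_group\<^esub> g = \<one>\<^bsub>special_orthogonal_group\<^esub>"
    using SO_inv[of g] by auto
qed (simp_all add: SO_comp SO_id comp_assoc)

lemma inv_SO: "inv\<^bsub>special_orthogonal_group\<^esub> g = inv' g" if "g \<in> SO" for g :: "'a \<Rightarrow> 'a"
  using group.inv_equality[OF group_SO] SO_inv[OF that] that by simp

text \<open>The third column is the coordinate cross product of the first two. By Lagrange's
  identity it is a unit vector, and its squared length is also the determinant.\<close>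

lemma SO_I:
  fixes g :: "'a \<Rightarrow> 'a"
  assumes "linear g" "g (e 1) = comb e a1 a2 a3" "g (e 2) = comb e b1 b2 b3"
    "g (e 3) = comb e (a2*b3-a3*b2) (a3*b1-a1*b3) (a1*b2-a2*b1)"
    "a1^2 + a2^2 + a3^2 = 1" "b1^2 + b2^2 + b3^2 = 1" "a1*b1 + a2*b2 + a3*b3 = 0"
  shows "g \<in> SO"
proof -
  have n: "(a2*b3-a3*b2)^2 + (a3*b1-a1*b3)^2 + (a1*b2-a2*b1)^2 = 1"
  proof -
    have "(a2*b3-a3*b2)^2 + (a3*b1-a1*b3)^2 + (a1*b2-a2*b1)^2 =
      (a1^2 + a2^2 + a3^2) * (b1^2 + b2^2 + b3^2) - (a1*b1 + a2*b2 + a3*b3)^2"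
      by algebra
    then show ?thesis using assms by simp
  qed
  have "g x \<bullet> g x = x \<bullet> x" for x
  proof -
    obtain p q r where x: "x = comb e p q r" by (rule comb_exhaust)
    have "g x \<bullet> g x = p^2 * (a1^2 + a2^2 + a3^2) + q^2 * (b1^2 + b2^2 + b3^2) +
      r^2 * ((a2*b3-a3*b2)^2 + (a3*b1-a1*b3)^2 + (a1*b2-a2*b1)^2) + 2*p*q*(a1*b1 + a2*b2 + a3*b3)"
      unfolding x comb_linear[OF assms(1)] by (simp add: assms(2-4)) algebra
    then show ?thesis
      unfolding n assms x by (simp add: power2_eq_square)
  qed
  then have "orthogonal_transformation g"
    using assms(1) by (simp add: orthogonal_transformation norm_eq_sqrt_inner)
  moreover have "endo_det g = (a2*b3-a3*b2)^2 + (a3*b1-a1*b3)^2 + (a1*b2-a2*b1)^2"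
    by (simp add: endo_det_eq[OF assms(1)] det_3 matrix_wrt_def assms(2-4)) algebra
  ultimately show ?thesis
    by (simp add: SO_iff n)
qed

text \<open>The third column c and the cross product n of the first two are unit vectors with inner
  product equal to the determinant 1, so the squared length of c - n is 1 - 2 + 1 = 0.\<close>

lemma SO_E:
  fixes g :: "'a \<Rightarrow> 'a"
  assumes "g \<in> SO"
  obtains a1 a2 a3 b1 b2 b3 where "linear g" "g (e 1) = comb e a1 a2 a3" "g (e 2) = comb e b1 b2 b3"
    "g (e 3) = comb e (a2*b3-a3*b2) (a3*b1-a1*b3) (a1*b2-a2*b1)"
    "a1^2 + a2^2 + a3^2 = 1" "b1^2 + b2^2 + b3^2 = 1" "a1*b1 + a2*b2 + a3*b3 = 0"
proof -
  obtain a1 a2 a3 where a: "g (e 1) = comb e a1 a2 a3" by (rule comb_exhaust)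
  obtain b1 b2 b3 where b: "g (e 2) = comb e b1 b2 b3" by (rule comb_exhaust)
  obtain c1 c2 c3 where c: "g (e 3) = comb e c1 c2 c3" by (rule comb_exhaust)
  have aa: "a1^2 + a2^2 + a3^2 = 1" and bb: "b1^2 + b2^2 + b3^2 = 1" and cc: "c1^2 + c2^2 + c3^2 = 1"
    and ab: "a1*b1 + a2*b2 + a3*b3 = 0"
    using SO_inner[OF assms, of "e 1" "e 1"] SO_inner[OF assms, of "e 2" "e 2"] SO_inner[OF assms, of "e 3" "e 3"]
      SO_inner[OF assms, of "e 1" "e 2"] by (simp_all add: a b c power2_eq_square)
  have "endo_det g = 1"
    using assms by (simp add: SO_iff)
  then have det: "c1*(a2*b3-a3*b2) + c2*(a3*b1-a1*b3) + c3*(a1*b2-a2*b1) = 1"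
    by (simp add: endo_det_eq[OF SO_linear[OF assms]] det_3 matrix_wrt_def a b c algebra_simps)
  have "(c1 - (a2*b3-a3*b2))^2 + (c2 - (a3*b1-a1*b3))^2 + (c3 - (a1*b2-a2*b1))^2 =
    (c1^2 + c2^2 + c3^2) - 2 * (c1*(a2*b3-a3*b2) + c2*(a3*b1-a1*b3) + c3*(a1*b2-a2*b1)) +
     ((a1^2 + a2^2 + a3^2) * (b1^2 + b2^2 + b3^2) - (a1*b1 + a2*b2 + a3*b3)^2)"
    by algebra
  also have "\<dots> = 0"
    by (simp add: aa bb cc ab det)
  finally have "c1 = (a2*b3-a3*b2)" "c2 = (a3*b1-a1*b3)" "c3 = (a1*b2-a2*b1)"
    by (smt (verit) zero_le_power2 zero_eq_power2)+
  then show ?thesis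
    using that SO_linear[OF assms] a b c aa bb ab by metis
qed

text \<open>The image of \<open>e 3\<close> is the cross product of the other two images, so two
  basis vectors suffice.\<close>

lemma SO_eqI:
  fixes g h :: "'a \<Rightarrow> 'a"
  assumes "g \<in> SO" "h \<in> SO" "g (e 1) = h (e 1)" "g (e 2) = h (e 2)"
  shows "g = h"
proof -
  obtain a1 a2 a3 b1 b2 b3 where g: "linear g" "g (e 1) = comb e a1 a2 a3" "g (e 2) = comb e b1 b2 b3"
    "g (e 3) = comb e (a2*b3-a3*b2) (a3*b1-a1*b3) (a1*b2-a2*b1)"
    using SO_E[OF assms(1)] by metis
  obtain a1' a2' a3' b1' b2' b3' where h: "linear h" "h (e 1) = comb e a1' a2' a3'" "h (e 2) = comb e b1' b2' b3'"
    "h (e 3) = comb e (a2'*b3'-a3'*b2') (a3'*b1'-a1'*b3') (a1'*b2'-a2'*b1')"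
    using SO_E[OF assms(2)] by metis
  show ?thesis
    using assms g h by (intro linear_eqI) auto
qed

end

section \<open>Rotations and generated groups\<close>

lemma cross_product_inner:
  assumes "linear (\<omega> u v)"
  shows "cross_product \<omega> u v \<bullet> w = \<omega> u v w"
proof -
  have "\<omega> u v w = \<omega> u v (\<Sum>b\<in>Basis. (w \<bullet> b) *\<^sub>R b)"
    by (simp add: euclidean_representation)
  also have "\<dots> = (\<Sum>b\<in>Basis. (w \<bullet> b) * \<omega> u v b)"
    by (simp add: linear_sum[OF assms] linear_cmul[OF assms])
  finally show ?thesis
    by (simp add: cross_product_def inner_sum_left inner_commute[of w] mult.commute)
qed

lemma angle_120:
  "cos (2 * pi / 3) = - 1 / 2" "sin (2 * pi / 3) = sqrt 3 / 2"
  "cos (pi * 2 / 3) = - 1 / 2" "sin (pi * 2 / 3) = sqrt 3 / 2"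
  using cos_120 sin_120 by (simp_all add: mult.commute)

locale frame = onb e for e :: "3 \<Rightarrow> 'a::euclidean_space" +
  fixes \<omega> :: "'a \<Rightarrow> 'a \<Rightarrow> 'a \<Rightarrow> real"
  assumes vol: "volume_form \<omega>"
begin

text \<open>The sign of the basis: \<open>e\<close> may be negatively oriented, and \<sigma> then
  appears as a factor of the sine in every rotation formula.\<close>

abbreviation "\<sigma> \<equiv> \<omega> (e 1) (e 2) (e 3)"

lemma orientation_cases: "\<sigma> = 1 \<or> \<sigma> = - 1"
proof -
  have "\<bar>\<sigma>\<bar> = 1"
    using vol by (simp add: volume_form_def norm_eq_1)
  then show ?thesis by linarith
qed

lemma orientation_square [simp]: "\<sigma> * \<sigma> = 1"
  using orientation_cases by auto

lemma \<omega>_linear: "linear (\<lambda>u. \<omega> u v w)" "linear (\<lambda>v. \<omega> u v w)" "linear (\<lambda>w. \<omega> u v w)"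
  using vol by (simp_all add: volume_form_def)

lemma \<omega>_alternating [simp]: "\<omega> u u v = 0" "\<omega> u v u = 0" "\<omega> u v v = 0"
  using vol by (simp_all add: volume_form_def)

lemma \<omega>_swap: "\<omega> v u w = - \<omega> u v w" "\<omega> u w v = - \<omega> u v w"
proof -
  have "0 = \<omega> (u + v) (u + v) w"
    by simp
  also have "\<dots> = \<omega> u v w + \<omega> v u w"
    by (simp only: linear_add[OF \<omega>_linear(1)] linear_add[OF \<omega>_linear(2)]) simp
  finally show "\<omega> v u w = - \<omega> u v w"
    by simp
  have "0 = \<omega> u (v + w) (v + w)"
    by simp
  also have "\<dots> = \<omega> u v w + \<omega> u w v"
    by (simp only: linear_add[OF \<omega>_linear(2)] linear_add[OF \<omega>_linear(3)]) simp
  finally show "\<omega> u w v = - \<omega> u v w"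
    by simp
qed

lemma \<omega>_comb:
  "\<omega> (comb e a1 a2 a3) (comb e b1 b2 b3) (comb e c1 c2 c3) =
    \<sigma> * ((a2*b3-a3*b2) * c1 + (a3*b1-a1*b3) * c2 + (a1*b2-a2*b1) * c3)"
proof -
  have "\<omega> (e 1) (e 3) (e 2) = - \<sigma>" "\<omega> (e 2) (e 1) (e 3) = - \<sigma>" "\<omega> (e 2) (e 3) (e 1) = \<sigma>"
    "\<omega> (e 3) (e 1) (e 2) = \<sigma>" "\<omega> (e 3) (e 2) (e 1) = - \<sigma>"
    by (metis \<omega>_swap minus_minus)+
  then show ?thesis
    by (simp add: comb_linear[OF \<omega>_linear(1)] comb_linear[OF \<omega>_linear(2)] comb_linear[OF \<omega>_linear(3)])
      (simp add: algebra_simps)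
qed

lemma cross_product_comb:
  "cross_product \<omega> (comb e a1 a2 a3) (comb e b1 b2 b3) =
    comb e (\<sigma> * (a2*b3-a3*b2)) (\<sigma> * (a3*b1-a1*b3)) (\<sigma> * (a1*b2-a2*b1))"
proof -
  obtain x y z where c: "cross_product \<omega> (comb e a1 a2 a3) (comb e b1 b2 b3) = comb e x y z"
    by (rule comb_exhaust)
  have "cross_product \<omega> (comb e a1 a2 a3) (comb e b1 b2 b3) \<bullet> comb e p q r =
    \<sigma> * ((a2*b3-a3*b2) * p + (a3*b1-a1*b3) * q + (a1*b2-a2*b1) * r)" for p q r
    using cross_product_inner[OF \<omega>_linear(3)] \<omega>_comb by simp
  from this[of 1 0 0] this[of 0 1 0] this[of 0 0 1] show ?thesis
    by (simp add: c)
qed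

lemma rotation_comb:
  "rotation \<omega> (comb e u1 u2 u3) \<theta> (comb e x y z) =
    comb e (cos \<theta> * x + \<sigma> * sin \<theta> * (u2*z-u3*y) + (1 - cos \<theta>) * (u1*x+u2*y+u3*z) * u1)
      (cos \<theta> * y + \<sigma> * sin \<theta> * (u3*x-u1*z) + (1 - cos \<theta>) * (u1*x+u2*y+u3*z) * u2)
      (cos \<theta> * z + \<sigma> * sin \<theta> * (u1*y-u2*x) + (1 - cos \<theta>) * (u1*x+u2*y+u3*z) * u3)"
  by (simp add: rotation_def cross_product_comb algebra_simps)

lemma linear_combI:
  fixes f :: "'a \<Rightarrow> 'a"
  assumes "\<And>x y z. f (comb e x y z) = x *\<^sub>R p + y *\<^sub>R q + z *\<^sub>R r"
  shows "linear f"
proof (rule linearI)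
  fix X Y :: 'a and c :: real
  obtain x y z where X: "X = comb e x y z" by (rule comb_exhaust)
  obtain x' y' z' where Y: "Y = comb e x' y' z'" by (rule comb_exhaust)
  show "f (X + Y) = f X + f Y" "f (c *\<^sub>R X) = c *\<^sub>R f X"
    by (simp_all add: X Y assms algebra_simps)
qed

lemma rotation_linear: "linear (rotation \<omega> u \<theta>)"
proof -
  obtain u1 u2 u3 where u: "u = comb e u1 u2 u3" by (rule comb_exhaust)
  show ?thesis
    unfolding u
    \<comment> \<open>\<open>p\<close>, \<open>q\<close>, \<open>r\<close> are the columns of
      Rodrigues' matrix.\<close>
    by (rule linear_combI[where p = "comb e (cos \<theta> + (1 - cos \<theta>) * u1 * u1) (\<sigma> * sin \<theta> * u3 + (1 - cos \<theta>) * u1 * u2)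
        (- \<sigma> * sin \<theta> * u2 + (1 - cos \<theta>) * u1 * u3)"
      and q = "comb e (- \<sigma> * sin \<theta> * u3 + (1 - cos \<theta>) * u2 * u1) (cos \<theta> + (1 - cos \<theta>) * u2 * u2)
        (\<sigma> * sin \<theta> * u1 + (1 - cos \<theta>) * u2 * u3)"
      and r = "comb e (\<sigma> * sin \<theta> * u2 + (1 - cos \<theta>) * u3 * u1) (- \<sigma> * sin \<theta> * u1 + (1 - cos \<theta>) * u3 * u2)
        (cos \<theta> + (1 - cos \<theta>) * u3 * u3)"])
      (simp add: rotation_comb algebra_simps)
qed

lemma rotation_e1: "rotation \<omega> (e 1) \<theta> (comb e x y z) =
    comb e x (cos \<theta> * y - \<sigma> * sin \<theta> * z) (\<sigma> * sin \<theta> * y + cos \<theta> * z)"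
  using rotation_comb[of 1 0 0 \<theta> x y z] by (simp add: algebra_simps flip: comb_unit)

lemma rot_P1: "rot_P \<omega> e 1 (comb e x y z) = comb e x (- y) (- z)"
  by (simp add: rot_P_def rotation_e1)

lemma rot_P2: "rot_P \<omega> e 2 (comb e x y z) = comb e (- x) y (- z)"
  using rotation_comb[of 0 1 0 pi x y z] by (simp add: rot_P_def algebra_simps flip: comb_unit)

lemma rot_R1: "rot_R \<omega> e 1 (comb e x y z) =
    comb e x (- (y / 2) - \<sigma> * sqrt 3 / 2 * z) (\<sigma> * sqrt 3 / 2 * y - z / 2)"
  by (simp add: rot_R_def rotation_e1 angle_120 algebra_simps)

lemma rot_R3: "rot_R \<omega> e 3 (comb e x y z) =
    comb e (- (x / 2) - \<sigma> * sqrt 3 / 2 * y) (\<sigma> * sqrt 3 / 2 * x - y / 2) z"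
  using rotation_comb[of 0 0 1 "2 * pi / 3" x y z]
  by (simp add: rot_R_def angle_120 algebra_simps flip: comb_unit)

text \<open>With cosine -1/2 and an axis with equal entries, Rodrigues' matrix has only the entries
  0 and 1: it permutes the coordinates cyclically, and the orientation decides in which
  direction.\<close>

lemma rot_Q: "rot_Q \<omega> e (comb e x y z) = (if \<sigma> = 1 then comb e z x y else comb e y z x)"
proof -
  \<comment> \<open>Writing \<open>sqrt 3\<close> as \<open>3 * t\<close> leaves a single irrational
    quantity, which is eliminated by \<open>t * t = 1 / 3\<close>.\<close>
  define t :: real where "t = 1 / sqrt 3"
  have t: "sqrt 3 = 3 * t" "t * (t * r) = r / 3" for r
    by (simp_all add: t_def field_simps)
  have "(1 / sqrt 3) *\<^sub>R (e 1 + e 2 + e 3) = comb e t t t"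
    by (simp add: comb_def t_def algebra_simps)
  then show ?thesis
    using orientation_cases
    by (elim disjE) (simp_all add: rot_Q_def rotation_comb angle_120 t algebra_simps, simp_all add: field_simps)
qed

lemma rotation_e1_SO: "rotation \<omega> (e 1) \<theta> \<in> SO"
proof (rule SO_I[OF rotation_linear])
  have [simp]: "(\<sigma> * sin \<theta>)\<^sup>2 = (sin \<theta>)\<^sup>2"
    using orientation_cases by auto
  show "rotation \<omega> (e 1) \<theta> (e 1) = comb e 1 0 0"
    "rotation \<omega> (e 1) \<theta> (e 2) = comb e 0 (cos \<theta>) (\<sigma> * sin \<theta>)"
    "rotation \<omega> (e 1) \<theta> (e 3) = comb e (0 * (\<sigma> * sin \<theta>) - 0 * cos \<theta>) (0 * 0 - 1 * (\<sigma> * sin \<theta>)) (1 * cos \<theta> - 0 * 0)"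
    using rotation_e1[of \<theta> 1 0 0] rotation_e1[of \<theta> 0 1 0] rotation_e1[of \<theta> 0 0 1]
    by (simp_all flip: comb_unit)
  show "0\<^sup>2 + (cos \<theta>)\<^sup>2 + (\<sigma> * sin \<theta>)\<^sup>2 = 1"
    by simp
qed auto

lemma SO_combI:
  assumes "\<And>x y z. g (comb e x y z) = x *\<^sub>R comb e a1 a2 a3 + y *\<^sub>R comb e b1 b2 b3
     + z *\<^sub>R comb e (a2*b3-a3*b2) (a3*b1-a1*b3) (a1*b2-a2*b1)"
    "a1^2 + a2^2 + a3^2 = 1" "b1^2 + b2^2 + b3^2 = 1" "a1*b1 + a2*b2 + a3*b3 = 0"
  shows "g \<in> SO"
  using linear_combI[OF assms(1)] assms(1)[of 1 0 0] assms(1)[of 0 1 0] assms(1)[of 0 0 1] assms(2-4)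
  by (intro SO_I[of g a1 a2 a3 b1 b2 b3]) (simp_all flip: comb_unit)

lemma rot_SO: "rot_P \<omega> e 1 \<in> SO" "rot_P \<omega> e 2 \<in> SO" "rot_R \<omega> e 1 \<in> SO" "rot_R \<omega> e 3 \<in> SO" "rot_Q \<omega> e \<in> SO"
proof -
  show "rot_P \<omega> e 1 \<in> SO" "rot_R \<omega> e 1 \<in> SO"
    unfolding rot_P_def rot_R_def by (rule rotation_e1_SO)+
  show "rot_P \<omega> e 2 \<in> SO"
    by (rule SO_combI[of _ "-1" 0 0 0 1 0]) (simp_all add: rot_P2)
  have [simp]: "(\<sigma> * sqrt 3 / 2)\<^sup>2 = 3 / 4"
    using orientation_cases by (auto simp: power_divide)
  then have "(\<sigma> * sqrt 3 / 2) * (\<sigma> * sqrt 3 / 2) = 3 / 4"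
    by (simp add: power2_eq_square)
  then show "rot_R \<omega> e 3 \<in> SO"
    by (intro SO_combI[of _ "-1/2" "\<sigma> * sqrt 3 / 2" 0 "- (\<sigma> * sqrt 3 / 2)" "-1/2" 0])
      (simp_all add: rot_R3 field_simps power2_eq_square)
  show "rot_Q \<omega> e \<in> SO"
  proof (cases "\<sigma> = 1")
    case True
    then show ?thesis
      by (intro SO_combI[of _ 0 1 0 0 0 1]) (simp_all add: rot_Q)
  next
    case False
    then show ?thesis
      by (intro SO_combI[of _ 0 0 1 1 0 0]) (simp_all add: rot_Q)
  qed
qed

text \<open>If \<open>e 1\<close> is fixed, the image of \<open>e 2\<close> is orthogonal to it,
  hence lies on the unit circle of the \<open>e 2\<close>, \<open>e 3\<close> plane and has an
  angle.\<close>

lemma axis_group: "{g \<in> SO. g (e 1) = e 1} = range (rotation \<omega> (e 1))"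
proof (intro equalityI subsetI)
  fix g
  assume "g \<in> {g \<in> SO. g (e 1) = e 1}"
  then have g: "g \<in> SO" "g (e 1) = e 1" by auto
  then obtain b1 b2 b3 where b: "g (e 2) = comb e b1 b2 b3" "b1^2 + b2^2 + b3^2 = 1" "b1 = 0"
    using SO_E[OF g(1)] by (metis (no_types, lifting) comb_eq_e(1) mult_1 mult_zero_left add.right_neutral)
  \<comment> \<open>The sense of the angle is measured by \<open>\<omega>\<close>, not by the order
    of \<open>e\<close>, which accounts for the factor \<sigma>.\<close>
  then have "b2\<^sup>2 + (\<sigma> * b3)\<^sup>2 = 1"
    using orientation_cases by auto
  then obtain \<theta> where \<theta>: "b2 = cos \<theta>" "\<sigma> * b3 = sin \<theta>"
    by (rule sincos_total_2pi)
  then have "b3 = \<sigma> * sin \<theta>"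
    using orientation_cases by auto
  then have "g = rotation \<omega> (e 1) \<theta>"
    using rotation_e1[of \<theta> 1 0 0] rotation_e1[of \<theta> 0 1 0] g b \<theta>
    by (intro SO_eqI[OF g(1) rotation_e1_SO]) (simp_all flip: comb_unit)
  then show "g \<in> range (rotation \<omega> (e 1))"
    by blast
qed (use rotation_e1_SO rotation_e1[of _ 1 0 0] in \<open>auto simp flip: comb_unit\<close>)

end

lemma id_generate: "id \<in> generate special_orthogonal_group A"
  using generate.one[of special_orthogonal_group A] by simp

lemma generate_comp:
  "f \<in> generate special_orthogonal_group A \<Longrightarrow> g \<in> generate special_orthogonal_group A \<Longrightarrow>
    f \<circ> g \<in> generate special_orthogonal_group A"
  using generate.eng[of f special_orthogonal_group A g] by simp

context onb begin

lemma generate_subset_SO: "generate special_orthogonal_group (SO \<inter> A) \<subseteq> SO" for A :: "('a \<Rightarrow> 'a) set"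
  using group.generate_in_carrier[OF group_SO] by blast

text \<open>An element of \<open>SO\<close> that fixes \<open>e 1\<close> and \<open>e 2\<close> is
  the identity, so \<open>g\<close> is the inverse of the word \<open>h\<close>. All proofs below
  that small groups are generated by given rotations end with this step.\<close>

lemma generate_cancel:
  fixes g :: "'a \<Rightarrow> 'a"
  assumes g: "g \<in> SO" and h: "h \<in> generate special_orthogonal_group (SO \<inter> A)"
    and "h (g (e 1)) = e 1" "h (g (e 2)) = e 2"
  shows "g \<in> generate special_orthogonal_group (SO \<inter> A)"
proof -
  have hS: "h \<in> SO"
    using h generate_subset_SO by blast
  have "h \<circ> g = id"
    using assms by (intro SO_eqI SO_comp hS SO_id) auto
  then have "g = inv\<^bsub>special_orthogonal_group\<^esub> h"
    using SO_inv(2)[OF hS] inv_SO[OF hS] by (metis comp_assoc comp_id id_comp)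
  then show ?thesis
    using group.generate_m_inv_closed[OF group_SO _ h] by auto
qed

lemma generated_by_eqI:
  fixes A :: "('a \<Rightarrow> 'a) set"
  assumes sub: "subgroup H special_orthogonal_group" and "A \<subseteq> H"
    and "\<And>g. g \<in> H \<Longrightarrow> g \<in> generate special_orthogonal_group (SO \<inter> A)"
  shows "special_orthogonal_group\<lparr>carrier := H\<rparr> = generated_by A"
proof -
  have "generate special_orthogonal_group (SO \<inter> A) \<subseteq> H"
    using assms(2) by (intro group.generate_subgroup_incl[OF group_SO _ sub]) auto
  then have "generate special_orthogonal_group (SO \<inter> A) = H"
    using assms(3) by auto
  then show ?thesis
    by (simp add: subgroup_generated_def)
qed

end

definition stab :: "('a::euclidean_space \<Rightarrow> 'a) \<Rightarrow> ('a \<Rightarrow> 'a \<Rightarrow> 'a) \<Rightarrow> ('a \<Rightarrow> 'a) set" where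
  "stab S K = {g \<in> SO. (\<forall>X Y. K (g X) (g Y) = g (K X Y)) \<and> (\<forall>X. S (g X) = g (S X))}"

lemma stabilizer_group_eq: "stabilizer_group S K = special_orthogonal_group\<lparr>carrier := stab S K\<rparr>"
  by (simp add: stabilizer_group_def stab_def)

lemma (in onb) subgroup_stab: "subgroup (stab S K) special_orthogonal_group" for S :: "'a \<Rightarrow> 'a"
proof (rule group.subgroupI[OF group_SO])
  show "stab S K \<subseteq> SO"
    by (auto simp: stab_def)
  show "stab S K \<noteq> {}"
    using SO_id by (auto simp: stab_def)
next
  fix g assume "g \<in> stab S K"
  then have g: "g \<in> SO" "\<And>X Y. K (g X) (g Y) = g (K X Y)" "\<And>X. S (g X) = g (S X)"
    by (auto simp: stab_def)
  have "g (inv' g X) = X" "inv' g (g X) = X" for X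
    using SO_inv(2,3)[OF g(1)] by (simp_all add: fun_eq_iff)
  then have "inv' g \<in> stab S K"
    using SO_inv(1)[OF g(1)] g(2,3) by (simp add: stab_def) metis
  then show "inv\<^bsub>special_orthogonal_group\<^esub> g \<in> stab S K"
    by (simp add: inv_SO[OF g(1)])
next
  fix g h assume "g \<in> stab S K" "h \<in> stab S K"
  then show "g \<otimes>\<^bsub>special_orthogonal_group\<^esub> h \<in> stab S K"
    by (auto simp: stab_def intro: SO_comp)
qed

section \<open>Normal forms in coordinates\<close>

text \<open>
  The map \<open>K\<close> belonging to the cubic form
  \<open>lam * (2 * x^3 - 3 * x * (y^2 + z^2)) + mu * (y^3 - 3 * y * z^2)\<close>, and in \<open>form_Z2\<close> to
  \<open>lam * (2 * x^3 - 3 * x * (y^2 + z^2)) + 6 * mu * x * y * z\<close>.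
\<close>

definition form_Z3 :: "(3 \<Rightarrow> 'a::real_vector) \<Rightarrow> ('a \<Rightarrow> 'a \<Rightarrow> 'a) \<Rightarrow> real \<Rightarrow> real \<Rightarrow> bool" where
  "form_Z3 e K lam mu \<longleftrightarrow> (\<forall>x y z x' y' z'. K (comb e x y z) (comb e x' y' z') =
    comb e (lam * (2*x*x' - y*y' - z*z')) (mu * (y*y' - z*z') - lam * (x*y' + y*x')) (- lam * (x*z' + z*x') - mu * (y*z' + z*y')))"

definition form_Z2 :: "(3 \<Rightarrow> 'a::real_vector) \<Rightarrow> ('a \<Rightarrow> 'a \<Rightarrow> 'a) \<Rightarrow> real \<Rightarrow> real \<Rightarrow> bool" where
  "form_Z2 e K lam mu \<longleftrightarrow> (\<forall>x y z x' y' z'. K (comb e x y z) (comb e x' y' z') =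
    comb e (lam * (2*x*x' - y*y' - z*z') + mu * (y*z' + z*y')) (mu * (x*z' + z*x') - lam * (x*y' + y*x')) (mu * (x*y' + y*x') - lam * (x*z' + z*x')))"

text \<open>The cubic form is \<open>lam * (x^3 - 3 * x * y^2)\<close>, that is, lam times the real
  part of (x + i y)^3.\<close>

definition form_S3 :: "(3 \<Rightarrow> 'a::real_vector) \<Rightarrow> ('a \<Rightarrow> 'a \<Rightarrow> 'a) \<Rightarrow> real \<Rightarrow> bool" where
  "form_S3 e K lam \<longleftrightarrow> (\<forall>x y z x' y' z'. K (comb e x y z) (comb e x' y' z') =
    comb e (lam * (x*x' - y*y')) (- lam * (x*y' + y*x')) 0)"

text \<open>The symmetric maps that have \<open>e 1\<close> as an eigenvector; \<open>d = 0\<close>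
  gives the diagonal ones.\<close>

definition block_form :: "(3 \<Rightarrow> 'a::real_vector) \<Rightarrow> ('a \<Rightarrow> 'a) \<Rightarrow> real \<Rightarrow> real \<Rightarrow> real \<Rightarrow> real \<Rightarrow> bool" where
  "block_form e S a b c d \<longleftrightarrow> (\<forall>x y z. S (comb e x y z) = comb e (a*x) (b*y + d*z) (d*y + c*z))"

context onb begin

lemma K_matrices_iff:
  assumes "bilinear K"
  shows "matrix_wrt e (K (e 1)) = vector [vector [a11, a12, a13], vector [a21, a22, a23], vector [a31, a32, a33]] \<and>
    matrix_wrt e (K (e 2)) = vector [vector [b11, b12, b13], vector [b21, b22, b23], vector [b31, b32, b33]] \<and>
    matrix_wrt e (K (e 3)) = vector [vector [c11, c12, c13], vector [c21, c22, c23], vector [c31, c32, c33]] \<longleftrightarrow>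
    (\<forall>x y z x' y' z'. K (comb e x y z) (comb e x' y' z') =
      comb e (x*(a11*x'+a12*y'+a13*z') + y*(b11*x'+b12*y'+b13*z') + z*(c11*x'+c12*y'+c13*z'))
       (x*(a21*x'+a22*y'+a23*z') + y*(b21*x'+b22*y'+b23*z') + z*(c21*x'+c22*y'+c23*z'))
       (x*(a31*x'+a32*y'+a33*z') + y*(b31*x'+b32*y'+b33*z') + z*(c31*x'+c32*y'+c33*z')))" (is "?L \<longleftrightarrow> ?R")
proof
  assume ?L
  then show ?R
    by (simp add: matrix_wrt_eq_iff comb_bilinear[OF assms] algebra_simps)
next
  assume R: ?R
  show ?L
    unfolding matrix_wrt_eq_iff
    using R[rule_format, of 1 0 0 1 0 0] R[rule_format, of 1 0 0 0 1 0] R[rule_format, of 1 0 0 0 0 1]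
      R[rule_format, of 0 1 0 1 0 0] R[rule_format, of 0 1 0 0 1 0] R[rule_format, of 0 1 0 0 0 1]
      R[rule_format, of 0 0 1 1 0 0] R[rule_format, of 0 0 1 0 1 0] R[rule_format, of 0 0 1 0 0 1]
    by (simp flip: comb_unit)
qed

lemma form_Z3_iff:
  assumes "bilinear K"
  shows "form_Z3 e K lam mu \<longleftrightarrow>
     matrix_wrt e (K (e 1)) = vector [vector [2*lam, 0, 0], vector [0, -lam, 0], vector [0, 0, -lam]] \<and>
     matrix_wrt e (K (e 2)) = vector [vector [0, -lam, 0], vector [-lam, mu, 0], vector [0, 0, -mu]] \<and>
     matrix_wrt e (K (e 3)) = vector [vector [0, 0, -lam], vector [0, 0, -mu], vector [-lam, -mu, 0]]"
  unfolding K_matrices_iff[OF assms] form_Z3_def by (simp add: algebra_simps)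

lemma form_Z2_iff:
  assumes "bilinear K"
  shows "form_Z2 e K lam mu \<longleftrightarrow>
     matrix_wrt e (K (e 1)) = vector [vector [2*lam, 0, 0], vector [0, -lam, mu], vector [0, mu, -lam]] \<and>
     matrix_wrt e (K (e 2)) = vector [vector [0, -lam, mu], vector [-lam, 0, 0], vector [mu, 0, 0]] \<and>
     matrix_wrt e (K (e 3)) = vector [vector [0, mu, -lam], vector [mu, 0, 0], vector [-lam, 0, 0]]"
  unfolding K_matrices_iff[OF assms] form_Z2_def by (simp add: algebra_simps)

lemma form_S3_iff:
  assumes "bilinear K"
  shows "form_S3 e K lam \<longleftrightarrow>
     matrix_wrt e (K (e 1)) = vector [vector [lam, 0, 0], vector [0, -lam, 0], vector [0, 0, 0]] \<and>
     matrix_wrt e (K (e 2)) = vector [vector [0, -lam, 0], vector [-lam, 0, 0], vector [0, 0, 0]] \<and>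
     K (e 3) = (\<lambda>Y. 0)"
proof -
  have "linear (K (e 3))"
    using assms by (simp add: bilinear_def)
  moreover have "linear (\<lambda>Y. 0 :: 'a)"
    by (rule linearI) simp_all
  \<comment> \<open>The third condition is an equality of functions; by linearity it is the same as
    a zero matrix, which brings it into the shape of \<open>K_matrices_iff\<close>.\<close>
  ultimately have "K (e 3) = (\<lambda>Y. 0) \<longleftrightarrow> matrix_wrt e (K (e 3)) = vector [vector [0, 0, 0], vector [0, 0, 0], vector [0, 0, 0]]"
    unfolding matrix_wrt_eq_iff by (auto intro: linear_eqI)
  then show ?thesis
    using K_matrices_iff[OF assms, of lam 0 0 0 "-lam" 0 0 0 0 0 "-lam" 0 "-lam" 0 0 0 0 0 0 0 0 0 0 0 0 0 0]
    unfolding form_S3_def by (simp add: algebra_simps)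
qed

lemma block_form_iff:
  assumes "linear S"
  shows "block_form e S a b c d \<longleftrightarrow> matrix_wrt e S = vector [vector [a, 0, 0], vector [0, b, d], vector [0, d, c]]" (is "?L \<longleftrightarrow> ?R")
proof
  assume L: ?L
  show ?R
    using L[unfolded block_form_def, rule_format, of 1 0 0] L[unfolded block_form_def, rule_format, of 0 1 0]
       L[unfolded block_form_def, rule_format, of 0 0 1]
    by (simp add: matrix_wrt_eq_iff flip: comb_unit)
next
  assume ?R
  then show ?L
    by (simp add: matrix_wrt_eq_iff block_form_def comb_linear[OF assms] algebra_simps)
qed

lemma block_form_scalar: "block_form e S a a a 0 \<longleftrightarrow> S = (\<lambda>X. a *\<^sub>R X)"
proof
  assume L: "block_form e S a a a 0"
  show "S = (\<lambda>X. a *\<^sub>R X)"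
  proof
    fix X
    obtain x y z where "X = comb e x y z" by (rule comb_exhaust)
    then show "S X = a *\<^sub>R X"
      using L by (simp add: block_form_def)
  qed
qed (simp add: block_form_def)

text \<open>Translates the matrix definitions into polynomial formulas; the normal forms are used
  only in this shape from here on.\<close>

lemma type_iff:
  assumes S: "linear S" and K: "bilinear K"
  shows
  "type_SO3 S K e \<longleftrightarrow> (\<exists>a. K = (\<lambda>X Y. 0) \<and> S = (\<lambda>X. a *\<^sub>R X))"
  "type_Z2_SO2 S K e \<longleftrightarrow> (\<exists>a b. K = (\<lambda>X Y. 0) \<and> block_form e S a b b 0 \<and> a \<noteq> b)"
  "type_SO2 S K e \<longleftrightarrow> (\<exists>lam a b. form_Z3 e K lam 0 \<and> block_form e S a b b 0 \<and> lam > 0)"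
  "type_A4 S K e \<longleftrightarrow> (\<exists>lam a. form_Z2 e K 0 lam \<and> S = (\<lambda>X. a *\<^sub>R X) \<and> lam > 0)"
  "type_S3 S K e \<longleftrightarrow> (\<exists>lam a b. form_S3 e K lam \<and> block_form e S a a b 0 \<and> lam > 0)"
  "type_Z2_Z2 S K e \<longleftrightarrow> (\<exists>lam a b c. form_Z2 e K 0 lam \<and> block_form e S a b c 0 \<and>
     (lam > 0 \<and> \<not> (a = b \<and> b = c) \<or> lam = 0 \<and> a \<noteq> b \<and> b \<noteq> c \<and> a \<noteq> c))"
  "type_Z3 S K e \<longleftrightarrow> (\<exists>lam mu a b. form_Z3 e K lam mu \<and> block_form e S a b b 0 \<and>
     (lam > 0 \<and> mu > 0 \<and> mu \<noteq> sqrt 2 * lam \<or> mu = sqrt 2 * lam \<and> mu > 0 \<and> a \<noteq> b))"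
  "type_Z2 S K e \<longleftrightarrow> (\<exists>lam mu a b c d. form_Z2 e K lam mu \<and> block_form e S a b c d \<and>
     (lam > 0 \<and> mu > 0 \<and> lam \<noteq> mu \<or>
      lam = mu \<and> mu > 0 \<and> (b - c)^2 + (b + c - 2*a - 2*d)^2 \<noteq> 0 \<or>
      lam = 0 \<and> mu > 0 \<and> d \<noteq> 0 \<or>
      mu = 0 \<and> lam > 0 \<and> (b - c)^2 + d^2 \<noteq> 0))"
  unfolding form_Z3_iff[OF K] form_Z2_iff[OF K] form_S3_iff[OF K] block_form_iff[OF S]
    type_SO3_def type_Z2_SO2_def type_SO2_def type_A4_def type_S3_def type_Z2_Z2_def type_Z3_def type_Z2_def
  by (simp_all only: conj_assoc mult_zero_right minus_zero)

end

text \<open>The hypotheses say that \<open>v = comb e x y z\<close> satisfies \<open>K v v = (2 * lam) *\<^sub>R v\<close> for \<open>K\<close> in \<open>form_Z3\<close>, resp. \<open>form_Z2\<close>.\<close>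

lemma axial_eigenvector3:
  fixes lam mu x y z :: real
  assumes "lam > 0" "x^2 + y^2 + z^2 = 1"
    "lam * (2*x*x - y*y - z*z) = 2 * lam * x"
    "mu * (y*y - z*z) - lam * (x*y + y*x) = 2 * lam * y"
    "- lam * (x*z + z*x) - mu * (y*z + z*y) = 2 * lam * z"
  shows "x = 1 \<or> mu^2 = 2 * lam^2 \<and> x = - 1 / 3"
proof (rule disjCI)
  assume *: "\<not> (mu^2 = 2 * lam^2 \<and> x = - 1 / 3)"
  have "2*x*x - y*y - z*z = 2 * x"
    using assms(1,3) by simp
  \<comment> \<open>Since \<open>y^2 + z^2 = 1 - x^2\<close>, the first coordinate alone gives a
    quadratic equation for \<open>x\<close>.\<close>
  then have "(x - 1) * (3 * x + 1) = 0"
    using assms(2) by algebra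
  \<comment> \<open>-1/3 is the inner product of two unit vectors pointing to different vertices of
    a regular tetrahedron. The cases \<open>z = 0\<close> and \<open>z \<noteq> 0\<close> cover the
    vertices inside and outside the plane of \<open>e 1\<close> and \<open>e 2\<close>.\<close>
  moreover have "mu^2 = 2 * lam^2" if x: "3 * x + 1 = 0"
  proof -
    have yz: "9 * (y^2 + z^2) = 8"
      using assms(2) x by algebra
    have 1: "3 * mu * (y*y - z*z) = 4 * lam * y" and 2: "3 * mu * y * z = - 2 * lam * z"
      using assms(4,5) x by algebra+
    show ?thesis
    proof (cases "z = 0")
      case True
      then have "y \<noteq> 0" "9 * y^2 = 8"
        using yz by auto
      then have "3 * mu * y = 4 * lam"
        using 1 True by simp
      then have "9 * mu^2 * y^2 = 16 * lam^2"
        by algebra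
      then show ?thesis
        using \<open>9 * y^2 = 8\<close> by algebra
    next
      case False
      moreover have "z * (3 * mu * y + 2 * lam) = 0"
        using 2 by algebra
      ultimately have 3: "3 * mu * y = - 2 * lam"
        by simp
      have mu: "mu \<noteq> 0"
        using 3 assms(1) by auto
      have "mu * (z^2 - 3 * y^2) = 0"
        using 1 3 by algebra
      then have "z^2 = 3 * y^2"
        using mu by simp
      then have "9 * y^2 = 2"
        using yz by simp
      moreover have "(9 * y^2) * mu^2 = 4 * lam^2"
        using 3 by algebra
      ultimately show ?thesis
        by simp
    qed
  qed
  ultimately show "x = 1"
    using * by auto
qed

lemma axial_eigenvector2:
  fixes lam mu x y z :: real
  assumes "lam > 0" "mu \<ge> 0" "x^2 + y^2 + z^2 = 1"
    "lam * (2*x*x - y*y - z*z) + mu * (y*z + z*y) = 2 * lam * x"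
    "mu * (x*z + z*x) - lam * (x*y + y*x) = 2 * lam * y"
    "mu * (x*y + y*x) - lam * (x*z + z*x) = 2 * lam * z"
  shows "x = 1 \<or> lam = mu \<and> x = - 1 / 2 \<and> z = - y"
\<comment> \<open>The last two equations are exchanged by swapping \<open>y\<close> and
  \<open>z\<close>. Their sum and difference factor as
  \<open>(y + z) * (x * (mu - lam) - lam) = 0\<close> and
  \<open>(y - z) * (x * (lam + mu) + lam) = 0\<close>.\<close>
proof (cases "y = - z")
  case True
  show ?thesis
  proof (cases "z = 0")
    case True
    then have "x^2 = 1" "2*x*x = 2 * x" 
      using assms \<open>y = - z\<close> by auto
    then show ?thesis by (auto simp: power2_eq_square)
  next
    case False
    have "z * (x * (lam + mu) + lam) = 0"
      using True assms(6) by algebra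
    then have x: "x * (lam + mu) = - lam"
      using False by simp
    \<comment> \<open>A quadratic equation for \<open>x\<close>, from the first coordinate and the
      norm. Its second root is compatible with \<open>x * (lam + mu) = - lam\<close> only for
      \<open>lam = mu\<close>.\<close>
    have "(x - 1) * ((3*lam + mu) * x + (lam + mu)) = 0"
      using True assms(3,4) by algebra
    moreover have "x \<noteq> 1"
      using x assms(1,2) by auto
    ultimately have "(3*lam + mu) * x + (lam + mu) = 0"
      by simp
    then have "(lam + mu)^2 = lam * (3*lam + mu)"
      using x by algebra
    then have "(mu - lam) * (mu + 2 * lam) = 0"
      by algebra
    then have "lam = mu"
      using assms(1,2) by auto
    then have "lam * (2 * x + 1) = 0"
      using x by (simp add: algebra_simps)
    then have "x = - 1/2"
      using assms(1) by simp
    then show ?thesis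
      using True \<open>lam = mu\<close> by simp
  qed
next
  case yz: False
  have "(y + z) * (x * (mu - lam) - lam) = 0"
    using assms(5,6) by algebra
  then have x: "x * (mu - lam) = lam"
    using yz by auto
  show ?thesis
  proof (cases "y = z")
    case True
    have "2 * z^2 = 1 - x^2" "lam * (2*x^2) - lam * (2*z^2) + mu * (2*z^2) = 2 * lam * x"
      using True assms(3,4) by (simp_all add: power2_eq_square algebra_simps)
    then have "(x - 1) * ((3*lam - mu) * x + (lam - mu)) = 0"
      by algebra
    moreover have False if "(3*lam - mu) * x + (lam - mu) = 0"
    proof -
      have "((3*lam - mu) * x + (lam - mu)) * (mu - lam) = (3*lam - mu) * (x * (mu - lam)) - (mu - lam)^2"
        by algebra
      then have "(mu - lam)^2 = lam * (3*lam - mu)"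
        unfolding x that by (simp add: mult.commute)
      then have "(mu - 2 * lam) * (mu + lam) = 0"
        by algebra
      \<comment> \<open>The only candidate in this branch leads back to \<open>x = 1\<close>, where
        \<open>y\<close> and \<open>z\<close> vanish, against \<open>y \<noteq> - z\<close>.\<close>
      then have "mu = 2 * lam"
        using assms(1,2) by auto
      then have "lam * (x - 1) = 0"
        using x by algebra
      then have "x = 1"
        using assms(1) by simp
      then have "2 * z^2 = 0"
        using True assms(3) by simp
      then show False
        using yz True by simp
    qed
    ultimately show ?thesis by auto
  next
    case False
    have "(y - z) * (x * (lam + mu) + lam) = 0"
      using assms(5,6) by algebra
    then have "x * (lam + mu) = - lam"
      using False by auto
    \<comment> \<open>With both linear factors nonzero, the two equations for \<open>x\<close> hold
      simultaneously and are added and subtracted.\<close>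
    then have "mu * x = 0" "lam * (x + 1) = 0"
      using x by (simp_all add: algebra_simps)
    then have "x = - 1" "mu = 0"
      using assms(1) by auto
    then have "y^2 + z^2 = 0" 
      using assms(3) by simp
    then show ?thesis
      using yz by (simp add: sum_power2_eq_zero_iff)
  qed
qed

section \<open>Stabilizers of the normal forms\<close>

lemma stabD:
  assumes "g \<in> stab S K"
  shows "g \<in> SO" "\<And>X Y. K (g X) (g Y) = g (K X Y)" "\<And>X. S (g X) = g (S X)"
  using assms by (auto simp: stab_def)

context onb begin

lemma stabI:
  fixes S :: "'a \<Rightarrow> 'a"
  assumes "g \<in> SO"
    and "\<And>x y z x' y' z'. K (g (comb e x y z)) (g (comb e x' y' z')) = g (K (comb e x y z) (comb e x' y' z'))"
    and "\<And>x y z. S (g (comb e x y z)) = g (S (comb e x y z))"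
  shows "g \<in> stab S K"
  unfolding stab_def mem_Collect_eq
proof (intro conjI allI)
  show "g \<in> SO" by fact
  fix X Y :: 'a
  obtain x y z where X: "X = comb e x y z" by (rule comb_exhaust)
  obtain x' y' z' where Y: "Y = comb e x' y' z'" by (rule comb_exhaust)
  show "K (g X) (g Y) = g (K X Y)" "S (g X) = g (S X)"
    using assms(2,3) by (simp_all add: X Y)
qed

text \<open>\<open>c\<close> and \<open>s\<close> replace the angle, so that invariance under
  rotations about \<open>e 1\<close> becomes algebra modulo \<open>c^2 + s^2 = 1\<close>.\<close>

lemma SO_E_axis:
  fixes g :: "'a \<Rightarrow> 'a"
  assumes "g \<in> SO" "g (e 1) = e 1"
  obtains c s where "\<forall>x y z. g (comb e x y z) = comb e x (c*y - s*z) (s*y + c*z)" "c^2 + s^2 = 1"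
proof -
  obtain a1 a2 a3 b1 b2 b3 where g: "linear g" "g (e 1) = comb e a1 a2 a3" "g (e 2) = comb e b1 b2 b3"
    "g (e 3) = comb e (a2*b3-a3*b2) (a3*b1-a1*b3) (a1*b2-a2*b1)"
    "a1^2 + a2^2 + a3^2 = 1" "b1^2 + b2^2 + b3^2 = 1" "a1*b1 + a2*b2 + a3*b3 = 0"
    using SO_E[OF assms(1)] .
  then have "a1 = 1" "a2 = 0" "a3 = 0"
    using assms(2) by simp_all
  with g show thesis
    by (intro that[of b2 b3]) (simp_all add: comb_linear algebra_simps)
qed

end

context frame begin

text \<open>The eigenspace of \<open>S\<close> for the simple eigenvalue \<open>a\<close> is the
  line of \<open>e 1\<close>, which g must preserve. Conversely \<open>S\<close> is \<open>b\<close>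
  times the identity plus a multiple of the projection to that line, so it depends on the line
  only.\<close>

lemma stab_axis_line:
  assumes S: "block_form e S a b b 0" and "a \<noteq> b"
  shows "stab S (\<lambda>X Y. 0) = {g \<in> SO. g (e 1) = e 1 \<or> g (e 1) = - e 1}"
proof (intro equalityI subsetI)
  fix g assume g: "g \<in> stab S (\<lambda>X Y. 0)"
  obtain a1 a2 a3 where a: "g (e 1) = comb e a1 a2 a3" by (rule comb_exhaust)
  have "S (g (e 1)) = g (S (e 1))"
    using stabD(3)[OF g] .
  moreover have "S (e 1) = a *\<^sub>R e 1"
    using S[unfolded block_form_def, rule_format, of 1 0 0] by (simp add: comb_def)
  ultimately have "b * a2 = a * a2" "b * a3 = a * a3"
    using S SO_linear[OF stabD(1)[OF g]] by (simp_all add: a block_form_def linear_cmul[of g])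
  then have "a2 = 0" "a3 = 0"
    using \<open>a \<noteq> b\<close> by simp_all
  moreover have "a1 * a1 + a2 * a2 + a3 * a3 = 1"
    using SO_inner[OF stabD(1)[OF g], of "e 1" "e 1"] by (simp add: a)
  ultimately have "a1 = 1 \<or> a1 = - 1"
    using square_eq_1_iff by auto
  then show "g \<in> {g \<in> SO. g (e 1) = e 1 \<or> g (e 1) = - e 1}"
    using a \<open>a2 = 0\<close> \<open>a3 = 0\<close> stabD(1)[OF g] by (auto simp: comb_unit)
next
  fix g assume "g \<in> {g \<in> SO. g (e 1) = e 1 \<or> g (e 1) = - e 1}"
  then have g: "g \<in> SO" "g (e 1) = e 1 \<or> g (e 1) = - e 1"
    by auto
  have S_eq: "S X = b *\<^sub>R X + (a - b) *\<^sub>R ((e 1 \<bullet> X) *\<^sub>R e 1)" for X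
  proof -
    obtain x y z where "X = comb e x y z" by (rule comb_exhaust)
    then show ?thesis
      using S by (simp add: block_form_def comb_unit(1)[of e] algebra_simps del: comb_eq_e)
  qed
  have "(e 1 \<bullet> g X) *\<^sub>R e 1 = (e 1 \<bullet> X) *\<^sub>R g (e 1)" for X
    using g(2)
  proof
    assume "g (e 1) = - e 1"
    moreover from this have "e 1 \<bullet> g X = - (e 1 \<bullet> X)"
      using SO_inner[OF g(1), of "e 1" X] by simp
    ultimately show ?thesis
      by simp
  qed (use SO_inner[OF g(1), of "e 1" X] in auto)
  then show "g \<in> stab S (\<lambda>X Y. 0)"
    using SO_linear[OF g(1)]
    by (simp add: stab_def g(1) S_eq linear_add[of g] linear_cmul[of g] linear_0[of g] del: scaleR_scaleR)
qed

text \<open>The set is the stabilizer of the orthogonal projection to the line of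
  \<open>e 1\<close>, so \<open>subgroup_stab\<close> applies.\<close>

lemma subgroup_axis_line: "subgroup {g \<in> SO. g (e 1) = e 1 \<or> g (e 1) = - e 1} special_orthogonal_group"
proof -
  define S where "S X = (e 1 \<bullet> X) *\<^sub>R e 1" for X
  have "block_form e S 1 0 0 0"
    by (simp add: block_form_def S_def) (simp add: comb_def)
  then show ?thesis
    using stab_axis_line[of S 1 0] subgroup_stab[of S "\<lambda>X Y. 0"] by simp
qed

text \<open>If g reverses \<open>e 1\<close>, then \<open>rot_P \<omega> e 2\<close> after g fixes
  it and is a rotation about \<open>e 1\<close>; applying the half turn once more recovers
  g.\<close>

lemma axis_line_generated:
  "special_orthogonal_group\<lparr>carrier := {g \<in> SO. g (e 1) = e 1 \<or> g (e 1) = - e 1}\<rparr> =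
    generated_by (range (rotation \<omega> (e 1)) \<union> {rot_P \<omega> e 2})"
proof (rule generated_by_eqI[OF subgroup_axis_line])
  have P2: "rot_P \<omega> e 2 (e 1) = - e 1"
    using rot_P2[of 1 0 0] by (simp flip: comb_unit add: comb_def)
  have 1: "range (rotation \<omega> (e 1)) \<subseteq> {g \<in> SO. g (e 1) = e 1 \<or> g (e 1) = - e 1}"
    using axis_group by auto
  with P2 rot_SO(2) show "range (rotation \<omega> (e 1)) \<union> {rot_P \<omega> e 2} \<subseteq> {g \<in> SO. g (e 1) = e 1 \<or> g (e 1) = - e 1}"
    by auto
  fix g assume "g \<in> {g \<in> SO. g (e 1) = e 1 \<or> g (e 1) = - e 1}"
  then have g: "g \<in> SO" "g (e 1) = e 1 \<or> g (e 1) = - e 1"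
    by auto
  let ?G = "generate special_orthogonal_group (SO \<inter> (range (rotation \<omega> (e 1)) \<union> {rot_P \<omega> e 2}))"
  have P2G: "rot_P \<omega> e 2 \<in> ?G"
    using rot_SO(2) by (intro generate.incl) auto
  have *: "h \<in> ?G" if "h \<in> SO" "h (e 1) = e 1" for h
  proof -
    have "h \<in> range (rotation \<omega> (e 1))"
      using that axis_group by blast
    then show ?thesis
      using that(1) by (intro generate.incl) auto
  qed
  show "g \<in> ?G"
  proof (cases "g (e 1) = e 1")
    case False
    then have "g (e 1) = - e 1"
      using g by simp
    moreover have "rot_P \<omega> e 2 \<circ> rot_P \<omega> e 2 = id"
    proof (intro linear_eqI)
      show "linear (rot_P \<omega> e 2 \<circ> rot_P \<omega> e 2)" "linear (id :: 'a \<Rightarrow> 'a)"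
        using SO_linear[OF SO_comp[OF rot_SO(2) rot_SO(2)]] SO_linear[OF SO_id] .
    qed (simp_all add: comb_unit[of e] rot_P2 del: comb_eq_e)
    moreover have "rot_P \<omega> e 2 (- e 1) = e 1"
      using rot_P2[of "-1" 0 0] by (simp add: comb_def)
    ultimately have "(rot_P \<omega> e 2 \<circ> g) (e 1) = e 1" "g = rot_P \<omega> e 2 \<circ> (rot_P \<omega> e 2 \<circ> g)"
      by (simp_all flip: comp_assoc)
    moreover from this have "rot_P \<omega> e 2 \<circ> g \<in> ?G"
      using * SO_comp[OF rot_SO(2) g(1)] by blast
    ultimately show ?thesis
      using generate_comp[OF P2G] by metis
  qed (use * g in auto)
qed

text \<open>For \<open>mu = 0\<close> the exceptional solutions of \<open>axial_eigenvector3\<close>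
  would need \<open>lam = 0\<close>, so \<open>e 1\<close> is fixed. Conversely the cubic form and
  \<open>S\<close> involve \<open>y\<close> and \<open>z\<close> only through
  \<open>y^2 + z^2\<close>.\<close>

lemma stab_axis:
  assumes K: "form_Z3 e K lam 0" and S: "block_form e S a b b 0" and "lam > 0"
  shows "stab S K = range (rotation \<omega> (e 1))"
  unfolding axis_group[symmetric]
proof (intro equalityI subsetI)
  fix g assume g: "g \<in> stab S K"
  obtain a1 a2 a3 where a: "g (e 1) = comb e a1 a2 a3" by (rule comb_exhaust)
  have n: "a1^2 + a2^2 + a3^2 = 1"
    using SO_inner[OF stabD(1)[OF g], of "e 1" "e 1"] by (simp add: a power2_eq_square)
  have "K (g (e 1)) (g (e 1)) = g (K (e 1) (e 1))"
    using stabD(2)[OF g] .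
  moreover have "K (e 1) (e 1) = (2 * lam) *\<^sub>R e 1"
    using K[unfolded form_Z3_def, rule_format, of 1 0 0 1 0 0] by (simp add: comb_def)
  ultimately have "a1 = 1"
    using axial_eigenvector3[OF \<open>lam > 0\<close> n, of 0] K \<open>lam > 0\<close> SO_linear[OF stabD(1)[OF g]]
    by (simp add: a form_Z3_def linear_cmul[of g])
  moreover have "a2 = 0" "a3 = 0"
    using n \<open>a1 = 1\<close> by (simp_all add: sum_power2_eq_zero_iff)
  ultimately show "g \<in> {g \<in> SO. g (e 1) = e 1}"
    using stabD(1)[OF g] a by simp
next
  fix g assume "g \<in> {g \<in> SO. g (e 1) = e 1}"
  then have g: "g \<in> SO" "g (e 1) = e 1"
    by auto
  obtain c s where cs: "\<forall>x y z. g (comb e x y z) = comb e x (c*y - s*z) (s*y + c*z)" "c^2 + s^2 = 1"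
    using SO_E_axis[OF g] .
  show "g \<in> stab S K"
  proof (rule stabI[OF g(1)])
    fix x y z x' y' z' :: real
    have "(c*y - s*z) * (c*y' - s*z') + (s*y + c*z) * (s*y' + c*z') = y * y' + z * z'"
      using cs(2) by algebra
    then show "K (g (comb e x y z)) (g (comb e x' y' z')) = g (K (comb e x y z) (comb e x' y' z'))"
      using K by (simp add: cs(1) form_Z3_def) (simp add: algebra_simps)
    show "S (g (comb e x y z)) = g (S (comb e x y z))"
      using S by (simp add: cs(1) block_form_def algebra_simps)
  qed
qed

text \<open>The unit solutions of \<open>K v v = lam *\<^sub>R v\<close> are the three vertices of
  an equilateral triangle in the plane of \<open>e 1\<close> and \<open>e 2\<close>. A power of
  \<open>rot_R \<omega> e 3\<close> brings the image of \<open>e 1\<close> back to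
  \<open>e 1\<close>, and what remains is the identity or \<open>rot_P \<omega> e 1\<close>.\<close>

lemma stab_S3_generated:
  assumes K: "form_S3 e K lam" and S: "block_form e S a a b 0" and "lam > 0"
  shows "stabilizer_group S K = generated_by {rot_P \<omega> e 1, rot_R \<omega> e 3}"
  unfolding stabilizer_group_eq
proof (rule generated_by_eqI[OF subgroup_stab])
  have "rot_R \<omega> e 3 \<in> stab S K"
    using K S orientation_cases
    by (intro stabI[OF rot_SO(4)]) (auto simp: rot_R3 form_S3_def block_form_def field_simps)
  moreover have "rot_P \<omega> e 1 \<in> stab S K"
    using K S by (intro stabI[OF rot_SO(1)]) (simp_all add: rot_P1 form_S3_def block_form_def algebra_simps)
  ultimately show "{rot_P \<omega> e 1, rot_R \<omega> e 3} \<subseteq> stab S K"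
    by auto
  fix g assume g: "g \<in> stab S K"
  let ?A = "SO \<inter> {rot_P \<omega> e 1, rot_R \<omega> e 3}" and ?P = "rot_P \<omega> e 1" and ?R = "rot_R \<omega> e 3"
  let ?G = "generate special_orthogonal_group ?A"
  note gS = stabD(1)[OF g]
  have PG: "?P \<in> ?G" and RG: "?R \<in> ?G"
    using rot_SO(1,4) by (auto intro!: generate.incl)
  obtain a1 a2 a3 b1 b2 b3 where "linear g" and a: "g (e 1) = comb e a1 a2 a3" and b: "g (e 2) = comb e b1 b2 b3"
    and e3: "g (e 3) = comb e (a2*b3-a3*b2) (a3*b1-a1*b3) (a1*b2-a2*b1)"
    and aa: "a1^2 + a2^2 + a3^2 = 1" and bb: "b1^2 + b2^2 + b3^2 = 1" and ab: "a1*b1 + a2*b2 + a3*b3 = 0"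
    using SO_E[OF gS] .
  have "K (g (e 1)) (g (e 1)) = g (K (e 1) (e 1))" "K (g (e 1)) (g (e 2)) = g (K (e 1) (e 2))"
    using stabD(2)[OF g] by auto
  moreover have "K (e 1) (e 1) = lam *\<^sub>R e 1" "K (e 1) (e 2) = - lam *\<^sub>R e 2"
    using K[unfolded form_S3_def, rule_format, of 1 0 0 1 0 0] K[unfolded form_S3_def, rule_format, of 1 0 0 0 1 0]
    by (simp_all add: comb_def)
  ultimately have "lam * (a1*a1 - a2*a2 - a1) = 0" and eqs: "lam * (a2 * (2 * a1 + 1)) = 0" "a3 = 0"
    using \<open>linear g\<close> K \<open>lam > 0\<close> by (simp_all add: a b form_S3_def linear_cmul[of g] linear_neg[of g] algebra_simps)
  then have "a1*a1 - a2*a2 = a1"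
    using \<open>lam > 0\<close> by simp
  have cases: "a1 = 1 \<and> a2 = 0 \<or> a1 = - 1 / 2 \<and> a2 = sqrt 3 / 2 \<or> a1 = - 1 / 2 \<and> a2 = - sqrt 3 / 2"
  proof (cases "a2 = 0")
    case True
    then have "a1 * a1 = a1" "a1 \<noteq> 0"
      using eqs aa \<open>a1*a1 - a2*a2 = a1\<close> by auto
    then show ?thesis
      using True by simp
  next
    case False
    moreover have "a2 * (2 * a1 + 1) = 0"
      using eqs(1) \<open>lam > 0\<close> by simp
    ultimately have "a1 = - 1 / 2"
      by simp
    then have "a2^2 = (sqrt 3 / 2)^2"
      using aa eqs(2) by (simp add: power_divide)
    then show ?thesis
      using \<open>a1 = - 1 / 2\<close> power2_eq_iff by force
  qed
  have "\<exists>h\<in>?G. h (g (e 1)) = e 1"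
  proof -
    have "id \<in> ?G"
      by (rule id_generate)
    \<comment> \<open>With \<sigma> in the labels, the same power of the rotation works for both
      orientations.\<close>
    moreover have R: "?R (comb e (- 1 / 2) (- \<sigma> * (sqrt 3 / 2)) 0) = e 1"
      "?R (comb e (- 1 / 2) (\<sigma> * (sqrt 3 / 2)) 0) = comb e (- 1 / 2) (- \<sigma> * (sqrt 3 / 2)) 0"
      using orientation_cases by (auto simp: rot_R3)
    moreover have "g (e 1) = e 1 \<or> g (e 1) = comb e (- 1 / 2) (- \<sigma> * (sqrt 3 / 2)) 0 \<or>
      g (e 1) = comb e (- 1 / 2) (\<sigma> * (sqrt 3 / 2)) 0"
      unfolding a eqs(2) comb_eq_iff comb_eq_e using cases orientation_cases by (elim disjE) simp_all
    moreover have "(?R \<circ> ?R) (g (e 1)) = e 1" if "g (e 1) = comb e (- 1 / 2) (\<sigma> * (sqrt 3 / 2)) 0"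
      using R by (simp only: that comp_apply)
    ultimately show ?thesis
      using RG generate_comp[OF RG RG] by (metis id_apply)
  qed
  then obtain h where h: "h \<in> ?G" "h (g (e 1)) = e 1"
    by auto
  have "h \<in> SO" 
    using h generate_subset_SO by blast
  then obtain c s where hg: "\<forall>x y z. (h \<circ> g) (comb e x y z) = comb e x (c*y - s*z) (s*y + c*z)" "c^2 + s^2 = 1"
    using SO_E_axis[OF SO_comp[OF _ gS], of h] h(2) by auto
  have stabG: "?G \<subseteq> stab S K"
    using \<open>{?P, ?R} \<subseteq> stab S K\<close> by (intro group.generate_subgroup_incl[OF group_SO _ subgroup_stab]) auto
  have "h \<circ> g \<in> stab S K"
    using stabG h(1) g subgroup.m_closed[OF subgroup_stab, of h S K g] by auto
  \<comment> \<open>Here \<open>K (e 2) (e 2)\<close> is \<open>- lam *\<^sub>R e 1\<close>, while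
    the vector with coordinates 0, \<open>c\<close>, \<open>s\<close> gives \<open>c * c\<close>
    times that.\<close>
  then have "K ((h \<circ> g) (e 2)) ((h \<circ> g) (e 2)) = (h \<circ> g) (K (e 2) (e 2))"
    by (rule stabD(2))
  then have "c * c = 1"
    using K \<open>lam > 0\<close> hg(1)[rule_format, of 0 1 0] hg(1)[rule_format, of "- lam" 0 0] by (auto simp: comb_unit[of e] form_S3_def simp del: comb_eq_e)
  then have "s = 0"
    using hg(2) by (simp add: power2_eq_square)
  then consider "c = 1" | "c = - 1"
    using hg(2) power2_eq_1_iff by auto
  then show "g \<in> ?G"
  proof cases
    case 1
    then show ?thesis
      using generate_cancel[OF gS h(1) h(2)] hg(1)[rule_format, of 0 1 0] \<open>s = 0\<close> by (simp flip: comb_unit)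
  next
    case 2
    then have "h (g (e 2)) = comb e 0 (-1) 0"
      using hg(1)[rule_format, of 0 1 0] \<open>s = 0\<close> by (simp flip: comb_unit)
    then have "(?P \<circ> h) (g (e 1)) = e 1" "(?P \<circ> h) (g (e 2)) = e 2"
      using h(2) rot_P1[of 1 0 0] by (auto simp: rot_P1 simp flip: comb_unit)
    then show ?thesis
      using generate_cancel[OF gS generate_comp[OF PG h(1)]] by auto
  qed
qed

end

context frame begin

lemma rot_e:
  "rot_P \<omega> e 1 (e 1) = e 1" "rot_P \<omega> e 1 (e 2) = - e 2"
  "rot_P \<omega> e 2 (e 1) = - e 1" "rot_P \<omega> e 2 (e 2) = e 2"
  "rot_R \<omega> e 1 (e 1) = e 1"
  using rot_P1[of 1 0 0] rot_P1[of 0 1 0] rot_P2[of 1 0 0] rot_P2[of 0 1 0] rot_R1[of 1 0 0]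
  by (simp_all add: comb_def)

text \<open>\<open>K v v = (2 * lam) *\<^sub>R v\<close> and \<open>v \<bullet> v = 3\<close>
  characterize the vertices \<open>?w0\<close> to \<open>?w3\<close> of a regular tetrahedron. The
  half turns move the image of \<open>?w0\<close> back to \<open>?w0\<close>, then powers of
  \<open>rot_Q\<close>, which fix \<open>?w0\<close>, move the image of \<open>?w1\<close> back to
  \<open>?w1\<close>; a rotation that fixes two vertices is the identity.\<close>

lemma stab_A4_generated:
  assumes K: "form_Z2 e K 0 lam" and S: "S = (\<lambda>X. a *\<^sub>R X)" and "lam > 0"
  shows "stabilizer_group S K = generated_by {rot_P \<omega> e 1, rot_P \<omega> e 2, rot_Q \<omega> e}"
  unfolding stabilizer_group_eq
proof (rule generated_by_eqI[OF subgroup_stab])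
  have "rot_Q \<omega> e \<in> stab S K"
    using K SO_linear[OF rot_SO(5)] 
    by (intro stabI[OF rot_SO(5)]) (auto simp: rot_Q form_Z2_def S algebra_simps)
  moreover have "rot_P \<omega> e 1 \<in> stab S K"
    using K by (intro stabI[OF rot_SO(1)]) (simp_all add: rot_P1 form_Z2_def S algebra_simps)
  moreover have "rot_P \<omega> e 2 \<in> stab S K"
    using K by (intro stabI[OF rot_SO(2)]) (simp_all add: rot_P2 form_Z2_def S algebra_simps)
  ultimately show sub: "{rot_P \<omega> e 1, rot_P \<omega> e 2, rot_Q \<omega> e} \<subseteq> stab S K"
    by auto
  let ?A = "SO \<inter> {rot_P \<omega> e 1, rot_P \<omega> e 2, rot_Q \<omega> e}"
    and ?P1 = "rot_P \<omega> e 1" and ?P2 = "rot_P \<omega> e 2" and ?Q = "rot_Q \<omega> e"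
  let ?G = "generate special_orthogonal_group ?A"
  have G: "?P1 \<in> ?G" "?P2 \<in> ?G" "?Q \<in> ?G"
    using rot_SO by (auto intro!: generate.incl)
  have stabG: "?G \<subseteq> stab S K"
    using sub by (intro group.generate_subgroup_incl[OF group_SO _ subgroup_stab]) auto
  let ?w0 = "comb e 1 1 1" and ?w1 = "comb e 1 (- 1) (- 1)" and ?w2 = "comb e (- 1) 1 (- 1)" and ?w3 = "comb e (- 1) (- 1) 1"
  have vertex: "g w = ?w0 \<or> g w = ?w1 \<or> g w = ?w2 \<or> g w = ?w3"
    if "g \<in> stab S K" "w = ?w0 \<or> w = ?w1" for g w
  proof -
    have "K w w = (2 * lam) *\<^sub>R w" "w \<bullet> w = 3"
      using that(2) K by (auto simp: form_Z2_def)
    then have *: "K (g w) (g w) = (2 * lam) *\<^sub>R g w" "g w \<bullet> g w = 3"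
      using stabD(2)[OF that(1)] SO_inner[OF stabD(1)[OF that(1)]] linear_cmul[OF SO_linear[OF stabD(1)[OF that(1)]]] by auto
    obtain x y z where w: "g w = comb e x y z" by (rule comb_exhaust)
    \<comment> \<open>Multiplying two of these equations gives \<open>x * z^2 = x\<close> and
      \<open>x * y^2 = x\<close>, so the coordinates are signs with product 1.\<close>
    have xyz: "y * z = x" "x * z = y" "x * y = z" "x * x + y * y + z * z = 3"
      using * \<open>lam > 0\<close> K unfolding w by (auto simp: form_Z2_def)
    have "x \<noteq> 0"
      using xyz by auto
    have "x * (z * z) = x" "x * (y * y) = x"
      using xyz by (metis mult.assoc, metis mult.assoc mult.commute)
    then have "z * z = 1" "y * y = 1"
      using \<open>x \<noteq> 0\<close> by auto
    then show ?thesis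
      using xyz(1) unfolding w square_eq_1_iff by auto
  qed
  fix g assume g: "g \<in> stab S K"
  note gS = stabD(1)[OF g]
  have "\<exists>h\<in>?G. h (g ?w0) = ?w0"
  proof -
    have "?P1 ?w1 = ?w0" "?P2 ?w2 = ?w0" "(?P1 \<circ> ?P2) ?w3 = ?w0"
      by (simp_all add: rot_P1 rot_P2)
    then show ?thesis
      using vertex[OF g, of ?w0] G id_generate generate_comp by (metis id_apply)
  qed
  then obtain h where h: "h \<in> ?G" "h (g ?w0) = ?w0"
    by auto
  have hg: "h \<circ> g \<in> stab S K"
    using stabG h(1) g subgroup.m_closed[OF subgroup_stab, of h S K g] by auto
  have "(h \<circ> g) ?w1 \<noteq> ?w0"
  proof
    assume "(h \<circ> g) ?w1 = ?w0"
    then have "(h \<circ> g) (?w0 - ?w1) = 0"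
      using h(2) linear_diff[OF SO_linear[OF stabD(1)[OF hg]], of ?w0 ?w1] by simp
    then show False
      using SO_inner[OF stabD(1)[OF hg], of "?w0 - ?w1" "?w0 - ?w1"] by simp
  qed
  then have "(h \<circ> g) ?w1 = ?w1 \<or> (h \<circ> g) ?w1 = ?w2 \<or> (h \<circ> g) ?w1 = ?w3"
    using vertex[OF hg, of ?w1] by auto
  moreover have "?Q ?w2 = ?w3 \<and> ?Q ?w3 = ?w1 \<or> ?Q ?w2 = ?w1 \<and> ?Q ?w3 = ?w2"
    by (simp add: rot_Q)
  ultimately have "\<exists>q\<in>?G. q ((h \<circ> g) ?w1) = ?w1 \<and> q ?w0 = ?w0"
  proof -
    have "?Q ?w0 = ?w0"
      by (simp add: rot_Q)
    then have "id ?w0 = ?w0" "?Q ?w0 = ?w0" "(?Q \<circ> ?Q) ?w0 = ?w0"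
      by simp_all
    moreover assume "(h \<circ> g) ?w1 = ?w1 \<or> (h \<circ> g) ?w1 = ?w2 \<or> (h \<circ> g) ?w1 = ?w3"
      "?Q ?w2 = ?w3 \<and> ?Q ?w3 = ?w1 \<or> ?Q ?w2 = ?w1 \<and> ?Q ?w3 = ?w2"
    then have "id ((h \<circ> g) ?w1) = ?w1 \<or> ?Q ((h \<circ> g) ?w1) = ?w1 \<or> (?Q \<circ> ?Q) ((h \<circ> g) ?w1) = ?w1"
      by auto
    ultimately show ?thesis
      using G(3) id_generate generate_comp[OF G(3) G(3)] by blast
  qed
  then obtain q where q: "q \<in> ?G" "q (h (g ?w1)) = ?w1" "q ?w0 = ?w0"
    by auto
  define f where "f = q \<circ> h \<circ> g"
  have "q \<circ> h \<in> ?G"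
    using generate_comp[OF q(1) h(1)] .
  have fS: "f \<in> SO"
    using generate_subset_SO \<open>q \<circ> h \<in> ?G\<close> SO_comp[OF _ gS, of "q \<circ> h"] unfolding f_def by blast
  have w0: "f ?w0 = ?w0" "f ?w1 = ?w1"
    using q h by (simp_all add: f_def)
  \<comment> \<open>The sum of these two vertices is twice \<open>e 1\<close>, so \<open>f\<close>
    is a rotation about \<open>e 1\<close>; that it also fixes \<open>?w0\<close> makes the angle
    zero.\<close>
  then have "f (?w0 + ?w1) = ?w0 + ?w1"
    using linear_add[OF SO_linear[OF fS]] by metis
  then have "f (2 *\<^sub>R e 1) = 2 *\<^sub>R e 1"
    by (simp add: comb_unit[of e] del: comb_eq_e)
  then have f1: "f (e 1) = e 1"
    using linear_cmul[OF SO_linear[OF fS], of 2 "e 1"] by simp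
  obtain c s where cs: "\<forall>x y z. f (comb e x y z) = comb e x (c*y - s*z) (s*y + c*z)" "c^2 + s^2 = 1"
    using SO_E_axis[OF fS f1] .
  have "c = 1" "s = 0"
    using w0 by (simp_all add: cs(1))
  then have "f (e 2) = e 2"
    using cs(1)[rule_format, of 0 1 0] by (simp flip: comb_unit)
  then show "g \<in> ?G"
    using generate_cancel[OF gS \<open>q \<circ> h \<in> ?G\<close>] f1 by (simp add: f_def)
qed

text \<open>For \<open>lam > 0\<close> the unit solutions of \<open>K v v = 0\<close> lie on the
  coordinate axes, so g permutes the axes; the product of \<open>e 1\<close> and \<open>e 2\<close>
  leaves only even permutations, and a 3-cycle would force equal eigenvalues of \<open>S\<close>.
  For \<open>lam = 0\<close> the distinct eigenvalues fix each axis.\<close>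

lemma stab_Z2_Z2_generated:
  assumes K: "form_Z2 e K 0 lam" and S: "block_form e S a b c 0"
    and cond: "lam > 0 \<and> \<not> (a = b \<and> b = c) \<or> lam = 0 \<and> a \<noteq> b \<and> b \<noteq> c \<and> a \<noteq> c"
  shows "stabilizer_group S K = generated_by {rot_P \<omega> e 1, rot_P \<omega> e 2}"
  unfolding stabilizer_group_eq
proof (rule generated_by_eqI[OF subgroup_stab])
  have "rot_P \<omega> e 1 \<in> stab S K"
    using K S by (intro stabI[OF rot_SO(1)]) (simp_all add: rot_P1 form_Z2_def block_form_def algebra_simps)
  moreover have "rot_P \<omega> e 2 \<in> stab S K"
    using K S by (intro stabI[OF rot_SO(2)]) (simp_all add: rot_P2 form_Z2_def block_form_def algebra_simps)
  ultimately show sub: "{rot_P \<omega> e 1, rot_P \<omega> e 2} \<subseteq> stab S K"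
    by auto
  let ?A = "SO \<inter> {rot_P \<omega> e 1, rot_P \<omega> e 2}" and ?P1 = "rot_P \<omega> e 1" and ?P2 = "rot_P \<omega> e 2"
  let ?G = "generate special_orthogonal_group ?A"
  have G: "?P1 \<in> ?G" "?P2 \<in> ?G"
    using rot_SO by (auto intro!: generate.incl)
  fix g assume g: "g \<in> stab S K"
  note gS = stabD(1)[OF g]
  obtain a1 a2 a3 b1 b2 b3 where "linear g" and e1: "g (e 1) = comb e a1 a2 a3" and e2: "g (e 2) = comb e b1 b2 b3"
    and e3: "g (e 3) = comb e (a2*b3-a3*b2) (a3*b1-a1*b3) (a1*b2-a2*b1)"
    and aa: "a1^2 + a2^2 + a3^2 = 1" and bb: "b1^2 + b2^2 + b3^2 = 1" and ab: "a1*b1 + a2*b2 + a3*b3 = 0"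
    using SO_E[OF gS] .
  have Sd: "S (comb e x y z) = comb e (a*x) (b*y) (c*z)" for x y z
    using S by (simp add: block_form_def)
  have "S (g (e 1)) = g (S (e 1))" "S (g (e 2)) = g (S (e 2))"
    using stabD(3)[OF g] by auto
  moreover have "S (e 1) = a *\<^sub>R e 1" "S (e 2) = b *\<^sub>R e 2"
    using Sd[of 1 0 0] Sd[of 0 1 0] by (simp_all add: comb_def)
  ultimately have s: "(a - b) * a2 = 0" "(a - c) * a3 = 0" "(a - b) * b1 = 0" "(b - c) * b3 = 0"
    using linear_cmul[OF \<open>linear g\<close>] by (auto simp: e1 e2 Sd)
  have "a2 = 0 \<and> a3 = 0 \<and> b1 = 0 \<and> b3 = 0"
  proof (cases "lam > 0")
    case True
    have "K (e 1) (e 1) = 0" "K (e 2) (e 2) = 0" "K (e 1) (e 2) = lam *\<^sub>R e 3"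
      using K[unfolded form_Z2_def, rule_format, of 1 0 0 1 0 0] K[unfolded form_Z2_def, rule_format, of 1 0 0 0 1 0]
        K[unfolded form_Z2_def, rule_format, of 0 1 0 0 1 0]
      by (simp_all add: comb_def)
    then have "K (g (e 1)) (g (e 1)) = 0" "K (g (e 2)) (g (e 2)) = 0" "K (g (e 1)) (g (e 2)) = lam *\<^sub>R g (e 3)"
      using stabD(2)[OF g] linear_cmul[OF \<open>linear g\<close>] linear_0[OF \<open>linear g\<close>] by simp_all
    then have *: "a2 * a3 = 0" "a1 * a3 = 0" "a1 * a2 = 0" "b2 * b3 = 0" "b1 * b3 = 0" "b1 * b2 = 0"
      "a2 * b3 + a3 * b2 = a2*b3-a3*b2" "a1 * b3 + a3 * b1 = a3*b1-a1*b3" "a1 * b2 + a2 * b1 = a1*b2-a2*b1"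
      using K True unfolding e1 e2 e3 by (auto simp: form_Z2_def)
    \<comment> \<open>\<open>K (e 1) (e 2)\<close> is \<open>lam *\<^sub>R e 3\<close>, so the
      symmetric product of the images must equal their cross product; these three equations exclude
      the three transpositions of the axes.\<close>
    then have **: "a3 * b2 = 0" "a1 * b3 = 0" "a2 * b1 = 0"
      by simp_all
    have "a1 \<noteq> 0 \<or> a2 \<noteq> 0 \<or> a3 \<noteq> 0" "b1 \<noteq> 0 \<or> b2 \<noteq> 0 \<or> b3 \<noteq> 0"
      using aa bb by auto
    moreover have "a \<noteq> b \<or> b \<noteq> c"
      using cond True by auto
    ultimately show ?thesis
      using * ** s ab by auto
  next
    case False
    then show ?thesis
      using cond s by auto
  qed
  moreover from this have "a1 = 1 \<or> a1 = - 1" "b2 = 1 \<or> b2 = - 1"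
    using aa bb power2_eq_1_iff[of a1] power2_eq_1_iff[of b2] by auto
  ultimately have e: "g (e 1) = e 1 \<or> g (e 1) = - e 1" "g (e 2) = e 2 \<or> g (e 2) = - e 2"
    using e1 e2 by (auto simp: comb_def)
  have uminus: "rot_P \<omega> e i (- X) = - rot_P \<omega> e i X" for i X
    using linear_neg[OF rotation_linear] by (simp add: rot_P_def)
  from e show "g \<in> ?G"
  proof (elim disjE)
    assume "g (e 1) = e 1" "g (e 2) = e 2"
    then show ?thesis
      using generate_cancel[OF gS id_generate] by simp
  next
    assume "g (e 1) = e 1" "g (e 2) = - e 2"
    then show ?thesis
      using generate_cancel[OF gS G(1)] by (simp add: rot_e uminus)
  next
    assume "g (e 1) = - e 1" "g (e 2) = e 2"
    then show ?thesis
      using generate_cancel[OF gS G(2)] by (simp add: rot_e uminus)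
  next
    assume "g (e 1) = - e 1" "g (e 2) = - e 2"
    then show ?thesis
      using generate_cancel[OF gS generate_comp[OF G]] by (simp add: rot_e uminus)
  qed
qed

text \<open>Once \<open>e 1\<close> is known to be fixed, invariance of the term with coefficient
  \<open>mu\<close> forces the angle to be a multiple of \<open>2 * pi / 3\<close>.\<close>

lemma stab_Z3_generated:
  assumes K: "form_Z3 e K lam mu" and S: "block_form e S a b b 0"
    and cond: "lam > 0 \<and> mu > 0 \<and> mu \<noteq> sqrt 2 * lam \<or> mu = sqrt 2 * lam \<and> mu > 0 \<and> a \<noteq> b"
  shows "stabilizer_group S K = generated_by {rot_R \<omega> e 1}"
  unfolding stabilizer_group_eq
proof (rule generated_by_eqI[OF subgroup_stab])
  have R: "rot_R \<omega> e 1 \<in> stab S K"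
    using K S orientation_cases
    by (intro stabI[OF rot_SO(3)]) (auto simp: rot_R1 form_Z3_def block_form_def field_simps)
  then show "{rot_R \<omega> e 1} \<subseteq> stab S K"
    by auto
  let ?G = "generate special_orthogonal_group (SO \<inter> {rot_R \<omega> e 1})" and ?R = "rot_R \<omega> e 1"
  have RG: "?R \<in> ?G"
    using rot_SO by (auto intro!: generate.incl)
  have "lam > 0" "mu > 0"
    using cond by (auto simp: zero_less_mult_iff)
  fix g assume g: "g \<in> stab S K"
  note gS = stabD(1)[OF g]
  obtain x y z where e1: "g (e 1) = comb e x y z" by (rule comb_exhaust)
  have n: "x^2 + y^2 + z^2 = 1"
    using SO_inner[OF gS, of "e 1" "e 1"] by (simp add: e1 power2_eq_square)
  have "K (g (e 1)) (g (e 1)) = g (K (e 1) (e 1))"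
    using stabD(2)[OF g] .
  moreover have "K (e 1) (e 1) = (2 * lam) *\<^sub>R e 1"
    using K[unfolded form_Z3_def, rule_format, of 1 0 0 1 0 0] by (simp add: comb_def)
  ultimately have x: "x = 1 \<or> mu^2 = 2 * lam^2 \<and> x = - 1 / 3"
    using axial_eigenvector3[OF \<open>lam > 0\<close> n, of mu] K linear_cmul[OF SO_linear[OF gS]]
    by (simp add: e1 form_Z3_def)
  \<comment> \<open>Another tetrahedron vertex would have to be an eigenvector of \<open>S\<close>
    for \<open>a\<close>; since \<open>a \<noteq> b\<close> in this case, it would lie on the line
    of \<open>e 1\<close>, against \<open>x = - 1 / 3\<close>.\<close>
  have "x = 1"
  proof (rule ccontr)
    assume "x \<noteq> 1"
    with x have "mu^2 = (sqrt 2 * lam)^2" "x = - 1 / 3"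
      by (auto simp: power_mult_distrib)
    from this(1) have "mu = sqrt 2 * lam"
      by (rule power2_eq_imp_eq) (use \<open>mu > 0\<close> \<open>lam > 0\<close> in simp_all)
    then have "a \<noteq> b"
      using cond by auto
    have "S (e 1) = a *\<^sub>R e 1"
      using S[unfolded block_form_def, rule_format, of 1 0 0] by (simp add: comb_def)
    then have "S (comb e x y z) = a *\<^sub>R comb e x y z"
      using stabD(3)[OF g, of "e 1"] linear_cmul[OF SO_linear[OF gS]] by (simp add: e1 del: comb_scaleR)
    then have "b * y = a * y" "b * z = a * z"
      using S by (simp_all add: block_form_def)
    then have "y = 0" "z = 0"
      using \<open>a \<noteq> b\<close> by simp_all
    then show False
      using n \<open>x = - 1 / 3\<close> by (simp add: power2_eq_square)
  qed
  moreover have "y = 0" "z = 0"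
    using n \<open>x = 1\<close> by (simp_all add: sum_power2_eq_zero_iff)
  ultimately have g1: "g (e 1) = e 1"
    using e1 by simp
  obtain c s where cs: "\<forall>x y z. g (comb e x y z) = comb e x (c*y - s*z) (s*y + c*z)" "c^2 + s^2 = 1"
    using SO_E_axis[OF gS g1] .
  have e2: "g (e 2) = comb e 0 c s"
    using cs(1)[rule_format, of 0 1 0] by (simp flip: comb_unit)
  have "K (g (comb e 0 1 0)) (g (comb e 0 1 0)) = g (K (comb e 0 1 0) (comb e 0 1 0))"
    using stabD(2)[OF g] .
  \<comment> \<open>For z = c + i s these are the real and imaginary parts of conj(z)^2 = z, that is
    z^3 = 1.\<close>
  then have eqs: "mu * (c * c - s * s) = mu * c" "- mu * (2 * (c * s)) = mu * s"
    using K by (simp_all add: cs(1) form_Z3_def algebra_simps)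
  then have "mu * (c * c - s * s - c) = 0" "mu * (s * (2 * c + 1)) = 0"
    by (simp_all add: algebra_simps)
  then have cs': "c * c - s * s = c" "s = 0 \<or> c = - 1 / 2"
    using \<open>mu > 0\<close> by auto
  have cases: "c = 1 \<and> s = 0 \<or> c = - 1 / 2 \<and> s = sqrt 3 / 2 \<or> c = - 1 / 2 \<and> s = - sqrt 3 / 2"
  proof (cases "s = 0")
    case True
    then have "c * c = c" "c \<noteq> 0"
      using cs'(1) cs(2) by auto
    then show ?thesis
      using True by simp
  next
    case False
    then have "c = - 1 / 2"
      using cs' by simp
    then have "s^2 = (sqrt 3 / 2)^2"
      using cs(2) by (simp add: power_divide)
    then show ?thesis
      using \<open>c = - 1 / 2\<close> power2_eq_iff by force
  qed
  have "?R (comb e 0 (- 1 / 2) (- \<sigma> * (sqrt 3 / 2))) = e 2"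
    "?R (comb e 0 (- 1 / 2) (\<sigma> * (sqrt 3 / 2))) = comb e 0 (- 1 / 2) (- \<sigma> * (sqrt 3 / 2))"
    using orientation_cases by (auto simp: rot_R1)
  moreover have "g (e 2) = e 2 \<or> g (e 2) = comb e 0 (- 1 / 2) (- \<sigma> * (sqrt 3 / 2)) \<or>
      g (e 2) = comb e 0 (- 1 / 2) (\<sigma> * (sqrt 3 / 2))"
    unfolding e2 comb_eq_iff comb_eq_e using cases orientation_cases by (elim disjE) simp_all
  ultimately have "id (g (e 2)) = e 2 \<or> ?R (g (e 2)) = e 2 \<or> (?R \<circ> ?R) (g (e 2)) = e 2"
    by (metis comp_apply id_apply)
  then show "g \<in> ?G"
    using generate_cancel[OF gS id_generate] generate_cancel[OF gS RG] generate_cancel[OF gS generate_comp[OF RG RG]] g1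
    by (auto simp: rot_e)
qed

text \<open>First the image of \<open>e 1\<close> is confined to \<open>e 1\<close>, or possibly
  \<open>- e 1\<close> if \<open>lam = 0\<close>; then the image of \<open>e 2\<close> has no
  \<open>e 3\<close> component, because of \<open>mu\<close> or, if \<open>mu = 0\<close>, because
  \<open>S\<close> is not scalar on the plane; finally \<open>d \<noteq> 0\<close> excludes the sign
  change of \<open>e 1\<close>.\<close>

lemma stab_Z2_generated:
  assumes K: "form_Z2 e K lam mu" and S: "block_form e S a b c d"
    and cond: "lam > 0 \<and> mu > 0 \<and> lam \<noteq> mu \<or>
      lam = mu \<and> mu > 0 \<and> (b - c)^2 + (b + c - 2*a - 2*d)^2 \<noteq> 0 \<or>
      lam = 0 \<and> mu > 0 \<and> d \<noteq> 0 \<or>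
      mu = 0 \<and> lam > 0 \<and> (b - c)^2 + d^2 \<noteq> 0"
  shows "stabilizer_group S K = generated_by {rot_P \<omega> e 1}"
  unfolding stabilizer_group_eq
proof (rule generated_by_eqI[OF subgroup_stab])
  have R: "rot_P \<omega> e 1 \<in> stab S K"
    using K S
    by (intro stabI[OF rot_SO(1)]) (simp_all add: rot_P1 form_Z2_def block_form_def algebra_simps)
  then show "{rot_P \<omega> e 1} \<subseteq> stab S K"
    by auto
  let ?G = "generate special_orthogonal_group (SO \<inter> {rot_P \<omega> e 1})" and ?P = "rot_P \<omega> e 1"
  have PG: "?P \<in> ?G"
    using rot_SO by (auto intro!: generate.incl)
  fix g assume g: "g \<in> stab S K"
  note gS = stabD(1)[OF g]
  obtain x y z b1 b2 b3 where "linear g" and e1: "g (e 1) = comb e x y z" and e2: "g (e 2) = comb e b1 b2 b3"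
    and e3: "g (e 3) = comb e (y*b3-z*b2) (z*b1-x*b3) (x*b2-y*b1)"
    and n: "x^2 + y^2 + z^2 = 1" and bb: "b1^2 + b2^2 + b3^2 = 1" and ab: "x*b1 + y*b2 + z*b3 = 0"
    using SO_E[OF gS] .
  have "K (comb e 1 0 0) (comb e 1 0 0) = (2 * lam) *\<^sub>R e 1"
    "K (comb e 1 0 0) (comb e 0 1 0) = mu *\<^sub>R e 3 - lam *\<^sub>R e 2"
    using K[unfolded form_Z2_def, rule_format, of 1 0 0 1 0 0] K[unfolded form_Z2_def, rule_format, of 1 0 0 0 1 0] by (simp_all add: comb_def)
  then have K1: "K (g (e 1)) (g (e 1)) = (2 * lam) *\<^sub>R g (e 1)"
    and K2: "K (g (e 1)) (g (e 2)) = mu *\<^sub>R g (e 3) - lam *\<^sub>R g (e 2)"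
    using stabD(2)[OF g] linear_cmul[OF \<open>linear g\<close>] linear_diff[OF \<open>linear g\<close>] by (simp_all flip: comb_unit)
  have "S (comb e 1 0 0) = a *\<^sub>R e 1" "S (comb e 0 1 0) = b *\<^sub>R e 2 + d *\<^sub>R e 3"
    using S[unfolded block_form_def, rule_format, of 1 0 0] S[unfolded block_form_def, rule_format, of 0 1 0]
    by (simp_all add: comb_def)
  then have "S (g (e 1)) = a *\<^sub>R g (e 1)" "S (g (e 2)) = b *\<^sub>R g (e 2) + d *\<^sub>R g (e 3)"
    using stabD(3)[OF g] linear_cmul[OF \<open>linear g\<close>] linear_add[OF \<open>linear g\<close>] by (simp_all flip: comb_unit)
  then have S1: "b * y + d * z = a * y" "d * y + c * z = a * z"
    and S2: "a * b1 = b * b1 + d * (y*b3-z*b2)" "b * b2 + d * b3 = b * b2 + d * (z*b1-x*b3)"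
      "d * b2 + c * b3 = b * b3 + d * (x*b2-y*b1)"
    using S by (simp_all add: e1 e2 e3 block_form_def)
  have "x = 1 \<or> x = - 1 \<and> lam = 0"
  proof (cases "lam > 0")
    case True
    have "x = 1 \<or> lam = mu \<and> x = - 1 / 2 \<and> z = - y"
      using K1 K cond by (intro axial_eigenvector2[OF True _ n]) (auto simp: e1 form_Z2_def)
    moreover have False if "lam = mu" "x = - 1 / 2" "z = - y"
    proof -
      \<comment> \<open>The image of \<open>e 1\<close> must be an eigenvector of \<open>S\<close>
        for \<open>a\<close>. For another vertex of the triangle this means
        \<open>b = c = a + d\<close>, which is exactly the excluded case.\<close>
      have "(b - d - a) * y = 0" "(d - c + a) * y = 0"
        using S1 that by (simp_all add: algebra_simps)
      moreover have "y \<noteq> 0"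
        using n that by (auto simp: power2_eq_square)
      ultimately have "b - c = 0" "b + c - 2*a - 2*d = 0"
        by auto
      then show False
        using cond that True by auto
    qed
    ultimately show ?thesis by auto
  next
    case False
    then have l: "lam = 0" "mu > 0" "d \<noteq> 0"
      using cond by auto
    then have "y * z = 0" "x * z = 0" "x * y = 0"
      using K1 K by (simp_all add: e1 form_Z2_def)
    then have "x = 0 \<Longrightarrow> y = 0 \<and> z = 0"
      using S1 l by auto
    moreover have "x \<noteq> 0 \<Longrightarrow> y = 0 \<and> z = 0"
      using \<open>x * z = 0\<close> \<open>x * y = 0\<close> by auto
    ultimately have "y = 0" "z = 0"
      by auto
    then have "x^2 = 1"
      using n by simp
    then show ?thesis
      using l power2_eq_1_iff by auto
  qed
  moreover have yz: "y = 0" "z = 0"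
    using n calculation by (auto simp: sum_power2_eq_zero_iff)
  then have b1: "b1 = 0"
    using ab calculation by auto
  \<comment> \<open>The \<open>e 2\<close> coordinate of \<open>K2\<close>; the contributions of
    \<open>lam\<close> cancel because \<open>x = 1\<close> or \<open>lam = 0\<close>.\<close>
  have "mu * (x * b3) = - (mu * (x * b3))"
    using K2 K yz b1 calculation by (auto simp: e1 e2 e3 form_Z2_def)
  then have mu: "mu * b3 = 0"
    using calculation by auto
  have b3: "b3 = 0"
  proof (cases "mu = 0")
    case True
    then have "lam > 0" "x = 1" "(b - c)^2 + d^2 \<noteq> 0"
      using cond calculation by auto
    then have "d * b3 = 0" "(b - c) * b3 = 0"
      using S2(2,3) yz by auto
    then show ?thesis
      using \<open>(b - c)^2 + d^2 \<noteq> 0\<close> by auto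
  qed (use mu in auto)
  then have b2: "b2 = 1 \<or> b2 = - 1"
    using bb b1 power2_eq_1_iff by auto
  \<comment> \<open>With \<open>x = - 1\<close> the map would be a half turn about
    \<open>e 2\<close> or \<open>e 3\<close>; it preserves the form for \<open>lam = 0\<close> but
    reverses the sign of \<open>d\<close>.\<close>
  have "x = 1"
  proof (rule ccontr)
    assume "x \<noteq> 1"
    then have "x = - 1" "lam = 0"
      using calculation by auto
    then have "d * b2 = - (d * b2)" "d \<noteq> 0"
      using S2(3) b3 yz cond by auto
    then show False
      using b2 by auto
  qed
  then have g1: "g (e 1) = e 1" and g2: "g (e 2) = e 2 \<or> g (e 2) = - e 2"
    using yz b1 b2 b3 by (auto simp: e1 e2 comb_def)
  have "rot_P \<omega> e 1 (- e 2) = e 2"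
    using rot_P1[of 0 "-1" 0] by (simp add: comb_def)
  then show "g \<in> ?G"
    using generate_cancel[OF gS id_generate] generate_cancel[OF gS PG] g1 g2
    by (auto simp: rot_e)
qed

end

section \<open>Isomorphisms with the model groups\<close>

abbreviation sub_SO :: "('a::euclidean_space \<Rightarrow> 'a) set \<Rightarrow> ('a \<Rightarrow> 'a) monoid" where
  "sub_SO H \<equiv> special_orthogonal_group\<lparr>carrier := H\<rparr>"

lemma funpow_mod_id: "p ^^ n = id \<Longrightarrow> p ^^ (k mod n) = p ^^ k"
  using funpow_mod_eq[where f = p and n = n and m = k] by (auto simp: fun_eq_iff)

context onb begin

text \<open>Since the inverse of \<open>p\<close> is \<open>p ^^ (n - 1)\<close>, natural powers
  exhaust the group. Injectivity below \<open>n\<close> says that the order is exactly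
  \<open>n\<close>.\<close>

lemma generated_by_cyclic:
  fixes p :: "'a \<Rightarrow> 'a"
  assumes p: "p \<in> SO" and n: "p ^^ n = id" "n > 0" and inj: "inj_on (\<lambda>k. p ^^ k) {..<n}"
  shows "generated_by {p} \<cong> integer_mod_group n"
proof -
  have pow: "p ^^ k \<in> generate special_orthogonal_group (SO \<inter> {p})" for k
  proof (induction k)
    case 0
    then show ?case
      by (simp only: funpow.simps id_generate)
  next
    case (Suc k)
    have "p \<in> generate special_orthogonal_group (SO \<inter> {p})"
      using p by (auto intro: generate.incl)
    from generate_comp[OF this Suc] show ?case
      by (simp only: funpow.simps)
  qed
  have gen: "generate special_orthogonal_group (SO \<inter> {p}) \<subseteq> range (\<lambda>k. p ^^ k)"
  proof
    fix g assume "g \<in> generate special_orthogonal_group (SO \<inter> {p})"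
    then show "g \<in> range (\<lambda>k. p ^^ k)"
    proof induction
      case one
      then show ?case
        using rangeI[of "\<lambda>k. p ^^ k" 0] by (simp only: funpow.simps special_orthogonal_group_simps)
    next
      case (incl h)
      then show ?case
        using rangeI[of "\<lambda>k. p ^^ k" 1] by simp
    next
      case (inv h)
      have "p ^^ (n - 1) \<circ> p = id"
        using n by (metis Suc_diff_1 funpow_Suc_right)
      moreover have "p ^^ (n - 1) \<in> SO"
        using pow generate_subset_SO by blast
      ultimately have "inv\<^bsub>special_orthogonal_group\<^esub> p = p ^^ (n - 1)"
        using group.inv_equality[OF group_SO] p by simp
      then show ?case
        using inv by auto
    next
      case (eng h1 h2)
      then obtain i j where "h1 = p ^^ i" "h2 = p ^^ j"
        by auto
      then show ?case
        using rangeI[of "\<lambda>k. p ^^ k" "i + j"] by (simp only: funpow_add special_orthogonal_group_simps)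
    qed
  qed
  let ?h = "\<lambda>i. p ^^ nat i"
  have "?h \<in> iso (integer_mod_group n) (generated_by {p})"
    unfolding iso_iff
  proof (intro conjI)
    show "?h \<in> hom (integer_mod_group n) (generated_by {p})"
    proof (rule homI)
      fix i j assume "i \<in> carrier (integer_mod_group n)" "j \<in> carrier (integer_mod_group n)"
      then have ij: "i \<ge> 0" "j \<ge> 0"
        using n by (auto simp: carrier_integer_mod_group)
      \<comment> \<open>Exponents may be reduced modulo \<open>n\<close>; the nonnegativity of
        \<open>i\<close> and \<open>j\<close> lets \<open>nat\<close> commute with sum and
        remainder.\<close>
      then have "p ^^ nat ((i + j) mod int n) = p ^^ (nat i + nat j)"
        by (metis funpow_mod_id[OF n(1)] nat_add_distrib nat_int nat_mod_distrib add_nonneg_nonneg of_nat_0_le_iff)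
      then show "?h (i \<otimes>\<^bsub>integer_mod_group n\<^esub> j) = ?h i \<otimes>\<^bsub>generated_by {p}\<^esub> ?h j"
        by (simp add: subgroup_generated_def funpow_add)
    qed (use pow in \<open>simp add: carrier_subgroup_generated\<close>)
    have "p ^^ k \<in> ?h ` {0..<int n}" for k
    proof -
      have "p ^^ k = ?h (int (k mod n))"
        by (simp add: funpow_mod_id[OF n(1)])
      then show ?thesis
        using n by (metis atLeastLessThan_iff imageI mod_less_divisor of_nat_0_le_iff of_nat_less_iff)
    qed
    then show "?h ` carrier (integer_mod_group n) = carrier (generated_by {p})"
      using gen pow n by (auto simp: carrier_integer_mod_group carrier_subgroup_generated)
    show "inj_on ?h (carrier (integer_mod_group n))"
    proof (rule inj_onI)
      fix i j assume "i \<in> carrier (integer_mod_group n)" "j \<in> carrier (integer_mod_group n)" "?h i = ?h j"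
      moreover from this have "0 \<le> i" "0 \<le> j" "nat i < n" "nat j < n"
        using n by (auto simp: carrier_integer_mod_group nat_less_iff)
      ultimately show "i = j"
        using inj_onD[OF inj, of "nat i" "nat j"] by simp
    qed
  qed
  then show ?thesis
    using group.iso_sym[OF group_integer_mod_group] is_isoI by blast
qed

lemma generated_by_two_involutions:
  fixes p q :: "'a \<Rightarrow> 'a"
  assumes S: "p \<in> SO" "q \<in> SO" and pq: "p \<circ> p = id" "q \<circ> q = id" "q \<circ> p = p \<circ> q"
    and d: "p \<noteq> id" "q \<noteq> id" "p \<noteq> q"
  shows "generated_by {p, q} \<cong> model_Z2_Z2"
proof -
  let ?G = "generate special_orthogonal_group (SO \<inter> {p, q})"
  let ?V = "{id, p, q, p \<circ> q}"
  have G: "p \<in> ?G" "q \<in> ?G" "id \<in> ?G"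
    using S id_generate by (auto intro: generate.incl)
  have inv: "inv\<^bsub>special_orthogonal_group\<^esub> p = p" "inv\<^bsub>special_orthogonal_group\<^esub> q = q"
    using group.inv_equality[OF group_SO] S pq by auto
  have pq': "p (p x) = x" "q (q x) = x" "q (p x) = p (q x)" for x
    using pq by (metis comp_apply id_apply)+
  have closed: "f \<circ> g \<in> ?V" if "f \<in> ?V" "g \<in> ?V" for f g
    using that by (auto simp: fun_eq_iff pq')
  have "?G \<subseteq> ?V"
  proof
    fix g assume "g \<in> ?G"
    then show "g \<in> ?V"
    proof induction
      case (eng f g)
      then show ?case
        using closed by (simp only: special_orthogonal_group_simps)
    qed (use inv in auto)
  qed
  then have GV: "?G = ?V"
    using G generate_comp[OF G(1,2)] by auto
  have "p \<circ> q \<noteq> id" "p \<circ> q \<noteq> p" "p \<circ> q \<noteq> q"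
    using d pq by (metis comp_assoc comp_id id_comp)+
  let ?h = "\<lambda>(i :: int, j :: int). (if i = 0 then id else p) \<circ> (if j = 0 then id else q)"
  have c2: "carrier (integer_mod_group 2) = {0, 1}"
    by (auto simp: carrier_integer_mod_group)
  have "?h \<in> iso model_Z2_Z2 (generated_by {p, q})"
    unfolding iso_iff
  proof (intro conjI)
    show "?h \<in> hom model_Z2_Z2 (generated_by {p, q})"
      by (rule homI) (auto simp: c2 DirProd_def carrier_subgroup_generated GV subgroup_generated_def fun_eq_iff pq')
    show "?h ` carrier model_Z2_Z2 = carrier (generated_by {p, q})"
      by (auto simp: c2 DirProd_def carrier_subgroup_generated GV image_iff)
    show "inj_on ?h (carrier model_Z2_Z2)"
      using d d[symmetric] \<open>p \<circ> q \<noteq> id\<close> \<open>p \<circ> q \<noteq> p\<close> \<open>p \<circ> q \<noteq> q\<close>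
        \<open>p \<circ> q \<noteq> id\<close>[symmetric] \<open>p \<circ> q \<noteq> p\<close>[symmetric] \<open>p \<circ> q \<noteq> q\<close>[symmetric]
      by (auto simp: inj_on_def c2 DirProd_def)
  qed
  then show ?thesis
    using group.iso_sym[OF DirProd_group[OF group_integer_mod_group group_integer_mod_group]] is_isoI by blast
qed

end

text \<open>Two injective parametrizations by the same set that compose by the same law
  \<open>m\<close> differ by a group isomorphism. It serves to compare rotations about an axis with
  rotations of the plane.\<close>

lemma iso_parametrized:
  fixes F :: "'p \<Rightarrow> 'a::euclidean_space \<Rightarrow> 'a" and F' :: "'p \<Rightarrow> 'b::euclidean_space \<Rightarrow> 'b"
  assumes m: "\<And>x y. x \<in> D \<Longrightarrow> y \<in> D \<Longrightarrow> m x y \<in> D"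
    and F: "\<And>x y. x \<in> D \<Longrightarrow> y \<in> D \<Longrightarrow> F x \<circ> F y = F (m x y)" "inj_on F D"
    and F': "\<And>x y. x \<in> D \<Longrightarrow> y \<in> D \<Longrightarrow> F' x \<circ> F' y = F' (m x y)" "inj_on F' D"
  shows "sub_SO (F ` D) \<cong> sub_SO (F' ` D)"
proof (rule is_isoI)
  let ?h = "\<lambda>g. F' (inv_into D F g)"
  have h: "?h (F x) = F' x" if "x \<in> D" for x
    using that by (simp add: inv_into_f_f[OF F(2)])
  show "?h \<in> iso (sub_SO (F ` D)) (sub_SO (F' ` D))"
    unfolding iso_iff
  proof (intro conjI)
    show "?h \<in> hom (sub_SO (F ` D)) (sub_SO (F' ` D))"
    proof (rule homI)
      fix f g assume "f \<in> carrier (sub_SO (F ` D))" "g \<in> carrier (sub_SO (F ` D))"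
      then obtain x y where "f = F x" "g = F y" "x \<in> D" "y \<in> D"
        by auto
      then show "?h (f \<otimes>\<^bsub>sub_SO (F ` D)\<^esub> g) = ?h f \<otimes>\<^bsub>sub_SO (F' ` D)\<^esub> ?h g"
        by (simp add: h F(1) F'(1) m)
    qed (auto simp: h)
    show "?h ` carrier (sub_SO (F ` D)) = carrier (sub_SO (F' ` D))"
      by (auto simp: h image_iff)
    show "inj_on ?h (carrier (sub_SO (F ` D)))"
      using F'(2) by (auto simp: inj_on_def h)
  qed
qed

lemma endo_det_real2:
  "endo_det (g :: real^2 \<Rightarrow> real^2) = g (axis 1 1) $ 1 * g (axis 2 1) $ 2 - g (axis 2 1) $ 1 * g (axis 1 1) $ 2"
proof -
  have B: "Basis = {axis 1 1, axis 2 1 :: real^2}"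
    by (auto simp: Basis_vec_def UNIV_2)
  have d: "axis 1 1 \<noteq> (axis 2 1 :: real^2)"
    by (simp add: axis_eq_axis)
  have f12: "finite {axis 2 1 :: real^2}" "axis 1 1 \<notin> {axis 2 1 :: real^2}"
    using d by auto
  show ?thesis
    unfolding endo_det_def B sum_over_permutations_insert[OF f12] permutes_sing
    using d d[symmetric] by (simp add: sign_swap_id sign_id swap_id_eq inner_axis)
qed

definition rot2 :: "real \<times> real \<Rightarrow> real^2 \<Rightarrow> real^2" where
  "rot2 = (\<lambda>(c, s) x. vector [c * x$1 - s * x$2, s * x$1 + c * x$2])"

text \<open>For a matrix with orthonormal columns (c, s) and (p, q) and determinant 1,
  \<open>(p + s)^2 + (q - c)^2\<close> equals 1 + 1 - 2, so the second column is the first one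
  turned by a right angle.\<close>

lemma SO2_eq: "carrier model_SO2 = rot2 ` {(c, s). c^2 + s^2 = 1}"
proof (intro equalityI subsetI)
  fix g :: "real^2 \<Rightarrow> real^2"
  assume g: "g \<in> SO"
  define c s p q where cs: "c = g (axis 1 1) $ 1" "s = g (axis 1 1) $ 2" "p = g (axis 2 1) $ 1" "q = g (axis 2 1) $ 2"
  have "endo_det g = 1"
    using g by (simp add: SO_iff)
  then have det: "c * q - p * s = 1"
    by (simp add: endo_det_real2 cs)
  have "axis 1 1 \<bullet> (axis 2 1 :: real^2) = 0"
    by (simp add: inner_axis_axis)
  then have n: "c * c + s * s = 1" "p * p + q * q = 1"
    using SO_inner[OF g, of "axis 1 1" "axis 1 1"] SO_inner[OF g, of "axis 2 1" "axis 2 1"]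
    by (simp_all add: inner_vec_def sum_2 inner_axis_axis cs axis_def)
  have "(p + s)^2 + (q - c)^2 = (p * p + q * q) + (c * c + s * s) - 2 * (c * q - p * s)"
    by algebra
  then have "(p + s)^2 + (q - c)^2 = 0"
    using n det by simp
  then have pq: "p = - s" "q = c"
    by (auto simp: sum_power2_eq_zero_iff)
  have "g x = rot2 (c, s) x" for x
  proof -
    have "x = x$1 *\<^sub>R axis 1 1 + x$2 *\<^sub>R axis 2 1"
      by (simp add: vec_eq_iff forall_2 axis_def)
    then have "g x = g (x$1 *\<^sub>R axis 1 1 + x$2 *\<^sub>R axis 2 1)"
      by (rule arg_cong)
    also have "\<dots> = x$1 *\<^sub>R g (axis 1 1) + x$2 *\<^sub>R g (axis 2 1)"
      by (simp add: linear_add[OF SO_linear[OF g]] linear_cmul[OF SO_linear[OF g]])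
    finally have "g x = x$1 *\<^sub>R g (axis 1 1) + x$2 *\<^sub>R g (axis 2 1)" .
    then show ?thesis
      using pq by (simp add: rot2_def vec_eq_iff forall_2 cs algebra_simps)
  qed
  then show "g \<in> rot2 ` {(c, s). c^2 + s^2 = 1}"
    using n by (auto simp: power2_eq_square image_iff fun_eq_iff intro!: bexI[of _ "(c, s)"])
next
  fix g :: "real^2 \<Rightarrow> real^2"
  assume "g \<in> rot2 ` {(c, s). c^2 + s^2 = 1}"
  then obtain c s where g: "g = rot2 (c, s)" and cs: "c^2 + s^2 = 1"
    by auto
  have "linear g"
    by (rule linearI) (simp_all add: g rot2_def vec_eq_iff forall_2 algebra_simps)
  moreover have "g x \<bullet> g x = x \<bullet> x" for x
  proof -
    have "g x \<bullet> g x = (c^2 + s^2) * (x \<bullet> x)"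
      by (simp add: g rot2_def inner_vec_def sum_2) algebra
    then show ?thesis
      by (simp add: cs)
  qed
  ultimately have "orthogonal_transformation g"
    by (simp add: orthogonal_transformation norm_eq_sqrt_inner)
  moreover have "endo_det g = 1"
    using cs by (simp add: endo_det_real2 g rot2_def axis_def power2_eq_square)
  ultimately show "g \<in> SO"
    by (simp add: SO_iff)
qed

context frame begin

lemma axis_group_iso: "sub_SO (range (rotation \<omega> (e 1))) \<cong> model_SO2"
proof -
  let ?D = "{(c, s). c^2 + s^2 = 1 :: bool} :: (real \<times> real) set"
  define F where "F = (\<lambda>(c, s) X. comb e (e 1 \<bullet> X) (c * (e 2 \<bullet> X) - s * (e 3 \<bullet> X)) (s * (e 2 \<bullet> X) + c * (e 3 \<bullet> X)))"
  \<comment> \<open>Multiplication of complex numbers.\<close>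
  define m where "m = (\<lambda>(c :: real, s) (c', s'). (c * c' - s * s', s * c' + c * s'))"
  have "range (rotation \<omega> (e 1)) = F ` ?D"
    unfolding axis_group[symmetric]
  proof (intro equalityI subsetI)
    fix g assume "g \<in> {g \<in> SO. g (e 1) = e 1}"
    then obtain c s where cs: "\<forall>x y z. g (comb e x y z) = comb e x (c*y - s*z) (s*y + c*z)" "c^2 + s^2 = 1"
      using SO_E_axis by blast
    have "g X = F (c, s) X" for X
      unfolding F_def using cs(1) by (subst comb_expand[of X]) simp
    then show "g \<in> F ` ?D"
      using cs(2) by (auto simp: image_iff fun_eq_iff intro!: bexI[of _ "(c, s)"])
  next
    fix g assume "g \<in> F ` ?D"
    then obtain c s where g: "g = F (c, s)" and cs: "c^2 + s^2 = 1"
      by auto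
    have "g \<in> SO"
      by (rule SO_combI[of g 1 0 0 0 c s]) (use cs in \<open>simp_all add: g F_def algebra_simps\<close>)
    then show "g \<in> {g \<in> SO. g (e 1) = e 1}"
      by (simp add: g F_def)
  qed
  moreover have "sub_SO (F ` ?D) \<cong> sub_SO (rot2 ` ?D)"
  proof (rule iso_parametrized[where m = m])
    fix x y assume "x \<in> ?D" "y \<in> ?D"
    obtain c s c' s' where xy: "x = (c, s)" "y = (c', s')"
      by (cases x, cases y) auto
    show "m x y \<in> ?D"
    proof -
      have "(c * c' - s * s')^2 + (s * c' + c * s')^2 = (c^2 + s^2) * (c'^2 + s'^2)"
        by algebra
      then show ?thesis
        using \<open>x \<in> ?D\<close> \<open>y \<in> ?D\<close> by (simp add: xy m_def)
    qed
    show "F x \<circ> F y = F (m x y)"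
      by (simp add: xy F_def m_def fun_eq_iff algebra_simps)
    show "rot2 x \<circ> rot2 y = rot2 (m x y)"
      by (simp add: xy rot2_def m_def fun_eq_iff vec_eq_iff forall_2 algebra_simps)
  next
    show "inj_on F ?D"
    proof (rule inj_onI)
      fix x y assume "F x = F y"
      then have "F x (e 2) = F y (e 2)"
        by simp
      then show "x = y"
        by (cases x; cases y) (simp add: F_def)
    qed
    show "inj_on rot2 ?D"
    proof (rule inj_onI)
      fix x y assume "rot2 x = rot2 y"
      then have "rot2 x (axis 1 1) = rot2 y (axis 1 1)"
        by simp
      then show "x = y"
        by (cases x; cases y) (simp add: rot2_def vec_eq_iff forall_2 axis_def)
    qed
  qed
  moreover have "sub_SO (rot2 ` ?D) = model_SO2"
    unfolding SO2_eq[symmetric] by simp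
  ultimately show ?thesis
    by simp
qed

end

text \<open>Conjugation by the isometry that maps \<open>e\<close> to \<open>f\<close>. Orientations
  do not matter, since \<open>SO_I\<close> and \<open>SO_E\<close> describe rotations by the same
  formulas in every orthonormal basis. The behaviour on the first basis vector is recorded so that
  the isomorphism restricts to stabilizers of that axis.\<close>

lemma conjugation_iso:
  fixes e :: "3 \<Rightarrow> 'a::euclidean_space" and f :: "3 \<Rightarrow> 'b::euclidean_space"
  assumes "onb e" "onb f"
  obtains h where "h \<in> iso special_orthogonal_group special_orthogonal_group"
    "\<forall>g\<in>SO. (h g (f 1) = f 1 \<longleftrightarrow> g (e 1) = e 1) \<and> (h g (f 1) = - f 1 \<longleftrightarrow> g (e 1) = - e 1)"
proof -
  interpret e: onb e by fact
  interpret f: onb f by fact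
  define T where "T X = comb f (e 1 \<bullet> X) (e 2 \<bullet> X) (e 3 \<bullet> X)" for X
  define U where "U X = comb e (f 1 \<bullet> X) (f 2 \<bullet> X) (f 3 \<bullet> X)" for X
  have UT: "U (T X) = X" and TU: "T (U Y) = Y" for X Y
    by (simp_all add: T_def U_def flip: e.comb_expand f.comb_expand)
  have linT: "linear T" and linU: "linear U"
    by (rule linearI; simp add: T_def U_def inner_simps)+
  have T: "T (comb e x y z) = comb f x y z" and U: "U (comb f x y z) = comb e x y z" for x y z
    by (simp_all add: T_def U_def)
  have TSO: "T \<circ> g \<circ> U \<in> SO" if g_SO: "g \<in> SO" for g
  proof -
    obtain a1 a2 a3 b1 b2 b3 where g: "linear g" "g (e 1) = comb e a1 a2 a3" "g (e 2) = comb e b1 b2 b3"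
      "g (e 3) = comb e (a2*b3-a3*b2) (a3*b1-a1*b3) (a1*b2-a2*b1)"
      "a1^2 + a2^2 + a3^2 = 1" "b1^2 + b2^2 + b3^2 = 1" "a1*b1 + a2*b2 + a3*b3 = 0"
      using e.SO_E[OF g_SO] .
    have "linear (T \<circ> g \<circ> U)"
      using linT linU g(1) by (intro linear_compose)
    moreover have "U (f 1) = e 1" "U (f 2) = e 2" "U (f 3) = e 3"
      by (simp_all add: U_def)
    ultimately show ?thesis
      using g by (intro f.SO_I[of _ a1 a2 a3 b1 b2 b3]) (simp_all add: T)
  qed
  have USO: "U \<circ> g \<circ> T \<in> SO" if g_SO: "g \<in> SO" for g
  proof -
    obtain a1 a2 a3 b1 b2 b3 where g: "linear g" "g (f 1) = comb f a1 a2 a3" "g (f 2) = comb f b1 b2 b3"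
      "g (f 3) = comb f (a2*b3-a3*b2) (a3*b1-a1*b3) (a1*b2-a2*b1)"
      "a1^2 + a2^2 + a3^2 = 1" "b1^2 + b2^2 + b3^2 = 1" "a1*b1 + a2*b2 + a3*b3 = 0"
      using f.SO_E[OF g_SO] .
    have "linear (U \<circ> g \<circ> T)"
      using linT linU g(1) by (intro linear_compose)
    moreover have "T (e 1) = f 1" "T (e 2) = f 2" "T (e 3) = f 3"
      by (simp_all add: T_def)
    ultimately show ?thesis
      using g by (intro e.SO_I[of _ a1 a2 a3 b1 b2 b3]) (simp_all add: U)
  qed
  let ?h = "\<lambda>g. T \<circ> g \<circ> U"
  have "?h \<in> iso special_orthogonal_group special_orthogonal_group"
    unfolding iso_iff
  proof (intro conjI)
    show "?h \<in> hom special_orthogonal_group special_orthogonal_group"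
      by (rule homI) (auto simp: TSO UT fun_eq_iff)
    have "g \<in> ?h ` SO" if "g \<in> SO" for g
      using USO[OF that] by (intro image_eqI[of _ _ "U \<circ> g \<circ> T"]) (simp_all add: TU fun_eq_iff)
    then show "?h ` SO = SO"
      using TSO by auto
    show "inj_on ?h SO"
    proof (rule inj_onI)
      fix g g' assume "?h g = ?h g'"
      then have "U (?h g (T X)) = U (?h g' (T X))" for X
        by simp
      then show "g = g'"
        by (simp add: UT fun_eq_iff)
    qed
  qed
  moreover have "(?h g (f 1) = f 1 \<longleftrightarrow> g (e 1) = e 1) \<and> (?h g (f 1) = - f 1 \<longleftrightarrow> g (e 1) = - e 1)" for g
  proof -
    obtain x y z where "g (e 1) = comb e x y z" by (rule e.comb_exhaust)
    moreover have "U (f 1) = e 1"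
      by (simp add: U_def)
    ultimately have "?h g (f 1) = comb f x y z" "g (e 1) = comb e x y z"
      by (simp_all add: T)
    then show ?thesis
      unfolding comb_unit(1)[of e] comb_unit(1)[of f] by simp
  qed
  ultimately show ?thesis
    using that by blast
qed

lemma onb_axis: "onb (\<lambda>i. axis i 1 :: real^3)"
  by (rule onb.intro, rule orthonormal_basisI) (auto simp: inner_axis_axis)

lemma volume_form_det: "volume_form (\<lambda>u v w. det (vector [u, v, w] :: real^3^3))"
  unfolding volume_form_def
proof (intro conjI allI impI)
  fix u v w :: "real^3"
  show "linear (\<lambda>u. det (vector [u, v, w] :: real^3^3))" "linear (\<lambda>v. det (vector [u, v, w] :: real^3^3))"
    "linear (\<lambda>w. det (vector [u, v, w] :: real^3^3))"
    by (rule linearI; simp add: det_3 algebra_simps)+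
  show "det (vector [u, u, v] :: real^3^3) = 0" "det (vector [u, v, u] :: real^3^3) = 0" "det (vector [u, v, v] :: real^3^3) = 0"
    by (simp_all add: det_3)
  assume "norm u = 1 \<and> norm v = 1 \<and> norm w = 1 \<and> u \<bullet> v = 0 \<and> u \<bullet> w = 0 \<and> v \<bullet> w = 0"
  moreover have "row 1 (vector [u, v, w] :: real^3^3) = u" "row 2 (vector [u, v, w] :: real^3^3) = v"
    "row 3 (vector [u, v, w] :: real^3^3) = w"
    by (simp_all add: row_def)
  ultimately have "orthogonal_matrix (vector [u, v, w] :: real^3^3)"
    by (simp add: orthogonal_matrix_orthonormal_rows forall_3 orthogonal_def inner_commute)
  then show "\<bar>det (vector [u, v, w] :: real^3^3)\<bar> = 1"
    using det_orthogonal_matrix by force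
qed

lemma (in onb) SO_iso_model: "(special_orthogonal_group :: ('a \<Rightarrow> 'a) monoid) \<cong> model_SO3"
  using conjugation_iso[OF onb_axioms onb_axis] is_isoI by metis

text \<open>By \<open>axis_line_generated\<close> for the standard basis of \<open>real^3\<close>
  and the determinant as volume form, the model is itself the group preserving the line of the first
  axis; conjugation does the rest.\<close>

lemma (in frame) axis_line_iso:
  "sub_SO {g \<in> SO. g (e 1) = e 1 \<or> g (e 1) = - e 1} \<cong> model_Z2_SO2"
proof -
  let ?f = "\<lambda>i. axis i 1 :: real^3"
  let ?w = "\<lambda>u v w. det (vector [u, v, w] :: real^3^3)"
  interpret f: frame ?f ?w
    by (intro frame.intro onb_axis frame_axioms.intro volume_form_det)
  let ?A = "{g \<in> SO. g (e 1) = e 1 \<or> g (e 1) = - e 1}" and ?B = "{g \<in> SO. g (?f 1) = ?f 1 \<or> g (?f 1) = - ?f 1}"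
  have "model_Z2_SO2 = sub_SO ?B"
    using f.axis_line_generated by (simp add: model_Z2_SO2_def Let_def rot_P_def)
  moreover obtain h where h: "h \<in> iso special_orthogonal_group special_orthogonal_group"
    "\<forall>g\<in>SO. (h g (?f 1) = ?f 1 \<longleftrightarrow> g (e 1) = e 1) \<and> (h g (?f 1) = - ?f 1 \<longleftrightarrow> g (e 1) = - e 1)"
    using conjugation_iso[OF onb_axioms onb_axis] .
  have "h \<in> iso (sub_SO ?A) (sub_SO ?B)"
    unfolding iso_iff
  proof (intro conjI)
    have hom: "h \<in> hom special_orthogonal_group special_orthogonal_group" and im: "h ` SO = SO" and inj: "inj_on h SO"
      using h(1) unfolding iso_iff by auto
    show "h \<in> hom (sub_SO ?A) (sub_SO ?B)"
      using hom h(2) by (auto simp: hom_def)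
    show "h ` carrier (sub_SO ?A) = carrier (sub_SO ?B)"
      using im h(2) by (auto simp: image_iff) (metis (no_types, lifting) imageE)+
    show "inj_on h (carrier (sub_SO ?A))"
      using inj by (auto simp: inj_on_def)
  qed
  ultimately show ?thesis
    using is_isoI by auto
qed

text \<open>Sylvester's determinant identity for a perturbation of the identity of rank at most
  two.\<close>

lemma (in onb) det_double_reflection:
  fixes n1 n2 n3 u1 u2 u3 r d :: real
  assumes "\<And>X. g X = X - r *\<^sub>R ((comb e n1 n2 n3 \<bullet> X) *\<^sub>R comb e n1 n2 n3) - d *\<^sub>R ((comb e u1 u2 u3 \<bullet> X) *\<^sub>R comb e u1 u2 u3)"
    and "linear g"
  shows "endo_det g = 1 - r * (n1^2 + n2^2 + n3^2) - d * (u1^2 + u2^2 + u3^2) +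
    r * d * ((n1^2 + n2^2 + n3^2) * (u1^2 + u2^2 + u3^2) - (n1*u1 + n2*u2 + n3*u3)^2)"
  unfolding endo_det_eq[OF assms(2)] det_3
  by (simp add: matrix_wrt_def assms(1) inner_diff_right) algebra

text \<open>
  The permutations of vectors \<open>w 1, \<dots>, w n\<close> that form a tight frame with constant mutual inner
  products extend to isometries, where \<open>u\<close> spans the orthogonal complement of the frame: \<open>u = 0\<close>
  for the tetrahedron, a unit normal for the triangle. A transposition acts as a reflection,
  composed with the reflection along \<open>u\<close> if \<open>u\<close> is a unit vector.
\<close>

locale perm_rep = onb e for e :: "3 \<Rightarrow> 'a::euclidean_space" +
  fixes n :: nat and w :: "nat \<Rightarrow> 'a" and u :: 'a and c \<beta> :: real
  assumes gram: "\<And>i j. i \<in> {1..n} \<Longrightarrow> j \<in> {1..n} \<Longrightarrow> w i \<bullet> w j = (if i = j then \<beta> + 1 / c else \<beta>)"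
    and c: "c > 0"
    and tight: "\<And>X. X = c *\<^sub>R (\<Sum>i=1..n. (w i \<bullet> X) *\<^sub>R w i) + (u \<bullet> X) *\<^sub>R u"
    and uw: "\<And>i. i \<in> {1..n} \<Longrightarrow> u \<bullet> w i = 0"
    and u: "u = 0 \<or> u \<bullet> u = 1"
begin

definition L :: "(nat \<Rightarrow> nat) \<Rightarrow> 'a \<Rightarrow> 'a" where
  "L p X = c *\<^sub>R (\<Sum>i=1..n. (w i \<bullet> X) *\<^sub>R w (p i)) + (of_int (sign p) * (u \<bullet> X)) *\<^sub>R u"

lemma L_linear: "linear (L p)"
proof -
  have 1: "linear (\<lambda>X. (a \<bullet> X) *\<^sub>R b)" for a b :: 'a
    by (rule linearI) (simp_all add: inner_add_right scaleR_add_left)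
  have "L p = (\<lambda>X. c *\<^sub>R (\<Sum>i=1..n. (w i \<bullet> X) *\<^sub>R w (p i)) + (u \<bullet> X) *\<^sub>R (of_int (sign p) *\<^sub>R u))"
    by (simp add: L_def fun_eq_iff mult.commute)
  then show ?thesis
    by (simp only:) (intro linear_compose_add linear_compose_scale_right linear_compose_sum ballI 1)
qed

text \<open>The Gram matrix is unchanged when both indices are permuted, so after reindexing the sum
  is the frame expansion of \<open>w (p j)\<close>.\<close>

lemma L_w:
  assumes p: "p permutes {1..n}" and j: "j \<in> {1..n}"
  shows "L p (w j) = w (p j)"
proof -
  have pj: "p i \<in> {1..n}" if "i \<in> {1..n}" for i
    using permutes_in_image[OF p] that by blast
  have "w i \<bullet> w j = w (p i) \<bullet> w (p j)" if "i \<in> {1..n}" for i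
    using that j pj gram permutes_inj[OF p] by (auto simp: inj_eq)
  then have "(\<Sum>i=1..n. (w i \<bullet> w j) *\<^sub>R w (p i)) = (\<Sum>i=1..n. (w (p i) \<bullet> w (p j)) *\<^sub>R w (p i))"
    by simp
  also have "\<dots> = (\<Sum>i=1..n. (w i \<bullet> w (p j)) *\<^sub>R w i)"
    using sum.permute[OF p, of "\<lambda>i. (w i \<bullet> w (p j)) *\<^sub>R w i"] by (simp add: comp_def)
  finally show ?thesis
    using tight[of "w (p j)"] uw[OF j] uw[OF pj[OF j]] by (simp add: L_def)
qed

lemma u_scale: "(u \<bullet> u) *\<^sub>R u = u"
  using u by auto

lemma L_u: "L p u = of_int (sign p) *\<^sub>R u"
proof -
  have "(\<Sum>i=1..n. (w i \<bullet> u) *\<^sub>R w (p i)) = 0"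
    using uw by (intro sum.neutral) (simp add: inner_commute)
  then show ?thesis
    using u_scale by (simp add: L_def flip: scaleR_scaleR)
qed

text \<open>The frame vectors together with \<open>u\<close> span the space by \<open>tight\<close>,
  so the images of these vectors identify a linear map as \<open>L p\<close>.\<close>

lemma L_eqI:
  assumes "linear g" "\<And>j. j \<in> {1..n} \<Longrightarrow> g (w j) = w (p j)" "g u = of_int (sign p) *\<^sub>R u"
  shows "g = L p"
proof
  fix X
  have "g X = g (c *\<^sub>R (\<Sum>i=1..n. (w i \<bullet> X) *\<^sub>R w i) + (u \<bullet> X) *\<^sub>R u)"
    using tight[of X] by simp
  also have "\<dots> = c *\<^sub>R (\<Sum>i=1..n. (w i \<bullet> X) *\<^sub>R g (w i)) + (u \<bullet> X) *\<^sub>R g u"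
    by (simp add: linear_add[OF assms(1)] linear_cmul[OF assms(1)] linear_sum[OF assms(1)])
  also have "\<dots> = L p X"
    by (simp add: assms(2,3) L_def mult.commute)
  finally show "g X = L p X" .
qed

lemma L_comp:
  assumes p: "p permutes {1..n}" and q: "q permutes {1..n}"
  shows "L p \<circ> L q = L (p \<circ> q)"
proof (rule L_eqI)
  show "linear (L p \<circ> L q)"
    by (intro linear_compose L_linear)
  show "(L p \<circ> L q) (w j) = w ((p \<circ> q) j)" if "j \<in> {1..n}" for j
    using that permutes_in_image[OF q] by (simp add: L_w[OF p] L_w[OF q])
  have "permutation p" "permutation q"
    using p q permutation_permutes by blast+
  then show "(L p \<circ> L q) u = of_int (sign (p \<circ> q)) *\<^sub>R u"
    by (simp add: L_u linear_cmul[OF L_linear] sign_compose)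
qed

lemma L_id: "L id = id"
  using tight by (auto simp: L_def fun_eq_iff)

text \<open>The frame part of the norm depends on the Gram matrix only, the mixed term vanishes and
  the sign is squared. Hence the norm of \<open>L p X\<close> equals that of \<open>L id X\<close>,
  which is \<open>X\<close>.\<close>

lemma L_norm:
  assumes p: "p permutes {1..n}"
  shows "L p X \<bullet> L p X = X \<bullet> X"
proof -
  have pj: "p i \<in> {1..n}" if "i \<in> {1..n}" for i
    using permutes_in_image[OF p] that by blast
  define A where "A q = (\<Sum>i=1..n. (w i \<bullet> X) *\<^sub>R w (q i))" for q
  have "w (p i) \<bullet> w (p j) = w i \<bullet> w j" if "i \<in> {1..n}" "j \<in> {1..n}" for i j
    using that pj gram permutes_inj[OF p] by (auto simp: inj_eq)
  then have 1: "A p \<bullet> A p = A id \<bullet> A id"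
    by (simp add: A_def inner_sum_left inner_sum_right)
  have 2: "A q \<bullet> u = 0" if "\<And>i. i \<in> {1..n} \<Longrightarrow> q i \<in> {1..n}" for q
    unfolding A_def inner_sum_left
    using uw[OF that] by (intro sum.neutral) (simp add: inner_commute)
  have "L q X \<bullet> L q X = c * c * (A q \<bullet> A q) + (u \<bullet> X) * (u \<bullet> X) * (u \<bullet> u)"
    if "\<And>i. i \<in> {1..n} \<Longrightarrow> q i \<in> {1..n}" for q
  proof -
    define s :: real where "s = of_int (sign q)"
    have s: "s * s = 1"
      by (simp add: s_def sign_def)
    have "L q X = c *\<^sub>R A q + (s * (u \<bullet> X)) *\<^sub>R u"
      by (simp only: L_def A_def s_def)
    then have "L q X \<bullet> L q X = c * c * (A q \<bullet> A q) + 2 * c * s * (u \<bullet> X) * (A q \<bullet> u) +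
      (s * s) * (u \<bullet> X) * (u \<bullet> X) * (u \<bullet> u)"
      by (simp add: inner_add_left inner_add_right inner_commute[of u "A q"] algebra_simps)
    then show ?thesis
      using 2[OF that] s by simp
  qed
  from this[of p] this[of id] show ?thesis
    using pj 1 by (simp add: L_id)
qed

lemma L_orthogonal: "p permutes {1..n} \<Longrightarrow> orthogonal_transformation (L p)"
  using L_norm L_linear by (simp add: orthogonal_transformation norm_eq_sqrt_inner)

lemma det_L_transpose:
  assumes ab: "a \<in> {1..n}" "b \<in> {1..n}" "a \<noteq> b"
  shows "endo_det (L (Transposition.transpose a b)) = (if u = 0 then - 1 else 1)"
proof -
  \<comment> \<open>As \<open>w a - w b\<close> has squared length \<open>2 / c\<close>, the first
    correction is the reflection that exchanges \<open>w a\<close> and \<open>w b\<close>; the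
    second is the reflection along \<open>u\<close>, or zero if \<open>u = 0\<close>.\<close>
  define g where "g X = X - c *\<^sub>R (((w a - w b) \<bullet> X) *\<^sub>R (w a - w b)) - 2 *\<^sub>R ((u \<bullet> X) *\<^sub>R u)" for X
  have lin: "linear g"
    by (rule linearI) (simp_all add: g_def inner_add_right inner_diff_left inner_diff_right algebra_simps)
  have "(w a - w b) \<bullet> u = 0"
    using uw ab by (simp add: inner_diff_left inner_commute[of "w _" u])
  have "g = L (Transposition.transpose a b)"
  proof (rule L_eqI[OF lin])
    show "g (w j) = w (Transposition.transpose a b j)" if "j \<in> {1..n}" for j
      using ab that c uw[OF that] by (auto simp: g_def inner_diff_left gram transpose_def algebra_simps)
    show "g u = of_int (sign (Transposition.transpose a b)) *\<^sub>R u"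
      using ab \<open>(w a - w b) \<bullet> u = 0\<close> u_scale by (simp add: g_def sign_swap_id scaleR_2)
  qed
  obtain n1 n2 n3 where n: "w a - w b = comb e n1 n2 n3" by (rule comb_exhaust)
  obtain u1 u2 u3 where u': "u = comb e u1 u2 u3" by (rule comb_exhaust)
  have "c * ((w a - w b) \<bullet> (w a - w b)) = 2"
    using ab c by (simp add: inner_diff_left inner_diff_right gram)
  then have nn: "c * (n1^2 + n2^2 + n3^2) = 2"
    unfolding n by (simp add: power2_eq_square)
  have nu: "n1*u1 + n2*u2 + n3*u3 = 0"
    using \<open>(w a - w b) \<bullet> u = 0\<close> unfolding n u' by simp
  have "endo_det g = 1 - c * (n1^2 + n2^2 + n3^2) - 2 * (u1^2 + u2^2 + u3^2) +
    c * 2 * ((n1^2 + n2^2 + n3^2) * (u1^2 + u2^2 + u3^2) - (n1*u1 + n2*u2 + n3*u3)^2)"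
    by (rule det_double_reflection[OF _ lin]) (simp only: g_def n u')
  also have "\<dots> = 1 - c * (n1^2 + n2^2 + n3^2) - 2 * (u1^2 + u2^2 + u3^2) +
    2 * (c * (n1^2 + n2^2 + n3^2)) * (u1^2 + u2^2 + u3^2)"
    unfolding nu by simp
  also have "\<dots> = - 1 + 2 * (u \<bullet> u)"
    unfolding nn u' by (simp add: power2_eq_square)
  finally show ?thesis
    using u \<open>g = L (Transposition.transpose a b)\<close> by auto
qed

lemma det_L:
  assumes "p permutes {1..n}"
  shows "endo_det (L p) = (if u = 0 then of_int (sign p) else 1)"
  using assms finite_atLeastAtMost
proof (induction p rule: permutes_induct)
  case id
  show ?case
    unfolding L_id endo_det_id sign_id by simp
next
  case (swap a b p)
  have t: "Transposition.transpose a b permutes {1..n}"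
    using swap by (intro permutes_swap_id)
  have "permutation p"
    using swap permutation_permutes by blast
  have "endo_det (L (Transposition.transpose a b \<circ> p)) = endo_det (L (Transposition.transpose a b)) * endo_det (L p)"
    using endo_det_comp[OF L_linear L_linear] L_comp[OF t \<open>p permutes {1..n}\<close>] by metis
  also have "\<dots> = (if u = 0 then - 1 else 1) * (if u = 0 then of_int (sign p) else 1)"
    using swap by (simp only: det_L_transpose[OF \<open>a \<in> {1..n}\<close> \<open>b \<in> {1..n}\<close> \<open>a \<noteq> b\<close>])
  also have "\<dots> = (if u = 0 then of_int (sign (Transposition.transpose a b) * sign p) else 1)"
    using swap by (simp add: sign_swap_id)
  finally show ?case
    by (simp only: sign_compose[OF permutation_swap_id \<open>permutation p\<close>])
qed

lemma L_SO: "p permutes {1..n} \<Longrightarrow> u \<noteq> 0 \<or> evenperm p \<Longrightarrow> L p \<in> SO"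
  by (auto simp: SO_iff L_orthogonal det_L sign_def)

text \<open>Distinct frame vectors differ, because diagonal and off-diagonal Gram entries differ by
  \<open>1 / c > 0\<close>.\<close>

lemma L_inj:
  assumes p: "p permutes {1..n}" and q: "q permutes {1..n}" and "L p = L q"
  shows "p = q"
proof
  fix j
  show "p j = q j"
  proof (cases "j \<in> {1..n}")
    case True
    then have "w (p j) = w (q j)"
      using L_w[OF p] L_w[OF q] assms(3) by metis
    moreover have "p j \<in> {1..n}" "q j \<in> {1..n}"
      using permutes_in_image[OF p] permutes_in_image[OF q] True by blast+
    ultimately show ?thesis
      using gram[of "p j" "q j"] gram[of "p j" "p j"] c by (cases "p j = q j") simp_all
  qed (use p q in \<open>simp add: permutes_not_in\<close>)
qed

lemma L_invariant:
  assumes K: "\<And>X Y. K X Y = \<kappa> *\<^sub>R (\<Sum>i=1..n. ((w i \<bullet> X) * (w i \<bullet> Y)) *\<^sub>R w i)"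
    and p: "p permutes {1..n}"
  shows "K (L p X) (L p Y) = L p (K X Y)"
proof -
  have inner: "w (p i) \<bullet> L p X = w i \<bullet> X" if "i \<in> {1..n}" for i X
    using L_orthogonal[OF p] that unfolding orthogonal_transformation_def by (metis L_w[OF p])
  have "(\<Sum>i=1..n. ((w i \<bullet> L p X) * (w i \<bullet> L p Y)) *\<^sub>R w i) =
    (\<Sum>i=1..n. ((w (p i) \<bullet> L p X) * (w (p i) \<bullet> L p Y)) *\<^sub>R w (p i))"
    using sum.permute[OF p, of "\<lambda>i. ((w i \<bullet> L p X) * (w i \<bullet> L p Y)) *\<^sub>R w i"] by (simp add: comp_def)
  also have "\<dots> = (\<Sum>i=1..n. ((w i \<bullet> X) * (w i \<bullet> Y)) *\<^sub>R L p (w i))"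
    by (simp add: inner L_w[OF p])
  finally show ?thesis
    by (simp add: K linear_cmul[OF L_linear] linear_sum[OF L_linear])
qed

text \<open>A circle of inclusions: \<open>L\<close> maps \<open>H\<close> into the stabilizer, the
  stabilizer is generated by \<open>A\<close>, and \<open>A\<close> lies in the subgroup
  \<open>L\<close> \<open>H\<close>. So all three agree, and the faithful map \<open>L\<close> is
  the isomorphism. \<open>S\<close> commutes with \<open>L p\<close> because \<open>L p u\<close> is
  \<open>u\<close> or \<open>- u\<close>.\<close>

lemma generated_by_iso:
  assumes H: "subgroup H (sym_group n)" and S: "\<And>p. p \<in> H \<Longrightarrow> u \<noteq> 0 \<or> evenperm p"
    and stab: "stabilizer_group S K = generated_by A"
    and A: "A \<subseteq> L ` H"
    and K: "\<And>X Y. K X Y = \<kappa> *\<^sub>R (\<Sum>i=1..n. ((w i \<bullet> X) * (w i \<bullet> Y)) *\<^sub>R w i)"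
    and S': "\<And>X. S X = a *\<^sub>R X + b *\<^sub>R ((u \<bullet> X) *\<^sub>R u)"
  shows "stabilizer_group S K \<cong> (sym_group n)\<lparr>carrier := H\<rparr>"
proof -
  have H_perm: "p permutes {1..n}" if "p \<in> H" for p
    using subgroup.subset[OF H] that by (auto simp: sym_group_carrier)
  interpret H: group "(sym_group n)\<lparr>carrier := H\<rparr>"
    using group.subgroup_imp_group[OF sym_group_is_group H] .
  have LSO: "L p \<in> SO" if "p \<in> H" for p
    using L_SO[OF H_perm[OF that] S[OF that]] .
  have hom: "L \<in> hom ((sym_group n)\<lparr>carrier := H\<rparr>) special_orthogonal_group"
    by (rule homI) (use LSO L_comp H_perm in \<open>simp_all add: sym_group_mult\<close>)
  then interpret gh: group_hom "(sym_group n)\<lparr>carrier := H\<rparr>" "special_orthogonal_group :: ('a \<Rightarrow> 'a) monoid" L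
    by (intro group_hom.intro H.group_axioms group_SO group_hom_axioms.intro)
  have sub: "subgroup (L ` H) special_orthogonal_group"
    using gh.img_is_subgroup by simp
  have "L p \<in> stab S K" if "p \<in> H" for p
    unfolding stab_def mem_Collect_eq
  proof (intro conjI allI)
    note p = H_perm[OF that]
    show "L p \<in> SO" using LSO that .
    show "K (L p X) (L p Y) = L p (K X Y)" for X Y
      using L_invariant[OF K p] .
    have "of_int (sign p) * (u \<bullet> L p X) = u \<bullet> X" for X
    proof -
      have "L p u \<bullet> L p X = u \<bullet> X"
        using L_orthogonal[OF p] unfolding orthogonal_transformation_def by auto
      then show ?thesis
        by (simp add: L_u)
    qed
    moreover have "of_int (sign p) * of_int (sign p) = (1 :: real)"
      by (simp add: sign_def)
    ultimately have "(u \<bullet> X) * of_int (sign p) = u \<bullet> L p X" for X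
      by (metis mult.assoc mult.commute mult_1)
    then have "(u \<bullet> L p X) *\<^sub>R u = (u \<bullet> X) *\<^sub>R L p u" for X
      by (simp add: L_u)
    then show "S (L p X) = L p (S X)" for X
      by (simp add: S' linear_add[OF L_linear] linear_cmul[OF L_linear] del: scaleR_scaleR)
  qed
  moreover have "stab S K = generate special_orthogonal_group (SO \<inter> A)"
    using arg_cong[OF stab, of carrier] by (simp add: stabilizer_group_eq subgroup_generated_def)
  moreover have "generate special_orthogonal_group (SO \<inter> A) \<subseteq> L ` H"
    using A by (intro group.generate_subgroup_incl[OF group_SO _ sub]) auto
  ultimately have "stab S K = L ` H"
    by blast
  then have "L \<in> iso ((sym_group n)\<lparr>carrier := H\<rparr>) (stabilizer_group S K)"
    using hom L_inj H_perm
    unfolding iso_iff by (auto simp: stabilizer_group_eq hom_def inj_on_def)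
  then show ?thesis
    using H.iso_sym is_isoI by blast
qed

end

context frame begin

lemma A4_iso:
  assumes K: "form_Z2 e K 0 lam" and S: "S = (\<lambda>X. a *\<^sub>R X)" and "lam > 0"
  shows "stabilizer_group S K \<cong> model_A4"
proof -
  define w where "w i = (if i = 1 then comb e 1 1 1 else if i = 2 then comb e 1 (- 1) (- 1)
    else if i = 3 then comb e (- 1) 1 (- 1) else comb e (- 1) (- 1) 1)" for i :: nat
  have four: "{1..4} = {1, 2, 3, 4 :: nat}"
    by auto
  have w: "w 1 = comb e 1 1 1" "w (Suc 0) = comb e 1 1 1" "w 2 = comb e 1 (- 1) (- 1)" "w 3 = comb e (- 1) 1 (- 1)" "w 4 = comb e (- 1) (- 1) 1"
    by (simp_all add: w_def)
  \<comment> \<open>The tetrahedron: squared lengths 3, mutual inner products -1, and the sum of the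
    dyads of the \<open>w i\<close> is 4 times the identity.\<close>
  interpret perm_rep e 4 w 0 "1/4" "- 1"
  proof unfold_locales
    show "w i \<bullet> w j = (if i = j then - 1 + 1 / (1 / 4) else - 1)" if "i \<in> {1..4}" "j \<in> {1..4}" for i j
      using that unfolding four by (elim insertE emptyE) (simp_all add: w)
    fix X :: 'a
    obtain x y z where "X = comb e x y z" by (rule comb_exhaust)
    then show "X = (1 / 4) *\<^sub>R (\<Sum>i=1..4. (w i \<bullet> X) *\<^sub>R w i) + (0 \<bullet> X) *\<^sub>R 0"
      unfolding four by (simp add: w)
  qed auto
  have "stabilizer_group S K \<cong> (sym_group 4)\<lparr>carrier := carrier (alt_group 4)\<rparr>"
  \<comment> \<open>The sum of the cubes of the \<open>w i \<bullet> X\<close> is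
    \<open>24 * x * y * z\<close>, while the form is \<open>6 * lam * x * y * z\<close>; hence the
    factor \<open>lam / 4\<close>.\<close>
  proof (rule generated_by_iso[OF alt_group_is_subgroup _ stab_A4_generated[OF K S \<open>lam > 0\<close>], of "lam / 4" a 0])
    show "K X Y = (lam / 4) *\<^sub>R (\<Sum>i=1..4. ((w i \<bullet> X) * (w i \<bullet> Y)) *\<^sub>R w i)" for X Y
    proof -
      obtain x y z where "X = comb e x y z" by (rule comb_exhaust)
      moreover obtain x' y' z' where "Y = comb e x' y' z'" by (rule comb_exhaust)
      ultimately show ?thesis
        using K unfolding four by (simp add: w form_Z2_def algebra_simps)
    qed
    let ?t = "Transposition.transpose :: nat \<Rightarrow> nat \<Rightarrow> nat \<Rightarrow> nat"
    have alt: "?t i j \<circ> ?t k l \<in> carrier (alt_group 4)" if "i \<noteq> j" "k \<noteq> l" "{i, j, k, l} \<subseteq> {1..4}" for i j k l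
      using that by (auto simp: alt_group_carrier evenperm_comp permutation_swap_id evenperm_swap intro!: permutes_compose permutes_swap_id)
    have L: "g \<in> L ` carrier (alt_group 4)"
      if "g \<in> SO" "i \<noteq> j" "k \<noteq> l" "{i, j, k, l} \<subseteq> {1..4}" "\<And>m. m \<in> {1..4} \<Longrightarrow> g (w m) = w ((?t i j \<circ> ?t k l) m)" for g i j k l
    proof (rule image_eqI[OF _ alt[OF that(2-4)]])
      show "g = L (?t i j \<circ> ?t k l)"
        by (rule L_eqI[OF SO_linear[OF that(1)] that(5)]) (simp_all add: linear_0[OF SO_linear[OF that(1)]])
    qed
    have "rot_P \<omega> e 1 \<in> L ` carrier (alt_group 4)"
      \<comment> \<open>The half turn about \<open>e 1\<close> acts on the vertices as (1 2)(3
        4).\<close>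
      by (rule L[OF rot_SO(1), of 1 2 3 4], simp, simp, simp, unfold four, elim insertE emptyE, simp_all add: w rot_P1 transpose_def)
    moreover have "rot_P \<omega> e 2 \<in> L ` carrier (alt_group 4)"
      by (rule L[OF rot_SO(2), of 1 3 2 4], simp, simp, simp, unfold four, elim insertE emptyE, simp_all add: w rot_P2 transpose_def)
    moreover have "rot_Q \<omega> e \<in> L ` carrier (alt_group 4)"
    proof (cases "\<sigma> = 1")
      case True
      show ?thesis
        by (rule L[OF rot_SO(5), of 2 3 3 4], simp, simp, simp, unfold four, elim insertE emptyE, simp_all add: w rot_Q True transpose_def)
    next
      case False
      then show ?thesis
        by (intro L[OF rot_SO(5), of 3 4 2 3], simp, simp, simp, unfold four, elim insertE emptyE, simp_all add: w rot_Q transpose_def)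
    qed
    ultimately show "{rot_P \<omega> e 1, rot_P \<omega> e 2, rot_Q \<omega> e} \<subseteq> L ` carrier (alt_group 4)"
      by simp
  qed (auto simp: S alt_group_carrier)
  then show ?thesis
    by (simp add: alt_group_def)
qed

lemma S3_iso:
  assumes K: "form_S3 e K lam" and S: "block_form e S a a b 0" and "lam > 0"
  shows "stabilizer_group S K \<cong> model_S3"
proof -
  define w where "w i = (if i = 1 then comb e 1 0 0 else if i = 2 then comb e (- 1 / 2) (sqrt 3 / 2) 0
    else comb e (- 1 / 2) (- sqrt 3 / 2) 0)" for i :: nat
  have three: "{1..3} = {1, 2, 3 :: nat}"
    by auto
  have w: "w 1 = comb e 1 0 0" "w (Suc 0) = comb e 1 0 0" "w 2 = comb e (- 1 / 2) (sqrt 3 / 2) 0"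
    "w 3 = comb e (- 1 / 2) (- sqrt 3 / 2) 0"
    by (simp_all add: w_def)
  have u: "e 3 = comb e 0 0 1"
    by simp
  \<comment> \<open>The triangle: unit vectors with inner products -1/2, whose dyads add up to 3/2
    times the projection to their plane; \<open>e 3\<close> is the normal.\<close>
  interpret perm_rep e 3 w "e 3" "2/3" "- 1 / 2"
  proof unfold_locales
    show "w i \<bullet> w j = (if i = j then - 1 / 2 + 1 / (2 / 3) else - 1 / 2)" if "i \<in> {1..3}" "j \<in> {1..3}" for i j
      using that unfolding three by (elim insertE emptyE) (simp_all add: w)
    show "e 3 \<bullet> w i = 0" if "i \<in> {1..3}" for i
      using that unfolding three by (elim insertE emptyE) (simp_all add: w)
    fix X :: 'a
    obtain x y z where X: "X = comb e x y z" by (rule comb_exhaust)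
    have "(\<Sum>i=1..3. (w i \<bullet> X) *\<^sub>R w i) = comb e (3 / 2 * x) (3 / 2 * y) 0"
      unfolding three X by (simp add: w field_simps)
    then show "X = (2 / 3) *\<^sub>R (\<Sum>i=1..3. (w i \<bullet> X) *\<^sub>R w i) + (e 3 \<bullet> X) *\<^sub>R e 3"
      unfolding X by (simp add: comb_unit(3)[of e] del: comb_eq_e)
  qed auto
  have "e 3 \<noteq> 0"
    using inner_e_simps(9) by force
  have "stabilizer_group S K \<cong> (sym_group 3)\<lparr>carrier := carrier (sym_group 3)\<rparr>"
  \<comment> \<open>The sum of the cubes of the \<open>w i \<bullet> X\<close> is 3/4 of
    \<open>x^3 - 3 * x * y^2\<close>, hence the factor \<open>4 * lam / 3\<close>; \<open>S\<close>
    is \<open>a\<close> times the identity plus \<open>b - a\<close> times the projection to the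
    normal.\<close>
  proof (rule generated_by_iso[OF group.subgroup_self[OF sym_group_is_group] _ stab_S3_generated[OF K S \<open>lam > 0\<close>], of "4 * lam / 3" a "b - a"])
    show "K X Y = (4 * lam / 3) *\<^sub>R (\<Sum>i=1..3. ((w i \<bullet> X) * (w i \<bullet> Y)) *\<^sub>R w i)" for X Y
    proof -
      obtain x y z where "X = comb e x y z" by (rule comb_exhaust)
      moreover obtain x' y' z' where "Y = comb e x' y' z'" by (rule comb_exhaust)
      ultimately show ?thesis
        using K unfolding three by (simp add: w form_S3_def field_simps)
    qed
    show "S X = a *\<^sub>R X + (b - a) *\<^sub>R ((e 3 \<bullet> X) *\<^sub>R e 3)" for X
    proof -
      obtain x y z where "X = comb e x y z" by (rule comb_exhaust)
      then show ?thesis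
        using S by (simp add: block_form_def comb_unit(3)[of e] algebra_simps del: comb_eq_e)
    qed
    let ?t = "Transposition.transpose :: nat \<Rightarrow> nat \<Rightarrow> nat \<Rightarrow> nat"
    have "rot_P \<omega> e 1 = L (?t 2 3)"
    proof (rule L_eqI[OF SO_linear[OF rot_SO(1)]])
      show "rot_P \<omega> e 1 (w m) = w (?t 2 3 m)" if "m \<in> {1..3}" for m
        using that unfolding three by (elim insertE emptyE) (simp_all add: w rot_P1 transpose_def)
      show "rot_P \<omega> e 1 (e 3) = real_of_int (sign (?t 2 3)) *\<^sub>R e 3"
        by (simp add: comb_unit(3)[of e] rot_P1 sign_swap_id del: comb_eq_e)
    qed
    moreover have "?t 2 3 \<in> carrier (sym_group 3)"
      by (simp add: sym_group_carrier permutes_swap_id)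
    moreover have "rot_R \<omega> e 3 \<in> L ` carrier (sym_group 3)"
    proof -
      \<comment> \<open>The rotation is a 3-cycle of the vertices, whose direction depends on the
        orientation of \<open>e\<close>.\<close>
      define p where "p = (if \<sigma> = 1 then ?t 1 2 \<circ> ?t 2 3 else ?t 2 3 \<circ> ?t 1 2)"
      have "p \<in> carrier (sym_group 3)"
        by (auto simp: p_def sym_group_carrier intro!: permutes_compose permutes_swap_id)
      moreover have "rot_R \<omega> e 3 = L p"
      proof (rule L_eqI[OF SO_linear[OF rot_SO(4)]])
        show "rot_R \<omega> e 3 (w m) = w (p m)" if "m \<in> {1..3}" for m
          using that orientation_cases unfolding three p_def by (elim insertE emptyE disjE) (simp_all add: w rot_R3 transpose_def)
        show "rot_R \<omega> e 3 (e 3) = real_of_int (sign p) *\<^sub>R e 3"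
          by (simp add: p_def comb_unit(3)[of e] rot_R3 sign_swap_id sign_compose permutation_swap_id del: comb_eq_e)
      qed
      ultimately show ?thesis by blast
    qed
    ultimately show "{rot_P \<omega> e 1, rot_R \<omega> e 3} \<subseteq> L ` carrier (sym_group 3)"
      by auto
  qed (use \<open>e 3 \<noteq> 0\<close> in auto)
  then show ?thesis
    by simp
qed

end

section \<open>Existence of a normal form\<close>

context frame begin

lemma rot_P_involution: "rot_P \<omega> e 1 \<circ> rot_P \<omega> e 1 = id" "rot_P \<omega> e 2 \<circ> rot_P \<omega> e 2 = id"
  "rot_P \<omega> e 2 \<circ> rot_P \<omega> e 1 = rot_P \<omega> e 1 \<circ> rot_P \<omega> e 2"
proof -
  have "rot_P \<omega> e 1 (rot_P \<omega> e 1 X) = X" "rot_P \<omega> e 2 (rot_P \<omega> e 2 X) = X"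
    "rot_P \<omega> e 2 (rot_P \<omega> e 1 X) = rot_P \<omega> e 1 (rot_P \<omega> e 2 X)" for X
  proof -
    obtain x y z where "X = comb e x y z" by (rule comb_exhaust)
    then show "rot_P \<omega> e 1 (rot_P \<omega> e 1 X) = X" "rot_P \<omega> e 2 (rot_P \<omega> e 2 X) = X"
      "rot_P \<omega> e 2 (rot_P \<omega> e 1 X) = rot_P \<omega> e 1 (rot_P \<omega> e 2 X)"
      by (simp_all add: rot_P1 rot_P2)
  qed
  then show "rot_P \<omega> e 1 \<circ> rot_P \<omega> e 1 = id" "rot_P \<omega> e 2 \<circ> rot_P \<omega> e 2 = id"
    "rot_P \<omega> e 2 \<circ> rot_P \<omega> e 1 = rot_P \<omega> e 1 \<circ> rot_P \<omega> e 2"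
    by (simp_all add: fun_eq_iff)
qed

lemma rot_P_distinct: "rot_P \<omega> e 1 \<noteq> id" "rot_P \<omega> e 2 \<noteq> id" "rot_P \<omega> e 1 \<noteq> rot_P \<omega> e 2"
proof -
  \<comment> \<open>A vector without zero coordinates separates all sign patterns.\<close>
  have "rot_P \<omega> e 1 (comb e 1 1 1) \<noteq> comb e 1 1 1" "rot_P \<omega> e 2 (comb e 1 1 1) \<noteq> comb e 1 1 1"
    "rot_P \<omega> e 1 (comb e 1 1 1) \<noteq> rot_P \<omega> e 2 (comb e 1 1 1)"
    by (simp_all add: rot_P1 rot_P2)
  then show "rot_P \<omega> e 1 \<noteq> id" "rot_P \<omega> e 2 \<noteq> id" "rot_P \<omega> e 1 \<noteq> rot_P \<omega> e 2"
    by fastforce+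
qed

lemma Z2_iso: "generated_by {rot_P \<omega> e 1} \<cong> model_Z2"
proof (rule generated_by_cyclic[OF rot_SO(1)])
  show "rot_P \<omega> e 1 ^^ 2 = id"
    using rot_P_involution(1) by (simp only: numeral_2_eq_2 funpow.simps comp_id)
  have "{..<2} = {0, 1 :: nat}"
    by auto
  then show "inj_on (\<lambda>k. rot_P \<omega> e 1 ^^ k) {..<2}"
    using rot_P_distinct(1) by (simp add: inj_on_def)
qed simp

lemma Z2_Z2_iso: "generated_by {rot_P \<omega> e 1, rot_P \<omega> e 2} \<cong> model_Z2_Z2"
  by (rule generated_by_two_involutions[OF rot_SO(1,2) rot_P_involution rot_P_distinct])

lemma Z3_iso: "generated_by {rot_R \<omega> e 1} \<cong> model_Z3"
proof (rule generated_by_cyclic[OF rot_SO(3)])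
  let ?R = "rot_R \<omega> e 1"
  have R: "?R (comb e x 1 0) = comb e x (- 1 / 2) (\<sigma> * (sqrt 3 / 2))"
    "?R (comb e x (- 1 / 2) (\<sigma> * (sqrt 3 / 2))) = comb e x (- 1 / 2) (- \<sigma> * (sqrt 3 / 2))" for x
    using orientation_cases by (auto simp: rot_R1)
  have "?R (?R (?R X)) = X" for X
  proof -
    obtain x y z where "X = comb e x y z" by (rule comb_exhaust)
    then show ?thesis
      using orientation_cases by (auto simp: rot_R1 field_simps)
  qed
  then have "?R \<circ> (?R \<circ> ?R) = id"
    by (simp add: fun_eq_iff)
  then show "?R ^^ 3 = id"
    by (simp only: numeral_3_eq_3 funpow.simps comp_id)
  have "id (comb e 0 1 0) \<noteq> ?R (comb e 0 1 0)" "id (comb e 0 1 0) \<noteq> (?R \<circ> ?R) (comb e 0 1 0)"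
    "?R (comb e 0 1 0) \<noteq> (?R \<circ> ?R) (comb e 0 1 0)"
    unfolding comp_apply R id_apply using orientation_cases by auto
  then have "id \<noteq> ?R" "id \<noteq> ?R \<circ> ?R" "?R \<noteq> ?R \<circ> ?R"
    by metis+
  moreover have "?R ^^ 0 = id" "?R ^^ 1 = ?R" "?R ^^ 2 = ?R \<circ> ?R"
    by (simp_all only: numeral_2_eq_2 One_nat_def funpow.simps comp_id)
  moreover have "{..<3} = {0, 1, 2 :: nat}"
    by auto
  ultimately show "inj_on (\<lambda>k. ?R ^^ k) {..<3}"
    unfolding inj_on_def by (metis insertE emptyE)
qed simp

end

text \<open>Basis independence of the trace: each summand over \<open>Basis\<close> is expanded in
  \<open>e\<close>, and for a fixed \<open>e i\<close> the sum over \<open>Basis\<close> collapses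
  again.\<close>

lemma (in onb) endo_trace_eq:
  assumes "linear f"
  shows "endo_trace f = f (e 1) \<bullet> e 1 + f (e 2) \<bullet> e 2 + f (e 3) \<bullet> e 3"
proof -
  have expand: "X \<bullet> Y = (e 1 \<bullet> X) * (e 1 \<bullet> Y) + (e 2 \<bullet> X) * (e 2 \<bullet> Y) + (e 3 \<bullet> X) * (e 3 \<bullet> Y)" for X Y
    by (subst comb_expand[of X], subst comb_expand[of Y]) simp
  have *: "(\<Sum>b\<in>Basis. (e i \<bullet> f b) * (e i \<bullet> b)) = f (e i) \<bullet> e i" for i
  proof -
    have "f (e i) = f (\<Sum>b\<in>Basis. (e i \<bullet> b) *\<^sub>R b)"
      by (simp add: euclidean_representation)
    also have "\<dots> = (\<Sum>b\<in>Basis. (e i \<bullet> b) *\<^sub>R f b)"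
      by (simp add: linear_sum[OF assms] linear_cmul[OF assms])
    finally have "f (e i) \<bullet> e i = (\<Sum>b\<in>Basis. (e i \<bullet> b) *\<^sub>R f b) \<bullet> e i"
      by (rule arg_cong)
    also have "\<dots> = (\<Sum>b\<in>Basis. (e i \<bullet> b) * (f b \<bullet> e i))"
      by (simp add: inner_sum_left)
    finally show ?thesis
      by (simp add: inner_commute[of _ "e i"] mult.commute)
  qed
  have "endo_trace f = (\<Sum>b\<in>Basis. (e 1 \<bullet> f b) * (e 1 \<bullet> b) + (e 2 \<bullet> f b) * (e 2 \<bullet> b) + (e 3 \<bullet> f b) * (e 3 \<bullet> b))"
    unfolding endo_trace_def by (intro sum.cong refl expand)
  then show ?thesis
    by (simp add: sum.distrib *)
qed

text \<open>In coordinates the vector is a unit vector of \<open>real^3\<close>, to which some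
  orthogonal map takes the first axis; the images of all axes form the basis.\<close>

lemma onb_first:
  fixes u :: "'a::euclidean_space"
  assumes "DIM('a) = 3" "norm u = 1"
  obtains e where "onb e" "e 1 = u"
proof -
  obtain b :: "3 \<Rightarrow> 'a" where "onb b"
    using ex_onb[OF assms(1)] by metis
  interpret b: onb b by fact
  define x :: "real^3" where "x = (\<chi> i. b i \<bullet> u)"
  have u: "u = comb b (x$1) (x$2) (x$3)"
    unfolding x_def vec_lambda_beta by (rule b.comb_expand)
  have "u \<bullet> u = x \<bullet> x"
    by (subst u, subst u) (simp add: inner_vec_def sum_3)
  then have "norm (axis 1 1 :: real^3) = norm x"
    using assms(2) by (simp add: norm_eq_sqrt_inner)
  then obtain f :: "real^3 \<Rightarrow> real^3" where f: "orthogonal_transformation f" "f (axis 1 1) = x"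
    by (rule orthogonal_transformation_exists)
  define e where "e i = comb b (f (axis i 1) $ 1) (f (axis i 1) $ 2) (f (axis i 1) $ 3)" for i
  have "orthonormal_basis e"
  proof (rule orthonormal_basisI[OF assms(1)])
    fix i j
    have "e i \<bullet> e j = f (axis i 1) \<bullet> f (axis j 1)"
      by (simp add: e_def inner_vec_def sum_3)
    then show "e i \<bullet> e j = (if i = j then 1 else 0)"
      using f(1) by (simp add: orthogonal_transformation_def inner_axis_axis)
  qed
  then show ?thesis
    using that[of e] f(2) u by (simp add: onb_def e_def)
qed

text \<open>Euler's theorem: 1 is a root of the characteristic polynomial, and a kernel vector of g
  - id is normalized.\<close>

lemma rotation_axis:
  fixes g :: "'a::euclidean_space \<Rightarrow> 'a"
  assumes "DIM('a) = 3" "g \<in> SO"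
  obtains u where "norm u = 1" "g u = u"
proof -
  obtain e :: "3 \<Rightarrow> 'a" where "onb e"
    using ex_onb[OF assms(1)] by metis
  interpret onb e by fact
  obtain a1 a2 a3 b1 b2 b3 where g: "linear g" "g (e 1) = comb e a1 a2 a3" "g (e 2) = comb e b1 b2 b3"
    "g (e 3) = comb e (a2*b3-a3*b2) (a3*b1-a1*b3) (a1*b2-a2*b1)"
    "a1^2 + a2^2 + a3^2 = 1" "b1^2 + b2^2 + b3^2 = 1" "a1*b1 + a2*b2 + a3*b3 = 0"
    using SO_E[OF assms(2)] .
  define M where "M = matrix_wrt e g - mat 1"
  \<comment> \<open>The determinant minus the principal 2 by 2 minors plus the trace minus 1,
    arranged so that the three relations of \<open>SO_E\<close> give the determinant 1 and make the
    minors add up to the trace.\<close>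
  have "det M = ((a1^2 + a2^2 + a3^2) * (b1^2 + b2^2 + b3^2) - (a1*b1 + a2*b2 + a3*b3)^2)
    - ((a1*b2 - a2*b1) + (b2 * (a1^2 + a2^2 + a3^2) - a2 * (a1*b1 + a2*b2 + a3*b3)) +
      (a1 * (b1^2 + b2^2 + b3^2) - b1 * (a1*b1 + a2*b2 + a3*b3))) + (a1 + b2 + (a1*b2 - a2*b1)) - 1"
    by (simp add: M_def det_3 matrix_wrt_def mat_def g(2-4)) algebra
  then have "det M = 0"
    by (simp add: g(5-7))
  then obtain x where x: "M *v x = 0" "x \<noteq> 0"
    using invertible_det_nz[of M] matrix_left_invertible_ker[of M] invertible_left_inverse[of M] by metis
  define v where "v = comb e (x$1) (x$2) (x$3)"
  have "g v = v"
    using x(1) unfolding v_def comb_linear[OF g(1)] g(2-4)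
    by (simp add: M_def matrix_wrt_def matrix_vector_mult_def vec_eq_iff sum_3 forall_3 mat_def g(2-4) algebra_simps)
  moreover have "v \<noteq> 0"
    using x(2) by (simp add: v_def vec_eq_iff forall_3)
  ultimately have "norm (v /\<^sub>R norm v) = 1" "g (v /\<^sub>R norm v) = v /\<^sub>R norm v"
    by (simp_all add: linear_cmul[OF g(1)])
  then show ?thesis
    using that by blast
qed

section \<open>Complex square and cube roots in real terms\<close>

lemma polar_coordinates:
  fixes x y :: real
  obtains r t where "r \<ge> 0" "x = r * cos t" "y = r * sin t"
proof (cases "x = 0 \<and> y = 0")
  case True
  then show ?thesis
    using that[of 0 0] by simp
next
  case False
  define r where "r = sqrt (x^2 + y^2)"
  have r: "r > 0" "r^2 = x^2 + y^2"
    using False by (simp_all add: r_def sum_power2_gt_zero_iff)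
  then have "(x / r)^2 + (y / r)^2 = 1"
    using False by (simp add: power_divide sum_power2_eq_zero_iff flip: add_divide_distrib)
  then obtain t where "x / r = cos t" "y / r = sin t"
    using sincos_total_2pi by blast
  then show ?thesis
    using r(1) by (intro that[of r t]) (simp_all add: field_simps)
qed

text \<open>A unit complex number C + i S whose square times \<open>mu\<close> is m + i t. Turning
  by its angle normalizes a term of weight 2.\<close>

lemma angle_halving:
  fixes m t :: real
  obtains C S mu where "mu \<ge> 0" "C^2 + S^2 = 1" "m = mu * (C^2 - S^2)" "t = mu * (2 * C * S)"
proof -
  obtain r a where ra: "r \<ge> 0" "m = r * cos a" "t = r * sin a"
    by (rule polar_coordinates)
  have "cos a = (cos (a/2))^2 - (sin (a/2))^2" "sin a = 2 * cos (a/2) * sin (a/2)"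
    using cos_double[of "a/2"] sin_double[of "a/2"] by simp_all
  then show ?thesis
    using ra by (intro that[of r "cos (a/2)" "sin (a/2)"]) simp_all
qed

text \<open>A unit complex number C + i S whose cube times \<open>mu\<close> is k + i l. Turning by
  its angle normalizes a term of weight 3.\<close>

lemma angle_trisection:
  fixes k l :: real
  obtains C S mu where "mu \<ge> 0" "C^2 + S^2 = 1" "k = mu * (C^3 - 3 * C * S^2)" "l = mu * (3 * C^2 * S - S^3)"
proof -
  obtain r a where ra: "r \<ge> 0" "k = r * cos a" "l = r * sin a"
    by (rule polar_coordinates)
  have "a = a/3 + (a/3 + a/3)"
    by simp
  then have "cos a = cos (a/3 + (a/3 + a/3))" "sin a = sin (a/3 + (a/3 + a/3))"
    by (rule arg_cong)+
  then have "cos a = (cos (a/3))^3 - 3 * cos (a/3) * (sin (a/3))^2" "sin a = 3 * (cos (a/3))^2 * sin (a/3) - (sin (a/3))^3"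
    unfolding cos_add sin_add by algebra+
  then show ?thesis
    using ra by (intro that[of r "cos (a/3)" "sin (a/3)"]) simp_all
qed

lemma comb_triple [simp]:
  "comb (triple (comb e a1 a2 a3) (comb e b1 b2 b3) (comb e c1 c2 c3)) x y z =
    comb e (x*a1 + y*b1 + z*c1) (x*a2 + y*b2 + z*c2) (x*a3 + y*b3 + z*c3)"
  by (simp add: comb_def[of "triple _ _ _"])

context onb begin

text \<open>A symmetric trilinear form in three variables has ten coefficients, and the vanishing
  traces remove three: seven parameters remain. About \<open>e 1\<close>, \<open>p\<close> has
  weight 0, \<open>q\<close> and \<open>r\<close> weight 1, \<open>t + p / 2\<close> and
  \<open>m\<close> weight 2; \<open>k\<close> and \<open>l\<close> have weight 3 once
  \<open>q = r = 0\<close>.\<close>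

lemma tensor_coordinates:
  assumes K: "bilinear K" "totally_symmetric K" and tr: "\<And>X. endo_trace (K X) = 0"
  obtains p q r t m k l where
    "K (e 1) (e 1) = comb e p q r" "K (e 1) (e 2) = comb e q t m" "K (e 1) (e 3) = comb e r m (- p - t)"
    "K (e 2) (e 1) = comb e q t m" "K (e 2) (e 2) = comb e t k l" "K (e 2) (e 3) = comb e m l (- q - k)"
    "K (e 3) (e 1) = comb e r m (- p - t)" "K (e 3) (e 2) = comb e m l (- q - k)"
    "K (e 3) (e 3) = comb e (- p - t) (- q - k) (- r - l)"
proof -
  have sym: "K X Y \<bullet> Z = K Y X \<bullet> Z" "K X Y \<bullet> Z = K X Z \<bullet> Y" for X Y Z
    using K(2) by (auto simp: totally_symmetric_def)
  have comm: "K X Y = K Y X" for X Y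
    using sym(1)[of X Y] vector_eq_rdot[of "K X Y" "K Y X"] by simp
  have lin: "linear (K X)" for X
    using K(1) by (simp add: bilinear_def)
  obtain p q r where 11: "K (e 1) (e 1) = comb e p q r" by (rule comb_exhaust)
  obtain q' t m where 12: "K (e 1) (e 2) = comb e q' t m" by (rule comb_exhaust)
  obtain r' m' o' where 13: "K (e 1) (e 3) = comb e r' m' o'" by (rule comb_exhaust)
  obtain t' k l where 22: "K (e 2) (e 2) = comb e t' k l" by (rule comb_exhaust)
  obtain m'' l' n' where 23: "K (e 2) (e 3) = comb e m'' l' n'" by (rule comb_exhaust)
  obtain o'' n'' i' where 33: "K (e 3) (e 3) = comb e o'' n'' i'" by (rule comb_exhaust)
  have "q' = q" "r' = r" "m' = m"
    using sym(2)[of "e 1" "e 1" "e 2"] sym(2)[of "e 1" "e 1" "e 3"] sym(2)[of "e 1" "e 2" "e 3"]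
    by (simp_all add: 11 12 13)
  moreover have "t' = t" "l' = l" "m'' = m"
    using sym(2)[of "e 2" "e 1" "e 2"] sym(2)[of "e 2" "e 2" "e 3"] sym(2)[of "e 2" "e 1" "e 3"]
    by (simp_all add: comm[of "e 2" "e 1"] 12 22 23)
  moreover have "o'' = o'" "n'' = n'"
    using sym(2)[of "e 3" "e 1" "e 3"] sym(2)[of "e 3" "e 2" "e 3"]
    by (simp_all add: comm[of "e 3" "e 1"] comm[of "e 3" "e 2"] 13 23 33)
  moreover have "p + t + o' = 0" "q' + k + n' = 0" "r' + l' + i' = 0"
    using tr[of "e 1"] tr[of "e 2"] tr[of "e 3"]
    by (simp_all add: endo_trace_eq[OF lin] comm[of "e 2" "e 1"] comm[of "e 3" "e 1"] comm[of "e 3" "e 2"] 11 12 13 22 23 33)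
  then have "o' = - p - t" "n' = - q' - k" "i' = - r' - l'"
    by linarith+
  ultimately show ?thesis
    using that[of p q r t m k l]
    by (simp add: comm[of "e 2" "e 1"] comm[of "e 3" "e 1"] comm[of "e 3" "e 2"] 11 12 13 22 23 33)
qed

lemma symmetric_block_form:
  assumes S: "linear S" "\<And>X Y. S X \<bullet> Y = X \<bullet> S Y" and "S (e 1) = a *\<^sub>R e 1"
  obtains b c d where "block_form e S a b c d"
proof -
  obtain \<alpha> b d where 2: "S (e 2) = comb e \<alpha> b d" by (rule comb_exhaust)
  obtain \<beta> d' c where 3: "S (e 3) = comb e \<beta> d' c" by (rule comb_exhaust)
  have "\<alpha> = 0" "\<beta> = 0" "d' = d"
    using S(2)[of "e 1" "e 2"] S(2)[of "e 1" "e 3"] S(2)[of "e 2" "e 3"] by (simp_all add: 2 3 assms(3))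
  then have "block_form e S a b c d"
    using 2 3 by (simp add: block_form_def comb_linear[OF S(1)] assms(3))
      (simp add: comb_def algebra_simps)
  then show ?thesis by (rule that)
qed

text \<open>Turning \<open>e 2\<close> and \<open>e 3\<close> by a third of the argument of k + i l
  makes this coefficient real and nonnegative. \<open>S\<close> is scalar on the plane and keeps its
  form.\<close>

lemma form_Z3_exists:
  assumes K: "bilinear K" and S: "block_form e S a b b 0" 
    and val: "K (e 1) (e 1) = comb e (2 * lam) 0 0" "K (e 1) (e 2) = comb e 0 (- lam) 0" "K (e 1) (e 3) = comb e 0 0 (- lam)"
    "K (e 2) (e 1) = comb e 0 (- lam) 0" "K (e 2) (e 2) = comb e (- lam) k l" "K (e 2) (e 3) = comb e 0 l (- k)"
    "K (e 3) (e 1) = comb e 0 0 (- lam)" "K (e 3) (e 2) = comb e 0 l (- k)" "K (e 3) (e 3) = comb e (- lam) (- k) (- l)"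
  obtains f mu where "onb f" "mu \<ge> 0" "form_Z3 f K lam mu" "block_form f S a b b 0"
proof -
  obtain C s mu where mu: "mu \<ge> 0" and cs: "C^2 + s^2 = 1" and kl: "k = mu * (C^3 - 3 * C * s^2)" "l = mu * (3 * C^2 * s - s^3)"
    by (rule angle_trisection)
  define f where "f = triple (comb e 1 0 0) (comb e 0 C s) (comb e 0 (- s) C)"
  have "onb f"
    unfolding f_def using cs by (intro onb_triple) (simp_all add: power2_eq_square)
  have K_e: "K (comb e x y z) (comb e x' y' z') = comb e (lam * (2 * x * x' - y * y' - z * z'))
     (k * (y * y' - z * z') + l * (y * z' + z * y') - lam * (x * y' + y * x')) (l * (y * y' - z * z') - k * (y * z' + z * y') - lam * (x * z' + z * x'))" for x y z x' y' z'
    by (simp add: comb_bilinear[OF K] val) (simp add: algebra_simps)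
  \<comment> \<open>For z = C + i s, where k + i l = mu z^3, these are the real and imaginary parts
    of (k + i l) conj(z)^2 = mu z.\<close>
  have kl2: "k * (C^2 - s^2) + l * (2 * C * s) = mu * C" "l * (C^2 - s^2) - k * (2 * C * s) = mu * s"
  proof -
    have "k * (C^2 - s^2) + l * (2 * C * s) = mu * C * (C^2 + s^2)^2" "l * (C^2 - s^2) - k * (2 * C * s) = mu * s * (C^2 + s^2)^2"
      unfolding kl by algebra+
    then show "k * (C^2 - s^2) + l * (2 * C * s) = mu * C" "l * (C^2 - s^2) - k * (2 * C * s) = mu * s"
      by (simp_all add: cs)
  qed
  have "form_Z3 f K lam mu"
    unfolding form_Z3_def
  proof (intro allI)
    fix x y z x' y' z' :: real
    let ?Y = "C * y - s * z" and ?Z = "s * y + C * z" and ?Y' = "C * y' - s * z'" and ?Z' = "s * y' + C * z'"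
    have f_comb: "comb f x y z = comb e x (C * y - s * z) (s * y + C * z)" for x y z
      by (simp add: f_def mult.commute)
    have 1: "lam * (2 * x * x' - ?Y * ?Y' - ?Z * ?Z') = lam * (2 * x * x' - y * y' - z * z')"
    proof -
      have "lam * (2 * x * x' - ?Y * ?Y' - ?Z * ?Z') = lam * (2 * x * x' - (C^2 + s^2) * (y * y' + z * z'))"
        by algebra
      then show ?thesis
        by (simp add: cs algebra_simps)
    qed
    have "k * (?Y * ?Y' - ?Z * ?Z') + l * (?Y * ?Z' + ?Z * ?Y') - lam * (x * ?Y' + ?Y * x') =
      (y * y' - z * z') * (k * (C^2 - s^2) + l * (2 * C * s)) + (y * z' + z * y') * (l * (C^2 - s^2) - k * (2 * C * s)) -
      lam * (x * ?Y' + ?Y * x')"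
      by algebra
    also have "\<dots> = C * (mu * (y * y' - z * z') - lam * (x * y' + y * x')) - s * (- lam * (x * z' + z * x') - mu * (y * z' + z * y'))"
      unfolding kl2 by algebra
    finally have 2: "k * (?Y * ?Y' - ?Z * ?Z') + l * (?Y * ?Z' + ?Z * ?Y') - lam * (x * ?Y' + ?Y * x') = \<dots>" .
    have "l * (?Y * ?Y' - ?Z * ?Z') - k * (?Y * ?Z' + ?Z * ?Y') - lam * (x * ?Z' + ?Z * x') =
      (y * y' - z * z') * (l * (C^2 - s^2) - k * (2 * C * s)) - (y * z' + z * y') * (k * (C^2 - s^2) + l * (2 * C * s)) -
      lam * (x * ?Z' + ?Z * x')"
      by algebra
    also have "\<dots> = s * (mu * (y * y' - z * z') - lam * (x * y' + y * x')) + C * (- lam * (x * z' + z * x') - mu * (y * z' + z * y'))"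
      unfolding kl2 by algebra
    finally have 3: "l * (?Y * ?Y' - ?Z * ?Z') - k * (?Y * ?Z' + ?Z * ?Y') - lam * (x * ?Z' + ?Z * x') = \<dots>" .
    show "K (comb f x y z) (comb f x' y' z') =
      comb f (lam * (2 * x * x' - y * y' - z * z')) (mu * (y * y' - z * z') - lam * (x * y' + y * x')) (- lam * (x * z' + z * x') - mu * (y * z' + z * y'))"
      unfolding f_comb K_e comb_eq_iff using 1 2 3 by blast
  qed
  moreover have "block_form f S a b b 0"
    using S by (simp add: block_form_def f_def algebra_simps)
  ultimately show ?thesis
    using that \<open>onb f\<close> mu by blast
qed

text \<open>On the plane of \<open>e 2\<close> and \<open>e 3\<close>, \<open>K (e 1)\<close> is
  \<open>- lam\<close> times the identity plus a trace-free symmetric part. A rotation makes that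
  part purely off-diagonal, with entry \<open>mu \<ge> 0\<close>.\<close>

lemma form_Z2_exists:
  assumes K: "bilinear K"
    and val: "K (e 1) (e 1) = comb e (2 * lam) 0 0" "K (e 1) (e 2) = comb e 0 t m" "K (e 1) (e 3) = comb e 0 m (- 2 * lam - t)"
    "K (e 2) (e 1) = comb e 0 t m" "K (e 2) (e 2) = comb e t 0 0" "K (e 2) (e 3) = comb e m 0 0"
    "K (e 3) (e 1) = comb e 0 m (- 2 * lam - t)" "K (e 3) (e 2) = comb e m 0 0" "K (e 3) (e 3) = comb e (- 2 * lam - t) 0 0"
  obtains f mu where "onb f" "f 1 = e 1" "mu \<ge> 0" "form_Z2 f K lam mu"
proof -
  \<comment> \<open>The diagonal entry of the trace-free part. The angle is half the argument of m -
    i \<tau>, since \<tau> is to vanish and \<open>m\<close> to become \<open>mu\<close>.\<close>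
  define \<tau> where "\<tau> = t + lam"
  obtain C s mu where mu: "mu \<ge> 0" and cs: "C^2 + s^2 = 1" and mt: "m = mu * (C^2 - s^2)" "- \<tau> = mu * (2 * C * s)"
    by (rule angle_halving)
  have \<tau>: "\<tau> = - mu * (2 * C * s)"
    using mt(2) by simp
  define f where "f = triple (comb e 1 0 0) (comb e 0 C s) (comb e 0 (- s) C)"
  have "onb f"
    unfolding f_def using cs by (intro onb_triple) (simp_all add: power2_eq_square)
  have K_e: "K (comb e x y z) (comb e x' y' z') =
    comb e (lam * (2 * x * x' - y * y' - z * z') + \<tau> * (y * y' - z * z') + m * (y * z' + z * y'))
     (\<tau> * (x * y' + y * x') + m * (x * z' + z * x') - lam * (x * y' + y * x'))
     (m * (x * y' + y * x') - \<tau> * (x * z' + z * x') - lam * (x * z' + z * x'))" for x y z x' y' z'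
    by (simp add: comb_bilinear[OF K] val) (simp add: \<tau>_def algebra_simps)
  \<comment> \<open>For z = C + i s, where m - i \<tau> = mu z^2, the first two say (m - i \<tau>)
    conj(z)^2 = mu and the last two (m - i \<tau>) conj(z) = mu z.\<close>
  have mt2: "\<tau> * (C^2 - s^2) + m * (2 * C * s) = 0" "m * (C^2 - s^2) - \<tau> * (2 * C * s) = mu"
    "\<tau> * C + m * s = - mu * s" "m * C - \<tau> * s = mu * C"
  proof -
    have "\<tau> * (C^2 - s^2) + m * (2 * C * s) = 0" "m * (C^2 - s^2) - \<tau> * (2 * C * s) = mu * (C^2 + s^2)^2"
      "\<tau> * C + m * s = - mu * s * (C^2 + s^2)" "m * C - \<tau> * s = mu * C * (C^2 + s^2)"
      unfolding mt(1) \<tau> by algebra+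
    then show "\<tau> * (C^2 - s^2) + m * (2 * C * s) = 0" "m * (C^2 - s^2) - \<tau> * (2 * C * s) = mu"
      "\<tau> * C + m * s = - mu * s" "m * C - \<tau> * s = mu * C"
      by (simp_all add: cs)
  qed
  have "form_Z2 f K lam mu"
    unfolding form_Z2_def
  proof (intro allI)
    fix x y z x' y' z' :: real
    let ?Y = "C * y - s * z" and ?Z = "s * y + C * z" and ?Y' = "C * y' - s * z'" and ?Z' = "s * y' + C * z'"
    have f_comb: "comb f x y z = comb e x (C * y - s * z) (s * y + C * z)" for x y z
      by (simp add: f_def mult.commute)
    have "lam * (2 * x * x' - ?Y * ?Y' - ?Z * ?Z') + \<tau> * (?Y * ?Y' - ?Z * ?Z') + m * (?Y * ?Z' + ?Z * ?Y') =
       lam * (2 * x * x' - (C^2 + s^2) * (y * y' + z * z')) + (y * y' - z * z') * (\<tau> * (C^2 - s^2) + m * (2 * C * s)) +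
        (y * z' + z * y') * (m * (C^2 - s^2) - \<tau> * (2 * C * s))"
      by algebra
    also have "\<dots> = lam * (2 * x * x' - y * y' - z * z') + mu * (y * z' + z * y')"
      unfolding mt2 cs by algebra
    finally have 1: "lam * (2 * x * x' - ?Y * ?Y' - ?Z * ?Z') + \<tau> * (?Y * ?Y' - ?Z * ?Z') + m * (?Y * ?Z' + ?Z * ?Y') = \<dots>" .
    have "\<tau> * (x * ?Y' + ?Y * x') + m * (x * ?Z' + ?Z * x') - lam * (x * ?Y' + ?Y * x') =
      (x * y' + y * x') * (\<tau> * C + m * s) + (x * z' + z * x') * (m * C - \<tau> * s) - lam * (x * ?Y' + ?Y * x')"
      by algebra
    also have "\<dots> = C * (mu * (x * z' + z * x') - lam * (x * y' + y * x')) - s * (mu * (x * y' + y * x') - lam * (x * z' + z * x'))"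
      unfolding mt2 by algebra
    finally have 2: "\<tau> * (x * ?Y' + ?Y * x') + m * (x * ?Z' + ?Z * x') - lam * (x * ?Y' + ?Y * x') = \<dots>" .
    have "m * (x * ?Y' + ?Y * x') - \<tau> * (x * ?Z' + ?Z * x') - lam * (x * ?Z' + ?Z * x') =
      (x * y' + y * x') * (m * C - \<tau> * s) - (x * z' + z * x') * (\<tau> * C + m * s) - lam * (x * ?Z' + ?Z * x')"
      by algebra
    also have "\<dots> = s * (mu * (x * z' + z * x') - lam * (x * y' + y * x')) + C * (mu * (x * y' + y * x') - lam * (x * z' + z * x'))"
      unfolding mt2 by algebra
    finally have 3: "m * (x * ?Y' + ?Y * x') - \<tau> * (x * ?Z' + ?Z * x') - lam * (x * ?Z' + ?Z * x') = \<dots>" .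
    show "K (comb f x y z) (comb f x' y' z') =
      comb f (lam * (2*x*x' - y*y' - z*z') + mu * (y*z' + z*y')) (mu * (x*z' + z*x') - lam * (x*y' + y*x')) (mu * (x*y' + y*x') - lam * (x*z' + z*x'))"
      unfolding f_comb K_e comb_eq_iff using 1 2 3 by blast
  qed
  moreover have "f 1 = e 1"
    by (simp add: f_def)
  ultimately show ?thesis
    using that \<open>onb f\<close> mu by blast
qed

end

section \<open>Reduction of the degenerate parameter values to the other normal forms\<close>

definition normal_form :: "('a::euclidean_space \<Rightarrow> 'a) \<Rightarrow> ('a \<Rightarrow> 'a \<Rightarrow> 'a) \<Rightarrow> (3 \<Rightarrow> 'a) \<Rightarrow> bool" where
  "normal_form S K e \<longleftrightarrow> type_SO3 S K e \<or> type_Z2_SO2 S K e \<or> type_SO2 S K e \<or> type_A4 S K e \<or>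
     type_S3 S K e \<or> type_Z2_Z2 S K e \<or> type_Z3 S K e \<or> type_Z2 S K e"

context onb begin

lemma form_0_iff: "form_Z3 e K 0 0 \<longleftrightarrow> K = (\<lambda>X Y. 0)" "form_Z2 e K 0 0 \<longleftrightarrow> K = (\<lambda>X Y. 0)"
proof -
  have *: "(\<forall>x y z x' y' z'. K (comb e x y z) (comb e x' y' z') = 0) \<longleftrightarrow> K = (\<lambda>X Y. 0)"
    unfolding fun_eq_iff by (metis comb_expand)
  then show "form_Z3 e K 0 0 \<longleftrightarrow> K = (\<lambda>X Y. 0)" "form_Z2 e K 0 0 \<longleftrightarrow> K = (\<lambda>X Y. 0)"
    by (simp_all add: form_Z3_def form_Z2_def)
qed

text \<open>Only coincidences among the eigenvalues matter. If exactly two agree, a cyclic change of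
  basis puts the simple eigenvalue first.\<close>

lemma normal_form_K_0:
  assumes S: "linear S" and K: "bilinear K" "K = (\<lambda>X Y. 0)" and diag: "block_form e S a b c 0"
  obtains f where "onb f" "normal_form S K f"
proof -
  consider "a = b" "b = c" | "a \<noteq> b" "b = c" | "a = b" "b \<noteq> c" | "a = c" "b \<noteq> c" | "a \<noteq> b" "b \<noteq> c" "a \<noteq> c"
    by blast
  then show thesis
  proof cases
    case 1
    then have "S = (\<lambda>X. a *\<^sub>R X)"
      using diag block_form_scalar by blast
    then have "type_SO3 S K e"
      unfolding type_iff(1)[OF S K(1)] using K(2) by blast
    then show ?thesis
      using that[OF onb_axioms] by (simp add: normal_form_def)
  next
    case 2
    then have "block_form e S a b b 0"
      using diag by simp
    then have "type_Z2_SO2 S K e"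
      unfolding type_iff(2)[OF S K(1)] using K(2) \<open>a \<noteq> b\<close> by blast
    then show ?thesis
      using that[OF onb_axioms] by (simp add: normal_form_def)
  next
    case 3
    let ?f = "triple (comb e 0 0 1) (comb e 1 0 0) (comb e 0 1 0)"
    interpret f: onb ?f
      by (rule onb_triple) simp_all
    have "block_form ?f S c a a 0"
      using diag 3 by (simp add: block_form_def)
    moreover have "c \<noteq> a"
      using 3 by simp
    ultimately have "type_Z2_SO2 S K ?f"
      unfolding f.type_iff(2)[OF S K(1)] using K(2) by blast
    then show ?thesis
      using that[OF f.onb_axioms] by (simp add: normal_form_def)
  next
    case 4
    let ?f = "triple (comb e 0 1 0) (comb e 0 0 1) (comb e 1 0 0)"
    interpret f: onb ?f
      by (rule onb_triple) simp_all
    have "block_form ?f S b a a 0"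
      using diag 4 by (simp add: block_form_def)
    moreover have "b \<noteq> a"
      using 4 by simp
    ultimately have "type_Z2_SO2 S K ?f"
      unfolding f.type_iff(2)[OF S K(1)] using K(2) by blast
    then show ?thesis
      using that[OF f.onb_axioms] by (simp add: normal_form_def)
  next
    case 5
    have "form_Z2 e K 0 0"
      using K(2) form_0_iff by simp
    then have "type_Z2_Z2 S K e"
      unfolding type_iff(6)[OF S K(1)] using diag 5 by blast
    then show ?thesis
      using that[OF onb_axioms] by (simp add: normal_form_def)
  qed
qed

text \<open>The trace-free part of the block is a weight 2 term: half the argument of (b - c) / 2 +
  i d is the angle to its principal axes.\<close>

lemma block_form_diagonal:
  assumes "block_form e S a b c d"
  obtains f b' c' where "onb f" "block_form f S a b' c' 0"
proof -
  define \<tau> where "\<tau> = (b - c) / 2"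
  obtain C s mu where cs: "C^2 + s^2 = 1" and m: "\<tau> = mu * (C^2 - s^2)" "d = mu * (2 * C * s)"
    by (rule angle_halving)
  define f where "f = triple (comb e 1 0 0) (comb e 0 C s) (comb e 0 (- s) C)"
  have "onb f"
    unfolding f_def using cs by (intro onb_triple) (simp_all add: power2_eq_square)
  define r where "r = (b + c) / 2"
  have bc: "b = r + \<tau>" "c = r - \<tau>"
    by (simp_all add: r_def \<tau>_def field_simps)
  have eig: "\<tau> * C + d * s = mu * C" "d * C - \<tau> * s = mu * s"
  proof -
    have "\<tau> * C + d * s = mu * C * (C^2 + s^2)" "d * C - \<tau> * s = mu * s * (C^2 + s^2)"
      unfolding m by algebra+
    then show "\<tau> * C + d * s = mu * C" "d * C - \<tau> * s = mu * s"
      by (simp_all add: cs)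
  qed
  have "block_form f S a (r + mu) (r - mu) 0"
    unfolding block_form_def
  proof (intro allI)
    fix x y z
    have "b * (C * y - s * z) + d * (s * y + C * z) =
       r * (C * y - s * z) + (\<tau> * C + d * s) * y + (d * C - \<tau> * s) * z"
      "d * (C * y - s * z) + c * (s * y + C * z) =
       r * (s * y + C * z) + (d * C - \<tau> * s) * y - (\<tau> * C + d * s) * z"
      unfolding bc by algebra+
    then show "S (comb f x y z) = comb f (a * x) ((r + mu) * y + 0 * z) (0 * y + (r - mu) * z)"
      using assms unfolding eig by (simp add: f_def block_form_def algebra_simps)
  qed
  then show ?thesis
    using that \<open>onb f\<close> by blast
qed

text \<open>The exceptional values: \<open>mu = 0\<close> is axial symmetry, \<open>lam = 0\<close>
  leaves the triangle form, and \<open>mu = sqrt 2 * lam\<close> with scalar \<open>S\<close> is the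
  tetrahedral form seen along a vertex.\<close>

lemma normal_form_of_form_Z3:
  assumes S: "linear S" and K: "bilinear K" and form: "form_Z3 e K lam mu" and block: "block_form e S a b b 0"
    and "lam \<ge> 0" "mu \<ge> 0"
  obtains f where "onb f" "normal_form S K f"
proof -
  consider "lam = 0" "mu = 0" | "lam > 0" "mu = 0" | "lam = 0" "mu > 0" |
    "lam > 0" "mu > 0" "mu \<noteq> sqrt 2 * lam \<or> a \<noteq> b" | "lam > 0" "mu = sqrt 2 * lam" "a = b"
    using \<open>lam \<ge> 0\<close> \<open>mu \<ge> 0\<close> by force
  then show thesis
  proof cases
    case 1
    then have "K = (\<lambda>X Y. 0)"
      using form form_0_iff by simp
    then show ?thesis
      by (intro normal_form_K_0[OF S K _ block that])
  next
    case 2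
    then have "type_SO2 S K e"
      unfolding type_iff(3)[OF S K] using form block by blast
    then show ?thesis
      using that[OF onb_axioms] by (simp add: normal_form_def)
  next
    case 3
    \<comment> \<open>The form \<open>mu * (y^3 - 3 * y * z^2)\<close> lives in the plane of
      \<open>e 2\<close> and \<open>e 3\<close>, so \<open>e 1\<close> becomes the normal, in third
      place.\<close>
    let ?f = "triple (comb e 0 1 0) (comb e 0 0 1) (comb e 1 0 0)"
    interpret f: onb ?f
      by (rule onb_triple) simp_all
    have "block_form ?f S b b a 0"
      using block by (simp add: block_form_def)
    moreover have "form_S3 ?f K mu"
      using form 3 by (simp add: form_S3_def form_Z3_def)
    ultimately have "type_S3 S K ?f"
      unfolding f.type_iff(5)[OF S K] using 3 by blast
    then show ?thesis
      using that[OF f.onb_axioms] by (simp add: normal_form_def)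
  next
    case 4
    then have "type_Z3 S K e"
      unfolding type_iff(7)[OF S K] using form block by blast
    then show ?thesis
      using that[OF onb_axioms] by (simp add: normal_form_def)
  next
    case 5
    define s v :: real where "s = 1 / sqrt 3" and "v = 1 / sqrt 2"
    have s: "s * s = 1 / 3" "s * (s * x) = x / 3" for x
      by (simp_all add: s_def field_simps)
    have v: "v * v = 1 / 2" "v * (v * x) = x / 2" for x
      by (simp_all add: v_def field_simps)
    have mu: "mu = 2 * v * lam" and "s > 0"
      using 5 by (simp_all add: v_def s_def field_simps)
    \<comment> \<open>Three orthonormal axes that make equal angles with the vertex direction: in
      the new basis \<open>e 1\<close> is \<open>s\<close> times the sum of the basis vectors.
      Evaluating the form at \<open>e 1\<close> gives the new parameter \<open>sqrt 3 * lam\<close>,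
      that is, \<open>3 * s * lam\<close>.\<close>
    let ?f = "triple (comb e s (2 * s * v) 0) (comb e s (- s * v) v) (comb e s (- s * v) (- v))"
    interpret f: onb ?f
      by (rule onb_triple) (simp_all add: s v algebra_simps)
    have "form_Z2 ?f K 0 (3 * s * lam)"
      unfolding form_Z2_def
    proof (intro allI)
      fix x y z x' y' z' :: real
      show "K (comb ?f x y z) (comb ?f x' y' z') =
        comb ?f (0 * (2*x*x' - y*y' - z*z') + 3 * s * lam * (y*z' + z*y')) (3 * s * lam * (x*z' + z*x') - 0 * (x*y' + y*x'))
          (3 * s * lam * (x*y' + y*x') - 0 * (x*z' + z*x'))"
        using form unfolding mu by (simp add: form_Z3_def) (simp add: s v field_simps)
    qed
    moreover have "S = (\<lambda>X. a *\<^sub>R X)"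
      using block 5 block_form_scalar by blast
    moreover have "3 * s * lam > 0"
      using 5 \<open>s > 0\<close> by simp
    ultimately have "type_A4 S K ?f"
      unfolding f.type_iff(4)[OF S K] by blast
    then show ?thesis
      using that[OF f.onb_axioms] by (simp add: normal_form_def)
  qed
qed

text \<open>Wherever the side condition of \<open>type_Z2\<close> fails, the pair has more symmetry
  than one half turn and belongs to another type.\<close>

lemma normal_form_of_form_Z2:
  assumes S: "linear S" and K: "bilinear K" and form: "form_Z2 e K lam mu" and block: "block_form e S a b c d"
    and "lam \<ge> 0" "mu \<ge> 0"
  obtains f where "onb f" "normal_form S K f"
proof (cases "type_Z2 S K e")
  case True
  then show ?thesis
    using that[OF onb_axioms] by (simp add: normal_form_def)
next
  case False
  then have nZ2: "\<not> (lam > 0 \<and> mu > 0 \<and> lam \<noteq> mu \<or>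
      lam = mu \<and> mu > 0 \<and> (b - c)^2 + (b + c - 2*a - 2*d)^2 \<noteq> 0 \<or>
      lam = 0 \<and> mu > 0 \<and> d \<noteq> 0 \<or>
      mu = 0 \<and> lam > 0 \<and> (b - c)^2 + d^2 \<noteq> 0)"
    using form block unfolding type_iff(8)[OF S K] by blast
  consider "lam = 0" "mu = 0" | "lam > 0" "mu = 0" | "lam = 0" "mu > 0" | "lam > 0" "lam = mu"
    using nZ2 \<open>lam \<ge> 0\<close> \<open>mu \<ge> 0\<close> by force
  then show thesis
  proof cases
    case 1
    then have "K = (\<lambda>X Y. 0)"
      using form form_0_iff by simp
    moreover obtain f b' c' where f: "onb f" "block_form f S a b' c' 0"
      using block_form_diagonal[OF block] .
    ultimately show ?thesis
      by (intro onb.normal_form_K_0[OF f(1) S K _ f(2) that])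
  next
    case 2
    then have "(b - c)^2 + d^2 = 0"
      using nZ2 by auto
    then have "b = c" "d = 0"
      by (auto simp: sum_power2_eq_zero_iff)
    moreover have "form_Z3 e K lam 0"
      using form 2 by (simp add: form_Z3_def form_Z2_def)
    ultimately have "type_SO2 S K e"
      unfolding type_iff(3)[OF S K] using 2 block by blast
    then show ?thesis
      using that[OF onb_axioms] by (simp add: normal_form_def)
  next
    case 3
    then have d: "d = 0"
      using nZ2 by auto
    show ?thesis
    proof (cases "a = b \<and> b = c")
      case True
      then have "S = (\<lambda>X. a *\<^sub>R X)"
        using block d block_form_scalar by blast
      then have "type_A4 S K e"
        unfolding type_iff(4)[OF S K] using 3 form by blast
      then show ?thesis
        using that[OF onb_axioms] by (simp add: normal_form_def)
    next
      case False
      then have "type_Z2_Z2 S K e"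
        unfolding type_iff(6)[OF S K] using 3 form block d by blast
      then show ?thesis
        using that[OF onb_axioms] by (simp add: normal_form_def)
    qed
  next
    case 4
    then have "(b - c)^2 + (b + c - 2*a - 2*d)^2 = 0"
      using nZ2 by auto
    then have bc: "b = a + d" "c = a + d"
      by (auto simp: sum_power2_eq_zero_iff)
    define v :: real where "v = 1 / sqrt 2"
    have v: "v * v = 1 / 2" "v * (v * x) = x / 2" for x
      by (simp_all add: v_def field_simps)
    \<comment> \<open>For \<open>lam = mu\<close> the form is
      \<open>lam * (2 * x^3 - 3 * x * (y - z)^2)\<close>, which involves only \<open>x\<close> and
      \<open>y - z\<close>: a triangle form in the plane orthogonal to the third vector. On that
      plane \<open>S\<close> has the eigenvalue \<open>a = b - d\<close>, and \<open>b + d\<close>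
      on the normal.\<close>
    let ?f = "triple (comb e 1 0 0) (comb e 0 v (- v)) (comb e 0 v v)"
    interpret f: onb ?f
      by (rule onb_triple) (simp_all add: v)
    have "block_form ?f S a a (b + d) 0"
      using block unfolding bc by (simp add: block_form_def algebra_simps)
    moreover have "form_S3 ?f K (2 * lam)"
      using form 4 by (simp add: form_S3_def form_Z2_def) (simp add: v algebra_simps)
    ultimately have "type_S3 S K ?f"
      unfolding f.type_iff(5)[OF S K] using 4 by (meson mult_pos_pos zero_less_numeral)
    then show ?thesis
      using that[OF f.onb_axioms] by (simp add: normal_form_def)
  qed
qed

end

lemma normal_form_exists:
  fixes S :: "'a::euclidean_space \<Rightarrow> 'a"
  assumes DIM: "DIM('a) = 3" and S: "linear S" "\<And>X Y. S X \<bullet> Y = X \<bullet> S Y"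
    and K: "bilinear K" "totally_symmetric K" "\<And>X. endo_trace (K X) = 0"
    and g: "g \<in> stab S K" "g \<noteq> id"
  obtains e where "onb e" "normal_form S K e"
proof -
  note gS = stabD(1)[OF g(1)]
  \<comment> \<open>The cubic form is odd, so one of the two directions of the axis gives a
    nonnegative value, which becomes \<open>2 * lam\<close>.\<close>
  have "\<exists>u. norm u = 1 \<and> g u = u \<and> K u u \<bullet> u \<ge> 0"
  proof -
    obtain u where u: "norm u = 1" "g u = u"
      using rotation_axis[OF DIM gS] .
    have "K (- u) (- u) \<bullet> (- u) = - (K u u \<bullet> u)"
      by (simp add: bilinear_lneg[OF K(1)] bilinear_rneg[OF K(1)])
    moreover have "norm (- u) = 1" "g (- u) = - u"
      using u linear_neg[OF SO_linear[OF gS]] by auto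
    ultimately show ?thesis
      using u by (metis linear neg_0_le_iff_le)
  qed
  then obtain u where u: "norm u = 1" "g u = u" "K u u \<bullet> u \<ge> 0"
    by auto
  obtain e :: "3 \<Rightarrow> 'a" where "onb e" and e1: "e 1 = u"
    using onb_first[OF DIM u(1)] .
  interpret onb e by fact
  obtain p q r t m k l where Ke:
    "K (e 1) (e 1) = comb e p q r" "K (e 1) (e 2) = comb e q t m" "K (e 1) (e 3) = comb e r m (- p - t)"
    "K (e 2) (e 1) = comb e q t m" "K (e 2) (e 2) = comb e t k l" "K (e 2) (e 3) = comb e m l (- q - k)"
    "K (e 3) (e 1) = comb e r m (- p - t)" "K (e 3) (e 2) = comb e m l (- q - k)"
    "K (e 3) (e 3) = comb e (- p - t) (- q - k) (- r - l)"
    using tensor_coordinates[OF K] by metis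
  have "g (e 1) = e 1"
    using u(2) e1 by simp
  then obtain c s where gcs: "\<forall>x y z. g (comb e x y z) = comb e x (c*y - s*z) (s*y + c*z)" and cs: "c^2 + s^2 = 1"
    using SO_E_axis[OF gS] by metis
  have g2: "g (e 2) = comb e 0 c s" "g (e 1) = e 1"
    using gcs[rule_format, of 0 1 0] gcs[rule_format, of 1 0 0] by (simp_all flip: comb_unit)
  have "c \<noteq> 1"
  proof
    assume "c = 1"
    then have "s = 0"
      using cs by simp
    then have "g = id"
      using g2 \<open>c = 1\<close> by (intro SO_eqI[OF gS SO_id]) simp_all
    then show False
      using g(2) by simp
  qed
  \<comment> \<open>A rotation of the plane other than the identity fixes only the zero vector;
    \<open>(1 - c)^2 + s^2\<close> is the determinant of the linear system.\<close>
  have fixed: "y = 0 \<and> z = 0" if "c * y - s * z = y" "s * y + c * z = z" for y z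
  proof -
    have yz: "(1 - c) * y = - (s * z)" "(1 - c) * z = s * y"
      using that by (simp_all add: algebra_simps)
    have "((1 - c)^2 + s^2) * y = (1 - c) * ((1 - c) * y) + s * (s * y)"
      "((1 - c)^2 + s^2) * z = (1 - c) * ((1 - c) * z) + s * (s * z)"
      by algebra+
    moreover have "(1 - c) * (- (s * z)) + s * ((1 - c) * z) = 0" "(1 - c) * (s * y) - s * ((1 - c) * y) = 0"
      by algebra+
    ultimately have "((1 - c)^2 + s^2) * y = 0" "((1 - c)^2 + s^2) * z = 0"
      unfolding yz by simp_all
    moreover have "(1 - c)^2 + s^2 \<noteq> 0"
      using \<open>c \<noteq> 1\<close> by (simp add: sum_power2_eq_zero_iff)
    ultimately show ?thesis
      by (simp only: mult_eq_0_iff) blast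
  qed
  have "p \<ge> 0"
    using u(3) by (simp add: Ke flip: e1)
  \<comment> \<open>\<open>K (e 1) (e 1)\<close> is fixed by \<open>g\<close> since
    \<open>e 1\<close> is, so it has no component in the plane. The same argument applies to
    \<open>S (e 1)\<close> below.\<close>
  have qr: "q = 0" "r = 0"
    using fixed[of q r] stabD(2)[OF g(1), of "e 1" "e 1"] by (simp_all add: g2 Ke gcs)
  obtain a \<alpha> \<beta> where S1: "S (e 1) = comb e a \<alpha> \<beta>" by (rule comb_exhaust)
  have "\<alpha> = 0" "\<beta> = 0"
    using fixed[of \<alpha> \<beta>] stabD(3)[OF g(1), of "e 1"] by (simp_all add: g2 S1 gcs)
  then have S1': "S (e 1) = a *\<^sub>R e 1"
    using S1 by (simp add: comb_def)
  obtain b d c' where block: "block_form e S a b c' d"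
    using symmetric_block_form[OF S S1'] by metis
  have K12: "K (g (e 1)) (g (e 2)) = g (K (e 1) (e 2))" and K22: "K (g (e 2)) (g (e 2)) = g (K (e 2) (e 2))"
    and S2: "S (g (e 2)) = g (S (e 2))"
    using stabD(2,3)[OF g(1)] by auto
  \<comment> \<open>\<open>m\<close> and \<open>p + 2 * t\<close> are the weight 2 coefficients;
    they turn by twice the angle and can survive only if the sine \<open>s\<close> vanishes.\<close>
  have K12': "s * m = 0" "s * (p + 2 * t) = 0"
  proof -
    have "linear (K (e 1))"
      using K(1) by (simp add: bilinear_def)
    then have "K (e 1) (comb e 0 c s) = c *\<^sub>R K (e 1) (e 2) + s *\<^sub>R K (e 1) (e 3)"
      by (simp add: comb_linear)
    then have "s = 0 \<or> m = 0" "s = 0 \<or> 2 * t = - p"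
      using K12 unfolding g2 by (auto simp: Ke gcs qr)
    then show "s * m = 0" "s * (p + 2 * t) = 0"
      by auto
  qed
  have "S (comb e 0 1 0) = comb e 0 b d"
    using block by (simp add: block_form_def)
  then have "b * c + d * s = c * b - s * d" "d * c + c' * s = s * b + c * d"
    using S2 block unfolding g2 by (simp_all add: block_form_def gcs flip: comb_unit)
  then have S2': "s * d = 0" "s * (c' - b) = 0"
    by (simp_all add: algebra_simps)
  show thesis
  \<comment> \<open>If the angle is not pi, \<open>k\<close> and \<open>l\<close> are left free.
    Angles other than thirds of a full turn need no separate case: whether \<open>mu\<close>
    vanishes is decided in \<open>normal_form_of_form_Z3\<close>.\<close>
  proof (cases "s = 0")
    case False
    define lam where "lam = p / 2"
    have p: "p = 2 * lam" "t = - lam" "m = 0" "lam \<ge> 0"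
      using K12' False \<open>p \<ge> 0\<close> by (simp_all add: lam_def)
    have "block_form e S a b b 0"
      using S2' False block by simp
    then obtain f mu where f: "onb f" "mu \<ge> 0" "form_Z3 f K lam mu" "block_form f S a b b 0"
      using form_Z3_exists[OF K(1) _, of S a b lam k l] Ke by (auto simp: p qr)
    show ?thesis
      by (rule onb.normal_form_of_form_Z3[OF f(1) S(1) K(1) f(3,4) p(4) f(2) that])
  next
    case True
    then have "c = - 1"
      using cs \<open>c \<noteq> 1\<close> power2_eq_1_iff by auto
    then have "g (e 2) = comb e 0 (- 1) 0"
      using g2 True by simp
    \<comment> \<open>The half turn is -1 on the plane, where the bilinear map \<open>K\<close> does
      not notice the sign; so \<open>K (e 2) (e 2)\<close> is fixed by \<open>g\<close> and its
      plane component vanishes.\<close>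
    then have "k = 0" "l = 0"
      using K22 unfolding g2 comb_bilinear[OF K(1)] by (simp_all add: Ke gcs True \<open>c = - 1\<close>)
    define lam where "lam = p / 2"
    have p: "p = 2 * lam" "lam \<ge> 0"
      using \<open>p \<ge> 0\<close> by (simp_all add: lam_def)
    obtain f mu where f: "onb f" "f 1 = e 1" "mu \<ge> 0" "form_Z2 f K lam mu"
      using form_Z2_exists[OF K(1), of lam t m] Ke by (auto simp: p qr \<open>k = 0\<close> \<open>l = 0\<close>)
    \<comment> \<open>The plane has been turned, but \<open>f 1 = e 1\<close> is still an
      eigenvector of \<open>S\<close> for \<open>a\<close>, so \<open>S\<close> keeps the block
      shape with new entries.\<close>
    obtain b' c' d' where block': "block_form f S a b' c' d'"
      using onb.symmetric_block_form[OF f(1) S, of a] S1' f(2) by metis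
    show ?thesis
      by (rule onb.normal_form_of_form_Z2[OF f(1) S(1) K(1) f(4) block' p(2) f(3) that])
  qed
qed

lemma (in frame) stabilizer_of_normal_form:
  assumes S: "linear S" and K: "bilinear K"
  defines "G \<equiv> stabilizer_group S K"
  shows
    "type_SO3 S K e \<Longrightarrow> G = special_orthogonal_group \<and> G \<cong> model_SO3"
    "type_Z2_SO2 S K e \<Longrightarrow>
       G = generated_by (range (rotation \<omega> (e 1)) \<union> {rot_P \<omega> e 2}) \<and> G \<cong> model_Z2_SO2"
    "type_SO2 S K e \<Longrightarrow> carrier G = range (rotation \<omega> (e 1)) \<and> G \<cong> model_SO2"
    "type_A4 S K e \<Longrightarrow> G = generated_by {rot_P \<omega> e 1, rot_P \<omega> e 2, rot_Q \<omega> e} \<and> G \<cong> model_A4"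
    "type_S3 S K e \<Longrightarrow> G = generated_by {rot_P \<omega> e 1, rot_R \<omega> e 3} \<and> G \<cong> model_S3"
    "type_Z2_Z2 S K e \<Longrightarrow> G = generated_by {rot_P \<omega> e 1, rot_P \<omega> e 2} \<and> G \<cong> model_Z2_Z2"
    "type_Z3 S K e \<Longrightarrow> G = generated_by {rot_R \<omega> e 1} \<and> G \<cong> model_Z3"
    "type_Z2 S K e \<Longrightarrow> G = generated_by {rot_P \<omega> e 1} \<and> G \<cong> model_Z2"
proof -
  note type = type_iff[OF S K]
  show "G = special_orthogonal_group \<and> G \<cong> model_SO3" if t: "type_SO3 S K e"
  proof -
    obtain a where KS: "K = (\<lambda>X Y. 0)" "S = (\<lambda>X. a *\<^sub>R X)"
      using t unfolding type by auto
    have "g 0 = 0 \<and> (\<forall>X. g (a *\<^sub>R X) = a *\<^sub>R g X)" if "g \<in> SO" for g :: "'a \<Rightarrow> 'a"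
      using linear_0[OF SO_linear[OF that]] linear_cmul[OF SO_linear[OF that]] by blast
    then have "stab S K = SO"
      unfolding stab_def KS by auto
    then have "G = special_orthogonal_group"
      by (simp add: G_def stabilizer_group_eq special_orthogonal_group_def)
    then show ?thesis
      using SO_iso_model by simp
  qed
  show "G = generated_by (range (rotation \<omega> (e 1)) \<union> {rot_P \<omega> e 2}) \<and> G \<cong> model_Z2_SO2" if t: "type_Z2_SO2 S K e"
  proof -
    obtain a b where KS: "K = (\<lambda>X Y. 0)" "block_form e S a b b 0" "a \<noteq> b"
      using t unfolding type by auto
    have "G = sub_SO {g \<in> SO. g (e 1) = e 1 \<or> g (e 1) = - e 1}"
      unfolding G_def stabilizer_group_eq KS(1) stab_axis_line[OF KS(2,3)] ..
    then show ?thesis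
      using axis_line_iso axis_line_generated by metis
  qed
  show "carrier G = range (rotation \<omega> (e 1)) \<and> G \<cong> model_SO2" if t: "type_SO2 S K e"
  proof -
    obtain lam a b where KS: "form_Z3 e K lam 0" "block_form e S a b b 0" "lam > 0"
      using t unfolding type by auto
    have "G = sub_SO (range (rotation \<omega> (e 1)))"
      unfolding G_def stabilizer_group_eq stab_axis[OF KS] ..
    then show ?thesis
      using axis_group_iso by simp
  qed
  show "G = generated_by {rot_P \<omega> e 1, rot_P \<omega> e 2, rot_Q \<omega> e} \<and> G \<cong> model_A4" if "type_A4 S K e"
    using that unfolding type G_def using stab_A4_generated A4_iso by blast
  show "G = generated_by {rot_P \<omega> e 1, rot_R \<omega> e 3} \<and> G \<cong> model_S3" if "type_S3 S K e"
    using that unfolding type G_def using stab_S3_generated S3_iso by blast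
  show "G = generated_by {rot_P \<omega> e 1, rot_P \<omega> e 2} \<and> G \<cong> model_Z2_Z2" if "type_Z2_Z2 S K e"
  proof -
    have "G = generated_by {rot_P \<omega> e 1, rot_P \<omega> e 2}"
      using that stab_Z2_Z2_generated unfolding type G_def by blast
    then show ?thesis
      using Z2_Z2_iso by simp
  qed
  show "G = generated_by {rot_R \<omega> e 1} \<and> G \<cong> model_Z3" if "type_Z3 S K e"
  proof -
    have "G = generated_by {rot_R \<omega> e 1}"
      using that stab_Z3_generated unfolding type G_def by blast
    then show ?thesis
      using Z3_iso by simp
  qed
  show "G = generated_by {rot_P \<omega> e 1} \<and> G \<cong> model_Z2" if "type_Z2 S K e"
  proof -
    have "G = generated_by {rot_P \<omega> e 1}"
      using that stab_Z2_generated unfolding type G_def by blast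
    then show ?thesis
      using Z2_iso by simp
  qed
qed

theorem theorem2p2:
  fixes \<omega> :: "'a::euclidean_space \<Rightarrow> 'a \<Rightarrow> 'a \<Rightarrow> real"
    and S :: "'a \<Rightarrow> 'a"
    and K :: "'a \<Rightarrow> 'a \<Rightarrow> 'a"
  assumes "DIM('a) = 3"
    and "volume_form \<omega>"
    and "linear S" and "\<And>X Y. S X \<bullet> Y = X \<bullet> S Y"
    and "bilinear K" and "totally_symmetric K"
    and "\<And>X. endo_trace (K X) = 0"
    and "carrier (stabilizer_group S K) \<noteq> {id}"
  shows "let G = stabilizer_group S K in
    (G \<cong> model_SO3 \<or> G \<cong> model_Z2_SO2 \<or> G \<cong> model_SO2 \<or> G \<cong> model_A4 \<or>
     G \<cong> model_S3 \<or> G \<cong> model_Z2_Z2 \<or> G \<cong> model_Z3 \<or> G \<cong> model_Z2) \<and>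
    (\<exists>e. orthonormal_basis e \<and>
       (type_SO3 S K e \<or> type_Z2_SO2 S K e \<or> type_SO2 S K e \<or> type_A4 S K e \<or>
        type_S3 S K e \<or> type_Z2_Z2 S K e \<or> type_Z3 S K e \<or> type_Z2 S K e)) \<and>
    (\<forall>e. orthonormal_basis e \<longrightarrow>
       (type_SO3 S K e \<longrightarrow> G = special_orthogonal_group \<and> G \<cong> model_SO3) \<and>
       (type_Z2_SO2 S K e \<longrightarrow>
          G = generated_by (range (rotation \<omega> (e 1)) \<union> {rot_P \<omega> e 2}) \<and> G \<cong> model_Z2_SO2) \<and>
       (type_SO2 S K e \<longrightarrow> carrier G = range (rotation \<omega> (e 1)) \<and> G \<cong> model_SO2) \<and>
       (type_A4 S K e \<longrightarrow>
          G = generated_by {rot_P \<omega> e 1, rot_P \<omega> e 2, rot_Q \<omega> e} \<and> G \<cong> model_A4) \<and>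
       (type_S3 S K e \<longrightarrow> G = generated_by {rot_P \<omega> e 1, rot_R \<omega> e 3} \<and> G \<cong> model_S3) \<and>
       (type_Z2_Z2 S K e \<longrightarrow>
          G = generated_by {rot_P \<omega> e 1, rot_P \<omega> e 2} \<and> G \<cong> model_Z2_Z2) \<and>
       (type_Z3 S K e \<longrightarrow> G = generated_by {rot_R \<omega> e 1} \<and> G \<cong> model_Z3) \<and>
       (type_Z2 S K e \<longrightarrow> G = generated_by {rot_P \<omega> e 1} \<and> G \<cong> model_Z2))"
proof -
  have frame: "frame e \<omega>" if "orthonormal_basis e" for e
    using that assms(2) by (simp add: frame_def onb_def frame_axioms_def)
  note stabilizer = frame.stabilizer_of_normal_form[OF frame assms(3,5)]
  obtain b :: "3 \<Rightarrow> 'a" where "onb b"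
    using ex_onb[OF assms(1)] by metis
  then have "id \<in> stab S K"
    using onb.SO_id by (auto simp: stab_def)
  then obtain g where g: "g \<in> stab S K" "g \<noteq> id"
    using assms(8) by (auto simp: stabilizer_group_eq)
  obtain e where e: "onb e" "normal_form S K e"
    using normal_form_exists[OF assms(1,3-7) g] .
  then have o: "orthonormal_basis e"
    by (simp add: onb_def)
  show ?thesis
    unfolding Let_def
  proof (intro conjI)
    show "stabilizer_group S K \<cong> model_SO3 \<or> stabilizer_group S K \<cong> model_Z2_SO2 \<or>
      stabilizer_group S K \<cong> model_SO2 \<or> stabilizer_group S K \<cong> model_A4 \<or>
      stabilizer_group S K \<cong> model_S3 \<or> stabilizer_group S K \<cong> model_Z2_Z2 \<or>
      stabilizer_group S K \<cong> model_Z3 \<or> stabilizer_group S K \<cong> model_Z2"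
      using e(2) stabilizer[OF o] unfolding normal_form_def by blast
    show "\<exists>e. orthonormal_basis e \<and>
       (type_SO3 S K e \<or> type_Z2_SO2 S K e \<or> type_SO2 S K e \<or> type_A4 S K e \<or>
        type_S3 S K e \<or> type_Z2_Z2 S K e \<or> type_Z3 S K e \<or> type_Z2 S K e)"
      using e(2) o unfolding normal_form_def by blast
  qed (intro allI impI conjI; blast dest: stabilizer)
qed

end
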